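(* Let $\mathscr{X}$ be a compact metric space, and let $(\mu_n \in \mathcal{M}^+_1(\mathscr{X}^n) : n \in \mathbb{N}_+)$ be a thinning-invariant triangular array, i.e. $T^n_k \mu_n = \mu_k$ for all $k,n \in \mathbb{N}_+$ with $k \le n$. Then there exists a unique Borel probability measure $P \in \mathcal{M}^+_1(\mathcal{K})$ such that for every $n \in \mathbb{N}_+$, $$\mu_n(dX_1\otimes\cdots\otimes dX_n) = \int_{\mathcal{K}} \int_{\Delta^{n}} \mu(dX_1,t_1)\cdots \mu(dX_n,t_n)\, n!\, dt_1\cdots dt_n\, P(d\mu),$$ where $\Delta^n = \{(t_1,\dots,t_n) : 0<t_1<\dots<t_n<1\}$.
   Context: $\mathbb{N}_+ = \{1,2,3,\dots\}$. For a compact metric space $Y$, $\mathcal{M}^+_1(Y)$ denotes the set of Borel probability measures on $Y$, and $\mathcal{C}(Y)$ the Banach space of continuous real-valued functions on $Y$ with the sup norm. $\mathcal{M}^+_1(\mathscr{X})$ carries the vague (weak-$*$) topology, generated by the maps $\mu \mapsto \int f\,d\mu$, $f \in \mathcal{C}(\mathscr{X})$. The interval $[0,1]$ carries its Borel $\sigma$-algebra and Lebesgue measure. Thinning. For $k \le n$ in $\mathbb{N}_+$, the map $T^n_k : \mathcal{M}^+_1(\mathscr{X}^n) \to \mathcal{M}^+_1(\mathscr{X}^k)$ is defined by $$(T^{n}_k \mu_n)(\{X_1 \in A_1,\ldots, X_k \in A_k\}) = \binom{n}{k}^{-1} \sum_{1\leq i_1<\dots<i_k\leq n} \mu_n(\{X_{i_1}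 \in A_1,\ldots,X_{i_k} \in A_k\})$$ for all Borel sets $A_1,\dots,A_k \subset \mathscr{X}$, where $X_1, X_2,\dots$ denote the coordinate maps. That is, $T^n_k\mu_n$ is the law of the subsequence indexed by a uniformly random $k$-subset of $\{1,\dots,n\}$, with the order kept. The space $\mathcal{K}$. $\mathcal{K}$ is the set of Borel measurable functions $t \mapsto \mu(\cdot,t)$ from $[0,1]$ to $\mathcal{M}^+_1(\mathscr{X})$, defined for Lebesgue-a.e. $t$ and identified when they agree for Lebesgue-a.e. $t$; measurability means that $t \mapsto \int_{\mathscr{X}} f(x)\,\mu(dx,t)$ is Borel for every $f \in \mathcal{C}(\mathscr{X})$. (Equivalently, via $\nu(dx\otimes dt) = \mu(dx,t)\,dt$, $\mathcal{K}$ is the set of Borel probability measures $\nu$ on $\mathscr{X}\times[0,1]$ such that $\nu(\mathscr{X}\times E)$ is the Lebesgue measure of $E$ for every Borel $E \subset [0,1]$.) Topology of $\mathcal{K}$. Let $\mathcal{L} = L^1([0,1],\mathcal{C}(\mathscr{X}))$ with norm $\|F\|_{\mathcal{L}} = \int_0^1 \max_{x}|F(x,t)|\,dt$, i.e. the closure in this norm of the functions $\sum_{j=1}^N \mathbf{1}_{E_j}(t) f_j(x)$ with $N\in\mathbb{N}_+$, $E_j \subset [0,1]$ Borel and $f_j \in \mathcal{C}(\mathscr{X})$. $\mathcal{K}$ is given the weakest topology making all the maps $\mu \mapsto \langle \mu, F\rangle := \int_0^1 \int_{\mathscr{X}} F(x,t)\,\mu(dx,t)\,dt$, $F \in \mathcal{L}$,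 continuous; with this topology $\mathcal{K}$ is compact and metrizable. $\mathcal{M}^+_1(\mathcal{K})$ is the set of Borel probability measures on $\mathcal{K}$. The displayed identity of measures means that for every $f \in \mathcal{C}(\mathscr{X}^n)$, $$\int_{\mathscr{X}^n} f\, d\mu_n = \int_{\mathcal{K}} \left( \int_{\Delta^n} \left[\int_{\mathscr{X}^n} f(X_1,\dots,X_n)\, \mu(dX_1,t_1)\cdots\mu(dX_n,t_n)\right] n!\, dt_1\cdots dt_n \right) P(d\mu).$$ *)

theory Defs
  imports "HOL-Probability.Probability"
begin

abbreviation unit_lborel :: "real measure"
  where "unit_lborel \<equiv> restrict_space lborel {0..1}"

text \<open>The elements of \<open>X\<^sup>n\<close> are the extensional functions on \<open>{1..n}\<close>.  For a separable
  metric space the product sigma-algebra used here is the Borel sigma-algebra of \<open>X\<^sup>n\<close>.\<close>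

abbreviation borel_pow :: "nat \<Rightarrow> (nat \<Rightarrow> 'a::topological_space) measure"
  where "borel_pow n \<equiv> PiM {1..n} (\<lambda>_. borel)"

abbreviation pow_topology :: "nat \<Rightarrow> (nat \<Rightarrow> 'a::topological_space) topology"
  where "pow_topology n \<equiv> product_topology (\<lambda>_. euclidean) {1..n}"

definition increasing_indices :: "nat \<Rightarrow> nat \<Rightarrow> (nat \<Rightarrow> nat) set"
  where "increasing_indices k n = {i \<in> {1..k} \<rightarrow>\<^sub>E {1..n}. strict_mono_on {1..k} i}"

definition thinning ::
    "nat \<Rightarrow> nat \<Rightarrow> (nat \<Rightarrow> 'a::topological_space) measure \<Rightarrow> (nat \<Rightarrow> 'a) measure"
  where "thinning n k M = measure_of (space (borel_pow k)) (sets (borel_pow k))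
    (\<lambda>A. (\<Sum>i\<in>increasing_indices k n.
            emeasure M {x \<in> space M. (\<lambda>j\<in>{1..k}. x (i j)) \<in> A}) / of_nat (n choose k))"

lemma finite_increasing_indices: "finite (increasing_indices k n)"
proof -
  have "finite ({1..k} \<rightarrow>\<^sub>E {1..n})" by (intro finite_PiE) auto
  then show ?thesis unfolding increasing_indices_def by (rule rev_finite_subset) auto
qed

lemma sets_thinning [simp]: "sets (thinning n k M) = sets (borel_pow k)"
  unfolding thinning_def by (rule sets.sets_measure_of_eq)

lemma space_thinning [simp]: "space (thinning n k M) = space (borel_pow k)"
  by (rule sets_eq_imp_space_eq) (rule sets_thinning)

lemma emeasure_thinning:
  assumes M: "sets M = sets (borel_pow n)" and A: "A \<in> sets (borel_pow k)"
  shows "emeasure (thinning n k M) A =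
    (\<Sum>i\<in>increasing_indices k n.
       emeasure M {x \<in> space M. (\<lambda>j\<in>{1..k}. x (i j)) \<in> A}) / of_nat (n choose k)"
proof -
  let ?B = "borel_pow k :: (nat \<Rightarrow> 'a) measure"
  let ?g = "\<lambda>i x. \<lambda>j\<in>{1..k}. x (i j)"
  have meas: "?g i \<in> measurable M ?B" if i: "i \<in> increasing_indices k n" for i
  proof -
    have "?g i \<in> measurable (borel_pow n) ?B"
    proof (rule measurable_restrict)
      fix j assume "j \<in> {1..k}"
      with i have "i j \<in> {1..n}" by (auto simp: increasing_indices_def)
      then show "(\<lambda>x. x (i j)) \<in> borel_measurable (borel_pow n)" by simp
    qed
    then show ?thesis by (simp cong: measurable_cong_sets add: M)
  qed
  have vim: "emeasure M {x \<in> space M. ?g i x \<in> B} = emeasure (distr M ?B (?g i)) B"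
    if "i \<in> increasing_indices k n" "B \<in> sets ?B" for i B
    using that by (subst emeasure_distr[OF meas]) (auto intro!: arg_cong[where f="emeasure M"])
  let ?mu = "\<lambda>B. (\<Sum>i\<in>increasing_indices k n. emeasure M {x \<in> space M. ?g i x \<in> B})
                  / of_nat (n choose k)"
  have ca: "countably_additive (sets ?B) ?mu"
    unfolding countably_additive_def
  proof (intro allI impI)
    fix F :: "nat \<Rightarrow> (nat \<Rightarrow> 'a) set"
    assume F: "range F \<subseteq> sets ?B" "disjoint_family F" "\<Union> (range F) \<in> sets ?B"
    have F': "F m \<in> sets ?B" for m using F(1) by auto
    have "(\<Sum>m. ?mu (F m)) = (\<Sum>m. (\<Sum>i\<in>increasing_indices k n.
        emeasure (distr M ?B (?g i)) (F m)) / of_nat (n choose k))"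
      by (simp only: vim F' cong: sum.cong)
    also have "\<dots> = (\<Sum>i\<in>increasing_indices k n. \<Sum>m.
        emeasure (distr M ?B (?g i)) (F m)) / of_nat (n choose k)"
      by (simp add: divide_ennreal_def suminf_sum)
    also have "\<dots> = (\<Sum>i\<in>increasing_indices k n.
        emeasure (distr M ?B (?g i)) (\<Union> (range F))) / of_nat (n choose k)"
      using F by (subst suminf_emeasure) auto
    also have "\<dots> = ?mu (\<Union> (range F))"
      by (simp only: vim F(3) cong: sum.cong)
    finally show "(\<Sum>m. ?mu (F m)) = ?mu (\<Union> (range F))" .
  qed
  have "thinning n k M = measure_of (space ?B) (sets ?B) ?mu" by (simp add: thinning_def)
  then show ?thesis
    by (rule emeasure_measure_of)
      (use A sets.space_closed ca in \<open>simp_all only: sets_thinning, simp_all add: positive_def\<close>)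
qed

lemma emeasure_thinning_box:
  assumes M: "sets M = sets (borel_pow n)" and A: "\<And>j. j \<in> {1..k} \<Longrightarrow> A j \<in> sets borel"
  shows "emeasure (thinning n k M) {y \<in> space (borel_pow k). \<forall>j\<in>{1..k}. y j \<in> A j} =
    (\<Sum>i\<in>increasing_indices k n.
       emeasure M {x \<in> space M. \<forall>j\<in>{1..k}. x (i j) \<in> A j}) / of_nat (n choose k)"
proof -
  have eq: "{y \<in> space (borel_pow k). \<forall>j\<in>{1..k}. y j \<in> A j} = PiE {1..k} A"
    by (auto simp: space_PiM PiE_def)
  have "PiE {1..k} A \<in> sets (borel_pow k)" using A by (intro sets_PiM_I_finite) auto
  then show ?thesis unfolding eq by (subst emeasure_thinning[OF M]) (auto simp: PiE_iff)
qed

definition is_kernel :: "(real \<Rightarrow> 'a::topological_space measure) \<Rightarrow> bool"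
  where "is_kernel m \<longleftrightarrow> (\<forall>t\<in>{0..1}. m t \<in> space (prob_algebra borel)) \<and>
    (\<forall>f :: 'a \<Rightarrow>\<^sub>C real. (\<lambda>t. LINT x|m t. apply_bcontfun f x) \<in> borel_measurable unit_lborel)"

definition kernel_eq ::
    "(real \<Rightarrow> 'a::topological_space measure) \<Rightarrow> (real \<Rightarrow> 'a measure) \<Rightarrow> bool"
  where "kernel_eq m m' \<longleftrightarrow> is_kernel m \<and> is_kernel m' \<and> (AE t in unit_lborel. m t = m' t)"

text \<open>A kernel defined only almost everywhere extends to all of \<open>[0,1]\<close> by a constant
  probability measure, so total functions modulo almost everywhere equality suffice.\<close>

quotient_type (overloaded) 'a kernels = "real \<Rightarrow> 'a::topological_space measure" / partial: kernel_eq
proof (rule part_equivpI)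
  have "return borel x \<in> space (prob_algebra borel)" for x :: 'a
    by (simp add: space_prob_algebra prob_space_return)
  then have "is_kernel (\<lambda>_. return borel (undefined :: 'a))"
    by (simp add: is_kernel_def)
  then show "\<exists>m. kernel_eq m (m :: real \<Rightarrow> 'a measure)"
    by (auto simp: kernel_eq_def)
  show "symp (kernel_eq :: (real \<Rightarrow> 'a measure) \<Rightarrow> _)"
    by (intro sympI) (auto simp: kernel_eq_def elim!: AE_mp)
  show "transp (kernel_eq :: (real \<Rightarrow> 'a measure) \<Rightarrow> _)"
  proof (rule transpI)
    fix a b c :: "real \<Rightarrow> 'a measure"
    assume *: "kernel_eq a b" "kernel_eq b c"
    then have "AE t in unit_lborel. a t = b t" "AE t in unit_lborel. b t = c t"
      by (auto simp: kernel_eq_def)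
    then have "AE t in unit_lborel. a t = c t" by eventually_elim simp
    with * show "kernel_eq a c" by (auto simp: kernel_eq_def)
  qed
qed

text \<open>\<open>rep_kernels \<kappa>\<close> is an arbitrary representative of the class \<open>\<kappa>\<close>.  It is only used
  under integrals over \<open>t\<close> with respect to (powers of) Lebesgue measure, where its choice is
  immaterial.\<close>

lemma is_kernel_rep: "is_kernel (rep_kernels \<kappa>)"
  using Quotient3_rep_reflp[OF Quotient3_kernels, of \<kappa>] by (simp add: kernel_eq_def)

lemma rep_abs_kernels: "is_kernel m \<Longrightarrow> AE t in unit_lborel. rep_kernels (abs_kernels m) t = m t"
  using rep_abs_rsp_left[OF Quotient3_kernels, of m m] by (simp add: kernel_eq_def)

text \<open>The space \<open>L\<^sup>1([0,1], C(X))\<close> for compact \<open>X\<close>, where \<open>C(X)\<close> is the type of bounded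
  continuous functions.  The library's Bochner integral assumes a second countable target type,
  hence the explicit closure.\<close>

definition step_functions :: "(real \<Rightarrow> ('a::topological_space \<Rightarrow>\<^sub>C real)) set"
  where "step_functions = {\<lambda>t. \<Sum>j=1..N. indicator (E j) t *\<^sub>R f j | N E f.
    N \<ge> (1::nat) \<and> (\<forall>j\<in>{1..N}. E j \<in> sets unit_lborel)}"

definition L1_cont :: "(real \<Rightarrow> ('a::topological_space \<Rightarrow>\<^sub>C real)) set"
  where "L1_cont = {F \<in> borel_measurable unit_lborel.
    \<forall>\<epsilon>>0. \<exists>S\<in>step_functions. (\<integral>\<^sup>+t. ennreal (norm (F t - S t)) \<partial>unit_lborel) < ennreal \<epsilon>}"

definition pairing :: "'a::topological_space kernels \<Rightarrow> (real \<Rightarrow> ('a \<Rightarrow>\<^sub>C real)) \<Rightarrow> real"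
  where "pairing \<kappa> F = (LINT t|unit_lborel. LINT x|rep_kernels \<kappa> t. apply_bcontfun (F t) x)"

instantiation kernels :: (topological_space) topological_space
begin

definition open_kernels :: "'a kernels set \<Rightarrow> bool"
  where "open_kernels =
    generate_topology {{\<kappa>. pairing \<kappa> F \<in> U} | F U. F \<in> L1_cont \<and> open U}"

instance
proof
  show "open (UNIV :: 'a kernels set)"
    unfolding open_kernels_def by (rule generate_topology.UNIV)
  show "open (S \<inter> T)" if "open S" "open T" for S T :: "'a kernels set"
    using that unfolding open_kernels_def by (rule generate_topology.Int)
  show "open (\<Union> K)" if "\<forall>S\<in>K. open S" for K :: "'a kernels set set"
    using that unfolding open_kernels_def by (auto intro: generate_topology.UN)
qed

end

definition ordered_simplex :: "nat \<Rightarrow> (nat \<Rightarrow> real) set"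
  where "ordered_simplex n = {t \<in> {1..n} \<rightarrow>\<^sub>E {0<..<1}. strict_mono_on {1..n} t}"

definition simplex_mixture ::
    "nat \<Rightarrow> ((nat \<Rightarrow> 'a::topological_space) \<Rightarrow> real) \<Rightarrow> 'a kernels \<Rightarrow> real"
  where "simplex_mixture n f \<kappa> =
    (LINT t:ordered_simplex n|PiM {1..n} (\<lambda>_. lborel).
       (LINT x|PiM {1..n} (\<lambda>i. rep_kernels \<kappa> (t i)). f x) * fact n)"

end

theory Submission
  imports Defs
begin

text \<open>Turn \<open>x \<in> X\<^sup>N\<close> into the empirical kernel that is the point mass at \<open>x\<^sub>i\<close> on the \<open>i\<close>-th of \<open>N\<close> equal blocks of
  \<open>[0,1]\<close>.  By thinning invariance the laws of these kernels under \<open>\<mu> N\<close> satisfy the mixture identity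
  up to \<open>O(1/N)\<close>, so any weak limit point is a solution, and one exists since the space of kernels
  is compact and metrizable.  On this space the mixtures of products of functions on \<open>X\<close> are
  iterated integrals.  These are continuous, closed under multiplication up to linear combinations
  (shuffle product), and they contain all moments \<open>\<integral> t^i \<integral> f d\<kappa>\<^sub>t dt\<close>, hence separate points; by
  Stone-Weierstrass they determine the mixing measure.\<close>

section \<open>Weak compactness\<close>

text \<open>The kernels carry a topology but no given metric. Compactness and approximation
  arguments are therefore carried out on the image of \<open>moments c\<close>, where
  \<open>c\<close> is a dense sequence of continuous functions: these countably many coordinates
  embed the kernels into a product of real lines. That the image is compact is the point where a
  kernel has to be produced. The joint laws of a uniform time and a point drawn from the fibre have
  a weak limit, its time marginal is still uniform, and disintegration along time turns it back into
  a kernel. Weak limits and conditional laws are both reduced to the real line by a Borel code,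
  because distribution functions are available there. The error O(1/N) stems from times that share a
  block: a thinned sample uses distinct positions, whereas several of n uniform times may fall into
  one block. Products of weakly convergent fibre integrals need not converge to the product of the
  limits. Iterated integrals are continuous nevertheless, since the inner integral converges
  pointwise and boundedly and only the outer fibre converges weakly.\<close>

lemma closed_indicator_limit:
  fixes F :: "'b::metric_space set"
  assumes "closed F"
  obtains f :: "nat \<Rightarrow> 'b \<Rightarrow> real" where
    "\<And>n. continuous_on UNIV (f n)" "\<And>n x. 0 \<le> f n x" "\<And>n x. f n x \<le> 1"
    "\<And>x. (\<lambda>n. f n x) \<longlonglongrightarrow> indicator F x"
proof (cases "F = {}")
  case True
  \<comment> \<open>\<open>infdist\<close> to the empty set is 0 by convention, so the cutoff used
    below would be constantly 1 here instead of 0.\<close>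
  then show thesis by (intro that[of "\<lambda>_ _. 0"]) auto
next
  case False
  define f where "f n x = max 0 (1 - real n * infdist x F)" for n x
  show thesis
  proof (rule that[of f])
    show "continuous_on UNIV (f n)" for n
      unfolding f_def by (intro continuous_intros)
    show "0 \<le> f n x" "f n x \<le> 1" for n x by (auto simp: f_def infdist_nonneg)
    show "(\<lambda>n. f n x) \<longlonglongrightarrow> indicator F x" for x
    proof (cases "x \<in> F")
      case True
      then show ?thesis by (simp add: f_def)
    next
      case xF: False
      then have d: "infdist x F > 0"
        using infdist_pos_not_in_closed[OF assms False] by simp
      obtain N where N: "real N * infdist x F > 1"
        using reals_Archimedean3[OF d] by blast
      have "f n x = 0" if "n \<ge> N" for n
      proof -
        have "real N * infdist x F \<le> real n * infdist x F"
          using that d by (intro mult_right_mono) auto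
        then show ?thesis using N by (auto simp: f_def)
      qed
      then have "\<forall>\<^sub>F n in sequentially. f n x = indicator F x"
        using xF by (auto simp: eventually_sequentially)
      then show ?thesis by (rule tendsto_eventually)
    qed
  qed
qed

lemma measure_closed_limit:
  fixes M :: "'b::metric_space measure"
  assumes M: "prob_space M" "sets M = sets borel" and F: "closed F"
    and f: "\<And>n. continuous_on UNIV (f n)" "\<And>n x. 0 \<le> f n x" "\<And>n x. f n x \<le> (1::real)"
      "\<And>x. (\<lambda>n. f n x) \<longlonglongrightarrow> indicator F x"
  shows "(\<lambda>n. integral\<^sup>L M (f n)) \<longlonglongrightarrow> measure M F"
proof -
  interpret prob_space M by fact
  note [measurable_cong] = M(2)
  have sp: "space M = UNIV" using sets_eq_imp_space_eq[OF M(2)] by simp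
  have fm[measurable]: "f n \<in> borel_measurable M" for n
    using borel_measurable_continuous_onI[OF f(1)] by (simp cong: measurable_cong_sets add: M(2))
  have [measurable]: "F \<in> sets M" using F by (simp add: M(2))
  have "(\<lambda>n. integral\<^sup>L M (f n)) \<longlonglongrightarrow> integral\<^sup>L M (indicator F)"
    by (rule integral_dominated_convergence[where w="\<lambda>_. 1"]) (use f in auto)
  then show ?thesis by (simp add: sp)
qed

text \<open>The closed sets are an intersection-stable generator, and the cutoffs recover the mass
  of each of them. Testing only functions with values in [0,1] weakens what has to be checked and
  keeps every integrand bounded.\<close>

lemma measure_eqI_continuous:
  fixes M N :: "'b::metric_space measure"
  assumes M: "prob_space M" "sets M = sets borel" and N: "prob_space N" "sets N = sets borel"
    and eq: "\<And>f :: 'b \<Rightarrow> real. continuous_on UNIV f \<Longrightarrow> (\<And>x. 0 \<le> f x) \<Longrightarrow> (\<And>x. f x \<le> 1) \<Longrightarrow>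
      integral\<^sup>L M f = integral\<^sup>L N f"
  shows "M = N"
proof (rule measure_eqI_generator_eq[where E="{F. closed F}" and \<Omega>=UNIV and A="\<lambda>_. UNIV"])
  interpret M: prob_space M by fact
  interpret N: prob_space N by fact
  show "emeasure M F = emeasure N F" if "F \<in> {F. closed F}" for F
  proof -
    have F: "closed F" using that by simp
    obtain f :: "nat \<Rightarrow> 'b \<Rightarrow> real" where f: "\<And>n. continuous_on UNIV (f n)" "\<And>n x. 0 \<le> f n x"
      "\<And>n x. f n x \<le> 1" "\<And>x. (\<lambda>n. f n x) \<longlonglongrightarrow> indicator F x"
      using closed_indicator_limit[OF F] by metis
    have "measure M F = measure N F"
      using measure_closed_limit[OF M F f] measure_closed_limit[OF N F f] eq[OF f(1,2,3)]
      by (simp add: LIMSEQ_unique)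
    then show ?thesis by (simp add: M.emeasure_eq_measure N.emeasure_eq_measure)
  qed
  show "sets M = sigma_sets UNIV {F. closed F}" "sets N = sigma_sets UNIV {F. closed F}"
    unfolding M N borel_eq_closed by simp_all
  show "Int_stable {F::'b set. closed F}" by (auto simp: Int_stable_def)
  show "emeasure M UNIV \<noteq> \<infinity>" by (simp add: M.emeasure_eq_measure)
qed auto

text \<open>Turns weak measurability, the form in which \<open>is_kernel\<close> is stated, into
  measurability with values in the space of measures, which is what composing measures with
  \<open>bind\<close> requires. The generator is again the family of closed sets.\<close>

lemma measurable_prob_algebra_continuous:
  fixes K :: "'c \<Rightarrow> 'b::metric_space measure"
  assumes K: "\<And>a. a \<in> space M \<Longrightarrow> prob_space (K a)" "\<And>a. a \<in> space M \<Longrightarrow> sets (K a) = sets borel"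
    and meas: "\<And>f :: 'b \<Rightarrow> real. continuous_on UNIV f \<Longrightarrow> (\<And>x. 0 \<le> f x) \<Longrightarrow> (\<And>x. f x \<le> 1) \<Longrightarrow>
      (\<lambda>a. integral\<^sup>L (K a) f) \<in> borel_measurable M"
  shows "K \<in> measurable M (prob_algebra borel)"
proof (rule measurable_prob_algebra_generated[where \<Omega>=UNIV and G="{F. closed F}"])
  show "sets borel = sigma_sets UNIV {F::'b set. closed F}" unfolding borel_eq_closed by simp
  show "Int_stable {F::'b set. closed F}" by (auto simp: Int_stable_def)
  show "(\<lambda>a. emeasure (K a) F) \<in> borel_measurable M" if "F \<in> {F. closed F}" for F
  proof -
    have F: "closed F" using that by simp
    obtain f :: "nat \<Rightarrow> 'b \<Rightarrow> real" where f: "\<And>n. continuous_on UNIV (f n)" "\<And>n x. 0 \<le> f n x"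
      "\<And>n x. f n x \<le> 1" "\<And>x. (\<lambda>n. f n x) \<longlonglongrightarrow> indicator F x"
      using closed_indicator_limit[OF F] by metis
    have "(\<lambda>a. measure (K a) F) \<in> borel_measurable M"
    proof (rule borel_measurable_LIMSEQ_real)
      show "(\<lambda>n. integral\<^sup>L (K a) (f n)) \<longlonglongrightarrow> measure (K a) F" if "a \<in> space M" for a
        using measure_closed_limit[OF K[OF that] F f] .
    qed (use meas f in auto)
    then have "(\<lambda>a. ennreal (measure (K a) F)) \<in> borel_measurable M" by measurable
    then show ?thesis
      by (rule measurable_cong[THEN iffD1, rotated])
        (simp add: K(1) prob_space.finite_measure finite_measure.emeasure_eq_measure)
  qed
qed (use K in auto)

text \<open>With digits 0 and 1 in base 3, a first difference at position n contributes 3^-n, and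
  all later digits together can undo at most half of that. Hence the sums stay at least 3^-n / 2
  apart. In base 2 the tail could cancel the difference completely.\<close>

lemma ternary_sums_agree:
  fixes b c :: "nat \<Rightarrow> real"
  assumes b: "\<And>k. b k \<in> {0, 1}" and c: "\<And>k. c k \<in> {0, 1}"
    and less: "\<bar>(\<Sum>k. b k * (1/3)^k) - (\<Sum>k. c k * (1/3)^k)\<bar> < (1/3)^L / 2" and k: "k < L"
  shows "b k = c k"
proof (rule ccontr)
  assume "b k \<noteq> c k"
  define n where "n = (LEAST n. b n \<noteq> c n)"
  have n: "b n \<noteq> c n" unfolding n_def by (rule LeastI) fact
  have n_less: "b i = c i" if "i < n" for i
    using not_less_Least[of i "\<lambda>n. b n \<noteq> c n"] that by (auto simp: n_def)
  have "n \<le> k" unfolding n_def by (rule Least_le) fact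
  with k have nL: "n < L" by simp
  define u where "u k = (b k - c k) * (1/3)^k" for k
  have geo: "summable (\<lambda>k. (1/3)^k :: real)" by (intro summable_geometric) simp
  have absb: "\<bar>b k\<bar> \<le> 1" "\<bar>c k\<bar> \<le> 1" "\<bar>b k - c k\<bar> \<le> 1" for k
    using b[of k] c[of k] by auto
  have sb: "summable (\<lambda>k. b k * (1/3)^k)" "summable (\<lambda>k. c k * (1/3)^k)" "summable u"
    using absb by (auto intro!: summable_comparison_test[OF _ geo] simp: abs_mult u_def mult_left_le_one_le)
  have "(\<Sum>k. b k * (1/3)^k) - (\<Sum>k. c k * (1/3)^k) = suminf u"
    unfolding u_def using sb by (subst suminf_diff) (auto simp: algebra_simps)
  also have "suminf u = (\<Sum>i. u (i + Suc n)) + (\<Sum>i<Suc n. u i)"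
    by (rule suminf_split_initial_segment) fact
  also have "(\<Sum>i<Suc n. u i) = u n"
    using n_less by (simp add: u_def)
  finally have eq: "(\<Sum>k. b k * (1/3)^k) - (\<Sum>k. c k * (1/3)^k) = (\<Sum>i. u (i + Suc n)) + u n" .
  have sg: "(\<lambda>i. (1/3)^(i + Suc n)) sums ((1/3)^n / 2 :: real)"
    using sums_mult[OF geometric_sums[of "1/3::real"], of "(1/3)^Suc n"] by (simp add: power_add mult.commute)
  have su: "norm (u (i + Suc n)) \<le> (1/3)^(i + Suc n)" for i
    using absb(3)[of "i + Suc n"] mult_right_mono[of "\<bar>b (i + Suc n) - c (i + Suc n)\<bar>" 1 "(1/3)^(i + Suc n)"]
    by (simp only: u_def real_norm_def abs_mult) simp
  have "norm (\<Sum>i. u (i + Suc n)) \<le> (\<Sum>i. (1/3)^(i + Suc n))"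
    using su by (intro order_trans[OF summable_norm] suminf_le sums_summable[OF sg]
        summable_comparison_test[OF _ sums_summable[OF sg]]) auto
  moreover have "\<bar>u n\<bar> = (1/3)^n"
    using n b[of n] c[of n] by (auto simp: u_def)
  moreover have "(1/3)^L \<le> ((1/3)^n :: real)"
    using nL by (intro power_decreasing) auto
  moreover have "(\<Sum>i. (1/3)^(i + Suc n)) = ((1/3)^n / 2 :: real)"
    using sums_unique[OF sg] by simp
  ultimately show False
    using less unfolding eq real_norm_def by linarith
qed

text \<open>The digits of \<open>e x\<close> record which of the balls \<open>ball (fst (g k)) (snd (g k))\<close> contain \<open>x\<close>.  Close values
  of \<open>e\<close> share many digits, hence finitely many digits locate \<open>x\<close> and the inverse of \<open>e\<close> is
  uniformly continuous.\<close>

lemma compact_borel_code: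
  fixes S :: "'b::complete_space set"
  assumes S: "compact S" "S \<noteq> {}"
  obtains e :: "'b \<Rightarrow> real" and C d where "e \<in> borel_measurable borel" "\<And>x. 0 \<le> e x" "\<And>x. e x \<le> 2"
    "closed C" "C \<subseteq> {0..2}" "e ` S \<subseteq> C" "continuous_on C d" "d ` C \<subseteq> S" "\<And>x. x \<in> S \<Longrightarrow> d (e x) = x"
proof -
  have "\<exists>K. finite K \<and> S \<subseteq> (\<Union>y\<in>K. ball y (1 / real (Suc p)))" for p
    using S(1) unfolding compact_eq_totally_bounded by (meson of_nat_0_less_iff zero_less_Suc zero_less_divide_1_iff)
  then obtain K where K: "\<And>p. finite (K p)" "\<And>p. S \<subseteq> (\<Union>y\<in>K p. ball y (1 / real (Suc p)))"
    by metis
  \<comment> \<open>All centres at all scales, each paired with its radius, so that one enumeration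
    \<open>g\<close> lists the balls of every net.\<close>
  define D where "D = (\<Union>p. K p \<times> {1 / real (Suc p)})"
  have "countable D" unfolding D_def using K(1) by (intro countable_UN) (auto intro: countable_finite)
  moreover have "D \<noteq> {}" using K(2)[of 0] S(2) unfolding D_def by fastforce
  ultimately obtain g :: "nat \<Rightarrow> 'b \<times> real" where g: "range g = D"
    by (metis range_from_nat_into)
  define b :: "'b \<Rightarrow> nat \<Rightarrow> real" where "b x k = indicator (ball (fst (g k)) (snd (g k))) x" for x k
  define e where "e x = (\<Sum>k. b x k * (1/3)^k)" for x
  have geo: "summable (\<lambda>k. (1/3)^k :: real)" by (intro summable_geometric) simp
  have b01: "b x k \<in> {0,1}" "0 \<le> b x k" "b x k \<le> 1" for x k by (auto simp: b_def indicator_def)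
  have sb: "summable (\<lambda>k. b x k * (1/3)^k)" for x
    using b01 by (intro summable_comparison_test[OF _ geo]) (auto simp: abs_mult mult_left_le_one_le)
  have e0: "0 \<le> e x" for x unfolding e_def using b01 by (intro suminf_nonneg sb) auto
  have "e x \<le> (\<Sum>k. (1/3)^k)" for x
    unfolding e_def using b01 by (intro suminf_le sb geo) (auto simp: mult_left_le_one_le)
  then have e2: "e x \<le> 2" for x
    using suminf_geometric[of "1/3::real"] order_trans[of "e x" "3/2" 2] by simp
  have [measurable]: "(\<lambda>x. b x k) \<in> borel_measurable borel" for k
    unfolding b_def by (intro borel_measurable_indicator borel_open) simp
  have em: "e \<in> borel_measurable borel"
    unfolding e_def by measurable
  \<comment> \<open>Choose a scale \<open>p\<close> with twice the radius below \<epsilon>. Its net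
    is finite, so the digits belonging to it all lie below some \<open>L\<close>; two points that
    agree in these digits lie in a common ball of the net.\<close>
  have uc: "\<exists>\<delta>>0. \<forall>x\<in>S. \<forall>y\<in>S. \<bar>e x - e y\<bar> < \<delta> \<longrightarrow> dist x y < \<epsilon>" if "\<epsilon> > 0" for \<epsilon>
  proof -
    obtain p where p: "2 / real (Suc p) < \<epsilon>"
      using reals_Archimedean[of "\<epsilon> / 2"] \<open>\<epsilon> > 0\<close> by (auto simp: field_simps)
    have "\<exists>k. g k = (y, 1 / real (Suc p))" if "y \<in> K p" for y
    proof -
      have "(y, 1 / real (Suc p)) \<in> range g" using that unfolding g D_def by blast
      then show ?thesis by auto
    qed
    then obtain idx where idx: "\<And>y. y \<in> K p \<Longrightarrow> g (idx y) = (y, 1 / real (Suc p))" by metis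
    obtain L where L: "\<And>y. y \<in> K p \<Longrightarrow> idx y < L"
      using finite_nat_set_iff_bounded[of "idx ` K p"] K(1)[of p] by auto
    show ?thesis
    proof (intro exI[of _ "(1/3)^L/2"] conjI ballI impI)
      fix x y assume xy: "x \<in> S" "y \<in> S" "\<bar>e x - e y\<bar> < (1/3)^L/2"
      obtain z where z: "z \<in> K p" "x \<in> ball z (1 / real (Suc p))" using K(2)[of p] xy(1) by blast
      have "b x (idx z) = b y (idx z)"
        by (rule ternary_sums_agree[of "b x" "b y" L]) (use b01(1) xy(3) L[OF z(1)] in \<open>auto simp: e_def\<close>)
      with z have "y \<in> ball z (1 / real (Suc p))" by (auto simp: b_def idx indicator_def split: if_splits)
      with z have "dist x y < 1 / real (Suc p) + 1 / real (Suc p)"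
        by (intro dist_triangle_less_add) (auto simp: dist_commute)
      then show "dist x y < \<epsilon>" using p by simp
    qed simp
  qed
  have inj: "x = y" if "x \<in> S" "y \<in> S" "e x = e y" for x y
  proof (rule ccontr)
    assume "x \<noteq> y"
    then have "dist x y > 0" by simp
    from uc[OF this] obtain \<delta> where "\<delta> > 0" and
      \<delta>: "\<And>u v. u \<in> S \<Longrightarrow> v \<in> S \<Longrightarrow> \<bar>e u - e v\<bar> < \<delta> \<Longrightarrow> dist u v < dist x y" by blast
    then show False using \<delta>[OF that(1,2)] that(3) by simp
  qed
  define d0 where "d0 = inv_into S e"
  have d0: "d0 (e x) = x" if "x \<in> S" for x
    unfolding d0_def using that inj by (intro inv_into_f_f) (auto simp: inj_on_def)
  have ucd: "uniformly_continuous_on (e ` S) d0"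
    unfolding uniformly_continuous_on_def
  proof (intro allI impI)
    fix \<epsilon> :: real assume "\<epsilon> > 0"
    from uc[OF this] show "\<exists>\<delta>>0. \<forall>x\<in>e ` S. \<forall>x'\<in>e ` S. dist x' x < \<delta> \<longrightarrow> dist (d0 x') (d0 x) < \<epsilon>"
      by (auto simp: d0 dist_real_def)
  qed
  \<comment> \<open>\<open>e\<close> is merely Borel, so the image of \<open>S\<close> need not be
    closed. A weak limit of coded measures only lives on the closure, which is why the inverse has
    to be extended to it; uniform continuity makes that possible.\<close>
  obtain d where d: "uniformly_continuous_on (closure (e ` S)) d"
      "\<And>x. x \<in> e ` S \<Longrightarrow> d0 x = d x"
    by (rule uniformly_continuous_on_extension_on_closure[OF ucd]) blast
  show thesis
  proof (rule that[of e "closure (e ` S)" d])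
    show "closure (e ` S) \<subseteq> {0..2}"
      by (rule closure_minimal) (use e0 e2 in auto)
    show cd: "continuous_on (closure (e ` S)) d" using d(1) by (rule uniformly_continuous_imp_continuous)
    show dx: "d (e x) = x" if "x \<in> S" for x using d(2)[of "e x"] d0[OF that] that by simp
    show "d ` closure (e ` S) \<subseteq> S"
      by (rule image_closure_subset[OF cd compact_imp_closed[OF S(1)]]) (use dx in auto)
  qed (use em e0 e2 closure_subset[of "e ` S"] in auto)
qed


text \<open>The coded measures live on a bounded interval and are therefore tight, so Helly
  selection on the real line yields a limit, which is decoded by \<open>d\<close>. Although
  \<open>e\<close> is not continuous, no test function is lost: \<open>f \<circ> d\<close> is
  continuous on the closed set \<open>C\<close> and extends to the line.\<close>

lemma weak_sequential_compactness:
  fixes S :: "'b::complete_space set" and P :: "nat \<Rightarrow> 'b measure"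
  assumes S: "compact S"
    and P: "\<And>k. prob_space (P k)" "\<And>k. sets (P k) = sets borel" "\<And>k. AE x in P k. x \<in> S"
  obtains r :: "nat \<Rightarrow> nat" and Q where "strict_mono r" "prob_space Q" "sets Q = sets borel"
    "AE x in Q. x \<in> S"
    "\<And>f :: 'b \<Rightarrow> real. continuous_on S f \<Longrightarrow>
      (\<lambda>k. LINT x:S|P (r k). f x) \<longlonglongrightarrow> (LINT x:S|Q. f x)"
proof -
  have "S \<noteq> {}"
  proof
    assume "S = {}"
    then have "AE x in P 0. False" using P(3)[of 0] by simp
    then show False using prob_space.AE_False[OF P(1)] by blast
  qed
  then obtain x0 where x0: "x0 \<in> S" by auto
  obtain e :: "'b \<Rightarrow> real" and C d where e[measurable]: "e \<in> borel_measurable borel"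
    and e02: "\<And>x. 0 \<le> e x" "\<And>x. e x \<le> 2"
    and C: "closed C" "C \<subseteq> {0..2}" "e ` S \<subseteq> C"
    and d: "continuous_on C d" "d ` C \<subseteq> S" "\<And>x. x \<in> S \<Longrightarrow> d (e x) = x"
    using compact_borel_code[OF S \<open>S \<noteq> {}\<close>] by metis
  have Cne: "C \<noteq> {}" using C(3) \<open>S \<noteq> {}\<close> by auto
  have e_P[measurable]: "e \<in> borel_measurable (P k)" for k
    by (simp cong: measurable_cong_sets add: P(2))
  define R where "R k = distr (P k) borel e" for k
  have R: "real_distribution (R k)" for k
    unfolding R_def by (intro prob_space.real_distribution_distr P) simp
  \<comment> \<open>Tightness is phrased with intervals open on the left; the endpoint -1 makes sure
    that the code value 0 is included.\<close>
  have "measure (R k) {-1<..2} = 1" for k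
  proof -
    interpret prob_space "P k" by fact
    have m1: "-1 < e x" for x using e02(1)[of x] by linarith
    have "e -` {-1<..2} \<inter> space (P k) = space (P k)"
      using e02 m1 by auto
    then show ?thesis unfolding R_def by (simp add: measure_distr prob_space)
  qed
  then have "-1 < (2::real) \<and> (\<forall>k. 1 - \<epsilon> < measure (R k) {-1<..2})" if "\<epsilon> > 0" for \<epsilon>
    using that by simp
  then have "tight R"
    unfolding tight_def using R by blast
  then obtain r M where r: "strict_mono r" and M: "real_distribution M" and "weak_conv_m (R \<circ> id \<circ> r) M"
    using tight_imp_convergent_subsubsequence[of R id] by (auto simp: strict_mono_id)
  then have conv: "(\<lambda>k. integral\<^sup>L (R (r k)) h) \<longlonglongrightarrow> integral\<^sup>L M h"
    if "continuous_on UNIV h" "\<And>x. \<bar>h x\<bar> \<le> B" for h :: "real \<Rightarrow> real" and B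
    using weak_conv_imp_integral_bdd_continuous_conv[of "R \<circ> id \<circ> r" M h B] R M that
    by (simp add: continuous_on_eq_continuous_at)
  interpret M: real_distribution M by fact
  have distr_int: "integral\<^sup>L (R k) h = (LINT x|P k. h (e x))" if "continuous_on UNIV h" for h :: "real \<Rightarrow> real" and k
    unfolding R_def using that by (subst integral_distr) (auto intro: borel_measurable_continuous_onI)
  have supp: "AE t in M. t \<in> C"
  proof -
    \<comment> \<open>A bounded continuous function whose zero set is \<open>C\<close>: its integral
      vanishes along the sequence, hence also in the limit, and the limit is carried by
      \<open>C\<close>.\<close>
    define h where "h t = min 1 (infdist t C)" for t :: real
    have h: "continuous_on UNIV h" "\<And>t. \<bar>h t\<bar> \<le> 1" "\<And>t. 0 \<le> h t"
      unfolding h_def by (intro continuous_intros) (auto simp: infdist_nonneg min_def)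
    have [measurable]: "h \<in> borel_measurable borel" using h(1) by (rule borel_measurable_continuous_onI)
    have "integral\<^sup>L (R k) h = 0" for k
    proof -
      have "AE x in P k. h (e x) = 0"
        using P(3)[of k] by eventually_elim (use C(3) in \<open>auto simp: h_def\<close>)
      then show ?thesis unfolding distr_int[OF h(1)] by (rule integral_eq_zero_AE)
    qed
    then have "integral\<^sup>L M h = 0" using conv[OF h(1,2)] by (simp add: LIMSEQ_unique)
    moreover have "integrable M h"
      by (rule M.integrable_const_bound[where B=1]) (use h in auto)
    ultimately have "AE t in M. h t = 0"
      using h(3) integral_nonneg_eq_0_iff_AE[of M h] by simp
    then show ?thesis
      by eventually_elim (use in_closed_iff_infdist_zero[OF C(1) Cne] in \<open>auto simp: h_def min_def split: if_splits\<close>)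
  qed
  \<comment> \<open>Off \<open>C\<close>, a null set for \<open>M\<close>, the value
    \<open>x0\<close> keeps the range of the decoder inside \<open>S\<close>.\<close>
  define d' where "d' t = (if t \<in> C then d t else x0)" for t
  have d'[measurable]: "d' \<in> borel_measurable borel"
    unfolding d'_def using C(1) d(1) by (intro borel_measurable_continuous_on_if) auto
  have d'S: "d' t \<in> S" for t using d(2) x0 by (auto simp: d'_def)
  define Q where "Q = distr M borel d'"
  have d'_M[measurable]: "d' \<in> borel_measurable M" by simp
  show thesis
  proof (rule that[of r Q])
    show "prob_space Q" unfolding Q_def by (rule M.prob_space_distr) simp
    show "AE x in Q. x \<in> S"
      unfolding Q_def using borel_closed[OF compact_imp_closed[OF S]] d'S by (subst AE_distr_iff) auto
    show "(\<lambda>k. LINT x:S|P (r k). f x) \<longlonglongrightarrow> (LINT x:S|Q. f x)" if f: "continuous_on S f" for f :: "'b \<Rightarrow> real"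
    proof -
      have "compact (f ` S)" using f S by (rule compact_continuous_image)
      then obtain B where B: "\<And>x. x \<in> S \<Longrightarrow> \<bar>f x\<bar> \<le> B" "B > 0"
        using compact_imp_bounded bounded_pos by (metis imageI real_norm_def)
      have "continuous_on C (f \<circ> d)"
        by (intro continuous_on_compose d(1) continuous_on_subset[OF f] d(2))
      moreover have "norm ((f \<circ> d) t) \<le> B" if "t \<in> C" for t
        using B(1)[of "d t"] d(2) that by auto
      \<comment> \<open>Tietze extension with the same bound \<open>B\<close>: weak convergence on
        the line tests only functions that are continuous and bounded everywhere.\<close>
      ultimately obtain h where h: "continuous_on UNIV h" "\<And>t. t \<in> C \<Longrightarrow> h t = f (d t)" "\<And>t. \<bar>h t\<bar> \<le> B"
        using Tietze[of C "f \<circ> d" UNIV B] C(1) B(2) by auto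
      have fS: "(\<lambda>x. indicator S x *\<^sub>R f x) \<in> borel_measurable borel"
        by (rule borel_measurable_continuous_on_indicator)
          (use borel_closed[OF compact_imp_closed[OF S]] f in auto)
      have [measurable]: "h \<in> borel_measurable borel" using h(1) by (rule borel_measurable_continuous_onI)
      have "(LINT x:S|P k. f x) = integral\<^sup>L (R k) h" for k
        unfolding distr_int[OF h(1)] set_lebesgue_integral_def
      proof (rule integral_cong_AE)
        show "AE x in P k. indicator S x *\<^sub>R f x = h (e x)"
          using P(3)[of k] by eventually_elim (use C(3) h(2) d(3) in auto)
        show "(\<lambda>x. indicator S x *\<^sub>R f x) \<in> borel_measurable (P k)"
          using fS by (simp cong: measurable_cong_sets add: P(2))
      qed measurable
      moreover have "(LINT x:S|Q. f x) = integral\<^sup>L M h"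
        unfolding Q_def set_lebesgue_integral_def
      proof (subst integral_distr[OF d'_M fS], rule integral_cong_AE)
        show "AE t in M. indicator S (d' t) *\<^sub>R f (d' t) = h t"
          using supp by eventually_elim (use d(2) h(2) in \<open>auto simp: d'_def\<close>)
        show "(\<lambda>t. indicator S (d' t) *\<^sub>R f (d' t)) \<in> borel_measurable M"
          by (rule measurable_compose[OF d'_M fS])
      qed simp
      ultimately show ?thesis using conv[OF h(1,3)] by simp
    qed
  qed (simp_all add: r Q_def)
qed

section \<open>Disintegration\<close>

text \<open>Integrating over the set where the inequality fails would give a strict reversal.
  Finiteness of the integrals of \<open>g\<close> is what makes the reversal strict.\<close>

lemma AE_le_from_set_nn_integrals:
  fixes f g :: "'s \<Rightarrow> ennreal"
  assumes [measurable]: "f \<in> borel_measurable M" "g \<in> borel_measurable M"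
    and fin: "\<And>B. B \<in> sets M \<Longrightarrow> (\<integral>\<^sup>+t\<in>B. g t \<partial>M) \<noteq> \<infinity>"
    and le: "\<And>B. B \<in> sets M \<Longrightarrow> (\<integral>\<^sup>+t\<in>B. f t \<partial>M) \<le> (\<integral>\<^sup>+t\<in>B. g t \<partial>M)"
  shows "AE t in M. f t \<le> g t"
proof -
  define B where "B = {t \<in> space M. g t < f t}"
  have B[measurable]: "B \<in> sets M" unfolding B_def by measurable
  have "AE t in M. f t * indicator B t \<le> g t * indicator B t"
  proof (rule ccontr)
    assume "\<not> ?thesis"
    then have "(\<integral>\<^sup>+t\<in>B. g t \<partial>M) < (\<integral>\<^sup>+t\<in>B. f t \<partial>M)"
      by (intro nn_integral_less fin B) (auto simp: B_def indicator_def)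
    with le[OF B] show False by simp
  qed
  then show ?thesis
    using AE_space
  proof eventually_elim
    case (elim t)
    then show ?case by (cases "g t < f t") (auto simp: B_def)
  qed
qed

lemma emeasure_distr_density_indicator:
  assumes [measurable]: "S \<in> sets M" "f \<in> measurable M N" "A \<in> sets N"
  shows "emeasure (distr (density M (indicator S)) N f) A = emeasure M (S \<inter> (f -` A \<inter> space M))"
proof -
  have "emeasure (distr (density M (indicator S)) N f) A
      = (\<integral>\<^sup>+x. indicator S x * indicator (f -` A \<inter> space M) x \<partial>M)"
    by (simp add: emeasure_distr emeasure_density del: nn_integral_indicator)
  also have "\<dots> = (\<integral>\<^sup>+x. indicator (S \<inter> (f -` A \<inter> space M)) x \<partial>M)"
    by (simp add: indicator_inter_arith)
  also have "\<dots> = emeasure M (S \<inter> (f -` A \<inter> space M))"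
    by (rule nn_integral_indicator) simp
  finally show ?thesis .
qed

text \<open>Regular conditional law of the real variable \<open>R\<close> given \<open>T\<close>.
  For each r, the measure of the event \<open>R \<le> r\<close> over sets of times has a density
  \<open>f r\<close> by Radon-Nikodym. The laws of a distribution function hold simultaneously for
  all rational r off one null set, and a right-continuous version defines the conditional measure.
  The range [0,2] is that of the code in \<open>compact_borel_code\<close>; it fixes the limits 0
  and 1 of the distribution functions.\<close>

lemma disintegration:
  fixes R :: "'w \<Rightarrow> real" and T :: "'w \<Rightarrow> 's"
  assumes nu: "prob_space \<nu>" and R[measurable]: "R \<in> borel_measurable \<nu>"
    and R02: "\<And>w. w \<in> space \<nu> \<Longrightarrow> R w \<in> {0..2}"
    and T[measurable]: "T \<in> measurable \<nu> L" and L: "distr \<nu> L T = L"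
  obtains Q where "Q \<in> measurable L (prob_algebra borel)"
    "\<And>\<psi> B. \<psi> \<in> borel_measurable (L \<Otimes>\<^sub>M borel) \<Longrightarrow> (\<And>z. \<bar>\<psi> z\<bar> \<le> B) \<Longrightarrow>
      (LINT w|\<nu>. \<psi> (T w, R w)) = (LINT t|L. LINT r|Q t. \<psi> (t, r) :: real)"
proof -
  interpret nu: prob_space \<nu> by fact
  interpret L: prob_space L using nu.prob_space_distr[OF T] unfolding L .
  define N where "N r = distr (density \<nu> (indicator {w \<in> space \<nu>. R w \<le> r})) L T" for r
  have N: "emeasure (N r) B = emeasure \<nu> {w \<in> space \<nu>. R w \<le> r \<and> T w \<in> B}"
    if [measurable]: "B \<in> sets L" for r B
  proof -
    have "emeasure (N r) B = emeasure \<nu> ({w \<in> space \<nu>. R w \<le> r} \<inter> (T -` B \<inter> space \<nu>))"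
      unfolding N_def by (simp add: emeasure_distr_density_indicator)
    also have "{w \<in> space \<nu>. R w \<le> r} \<inter> (T -` B \<inter> space \<nu>) = {w \<in> space \<nu>. R w \<le> r \<and> T w \<in> B}" by auto
    finally show ?thesis .
  qed
  have LT: "emeasure L B = emeasure \<nu> (T -` B \<inter> space \<nu>)" if "B \<in> sets L" for B
    using emeasure_distr[OF T that] unfolding L .
  have "absolutely_continuous L (N r)" for r
    unfolding absolutely_continuous_def
  proof
    fix B assume B: "B \<in> null_sets L"
    then have Bs[measurable]: "B \<in> sets L" and "emeasure L B = 0" by auto
    then have "emeasure (N r) B \<le> 0"
      unfolding N[OF Bs] LT[OF Bs, symmetric, simplified \<open>emeasure L B = 0\<close>, symmetric]
      using emeasure_mono[of "{w \<in> space \<nu>. R w \<le> r \<and> T w \<in> B}" "T -` B \<inter> space \<nu>" \<nu>] LT[OF Bs] by auto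
    then show "B \<in> null_sets (N r)" using Bs by (simp add: N_def null_sets_def)
  qed
  then have "\<exists>f\<in>borel_measurable L. density L f = N r" for r
    by (intro L.Radon_Nikodym) (auto simp: N_def)
  then obtain f where f[measurable]: "\<And>r. f r \<in> borel_measurable L" and "\<And>r. density L (f r) = N r"
    by metis
  then have fN: "(\<integral>\<^sup>+t\<in>B. f r t \<partial>L) = emeasure \<nu> {w \<in> space \<nu>. R w \<le> r \<and> T w \<in> B}" if "B \<in> sets L" for r B
    using N[OF that, of r] that emeasure_density[OF f[of r] that] by simp
  have fin: "(\<integral>\<^sup>+t\<in>B. f r t \<partial>L) \<noteq> \<infinity>" if "B \<in> sets L" for r B
    unfolding fN[OF that] by (simp add: nu.emeasure_eq_measure)
  have one: "(\<integral>\<^sup>+t\<in>B. 1 \<partial>L) = emeasure \<nu> {w \<in> space \<nu>. T w \<in> B}" if "B \<in> sets L" for B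
    using LT[OF that] that by (simp add: Int_def vimage_def conj_commute)
  have mono: "AE t in L. f r t \<le> f s t" if "r \<le> s" for r s
  proof (rule AE_le_from_set_nn_integrals)
    fix B assume [measurable]: "B \<in> sets L"
    show "(\<integral>\<^sup>+t\<in>B. f r t \<partial>L) \<le> (\<integral>\<^sup>+t\<in>B. f s t \<partial>L)"
      using that unfolding fN[OF \<open>B \<in> sets L\<close>] by (intro emeasure_mono) auto
  qed (use fin in auto)
  have neg: "AE t in L. f r t = 0" if "r < 0" for r
  proof -
    have e0: "{w \<in> space \<nu>. R w \<le> r \<and> T w \<in> space L} = {}" using R02 that by force
    have "(\<integral>\<^sup>+t\<in>space L. f r t \<partial>L) = 0" using fN[OF sets.top, of r, unfolded e0] by simp
    then have "(\<integral>\<^sup>+t. f r t \<partial>L) = 0" by (simp cong: nn_integral_cong)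
    then show ?thesis by (simp add: nn_integral_0_iff_AE)
  qed
  have big: "AE t in L. f r t = 1" if "2 \<le> r" for r
  proof -
    have eq: "{w \<in> space \<nu>. R w \<le> r \<and> T w \<in> B} = {w \<in> space \<nu>. T w \<in> B}" for B
      using R02 that by force
    have "AE t in L. f r t \<le> 1"
      by (rule AE_le_from_set_nn_integrals)
        (simp_all only: fN one eq, auto simp: nu.emeasure_eq_measure)
    moreover have "AE t in L. 1 \<le> f r t"
      by (rule AE_le_from_set_nn_integrals)
        (simp_all only: fN one eq, auto simp: nu.emeasure_eq_measure)
    ultimately show ?thesis by eventually_elim simp
  qed
  \<comment> \<open>Only countably many conditions, so almost every t satisfies them all at
    once.\<close>
  define good where "good t \<longleftrightarrow> (\<forall>r\<in>\<rat>. \<forall>s\<in>\<rat>. r \<le> s \<longrightarrow> f r t \<le> f s t) \<and>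
    (\<forall>r\<in>\<rat>. r < 0 \<longrightarrow> f r t = 0) \<and> (\<forall>r\<in>\<rat>. 2 \<le> r \<longrightarrow> f r t = 1)" for t
  have cq: "countable (\<rat> :: real set)" by (rule countable_rat)
  have good_m[measurable]: "Measurable.pred L good"
    unfolding good_def using cq by measurable
  have good_AE: "AE t in L. good t"
    unfolding good_def using mono neg big cq by (simp add: AE_ball_countable)
  \<comment> \<open>At exceptional t this is the distribution function of the point mass at 0. All
    later properties then hold for every t, so that each \<open>Q t\<close> is a genuine probability
    measure.\<close>
  define g where "g r t = (if good t then enn2real (f r t) else if r < 0 then 0 else 1)" for r t
  have g[measurable]: "g r \<in> borel_measurable L" for r unfolding g_def by measurable
  have rat_up: "\<exists>s\<in>\<rat>. r \<le> s \<and> 2 \<le> s" for r :: real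
  proof -
    have "r \<le> real_of_int (max 2 \<lceil>r\<rceil>)" "2 \<le> real_of_int (max 2 \<lceil>r\<rceil>)" by linarith+
    then show ?thesis using Rats_of_int by blast
  qed
  have f_fin: "f r t < \<infinity>" if "good t" "r \<in> \<rat>" for r t
  proof -
    obtain s where "s \<in> \<rat>" "r \<le> s" "2 \<le> s" using rat_up by blast
    then have "f r t \<le> f s t" "f s t = 1"
      using that unfolding good_def by blast+
    then show ?thesis by (auto simp: less_top[symmetric] top_unique)
  qed
  have g_mono: "g r t \<le> g s t" if "r \<in> \<rat>" "s \<in> \<rat>" "r \<le> s" for r s t
    using that f_fin[of t s] unfolding g_def good_def
    by (auto intro!: enn2real_mono)
  have g0: "g r t = 0" if "r \<in> \<rat>" "r < 0" for r t using that by (auto simp: g_def good_def)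
  have g1: "g r t = 1" if "r \<in> \<rat>" "r \<ge> 2" for r t using that by (auto simp: g_def good_def)
  have g_nn: "0 \<le> g r t" for r t by (simp add: g_def)
  have g_le1: "g r t \<le> 1" if "r \<in> \<rat>" for r t
  proof -
    obtain s where "s \<in> \<rat>" "r \<le> s" "2 \<le> s" using rat_up by blast
    then show ?thesis using g_mono[OF that, of s t] g1[of s t] by simp
  qed
  have gN: "(LINT t:B|L. g r t) = measure \<nu> {w \<in> space \<nu>. R w \<le> r \<and> T w \<in> B}"
    if [measurable]: "B \<in> sets L" and r: "r \<in> \<rat>" for r B
  proof -
    have "(LINT t:B|L. g r t) = enn2real (\<integral>\<^sup>+t. ennreal (indicator B t *\<^sub>R g r t) \<partial>L)"
      unfolding set_lebesgue_integral_def by (rule integral_eq_nn_integral) (auto simp: g_nn)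
    also have "(\<integral>\<^sup>+t. ennreal (indicator B t *\<^sub>R g r t) \<partial>L) = (\<integral>\<^sup>+t\<in>B. f r t \<partial>L)"
      by (rule nn_integral_cong_AE) (use good_AE in eventually_elim,
          use f_fin r in \<open>auto simp: g_def indicator_def\<close>)
    finally show ?thesis by (simp add: fN measure_def)
  qed
  \<comment> \<open>The infimum runs over rationals strictly above x; this strictness is what gives
    right continuity.\<close>
  define F where "F t x = (INF r\<in>{r\<in>\<rat>. x < r}. g r t)" for t x
  have ne: "{r\<in>\<rat>. x < r} \<noteq> {}" for x :: real
    using Rats_dense_in_real[of x "x + 1"] by auto
  have bdd: "bdd_below ((\<lambda>r. g r t) ` {r\<in>\<rat>. x < r})" for x t
    using g_nn by (intro bdd_belowI[of _ 0]) auto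
  have F_le: "F t x \<le> g r t" if "r \<in> \<rat>" "x < r" for r t x
    unfolding F_def by (rule cINF_lower[OF bdd]) (use that in auto)
  have F_less: "\<exists>r\<in>\<rat>. x < r \<and> g r t < y" if "F t x < y" for t x y
    using that unfolding F_def by (subst (asm) cINF_less_iff[OF ne bdd]) auto
  have F_nn: "0 \<le> F t x" for t x
    unfolding F_def by (rule cINF_greatest[OF ne]) (rule g_nn)
  have F_mono: "F t x \<le> F t y" if "x \<le> y" for t x y
    unfolding F_def by (rule cINF_superset_mono[OF ne bdd]) (use that in auto)
  have F_rc: "continuous (at_right x) (F t)" for t x
    unfolding continuous_within
  proof (rule order_tendstoI)
    fix a assume "a < F t x"
    then show "\<forall>\<^sub>F y in at_right x. a < F t y"
      unfolding eventually_at_right_field using F_mono[of x _ t]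
      by (intro exI[of _ "x + 1"]) (auto intro: less_le_trans)
  next
    fix a assume "F t x < a"
    then obtain r where r: "r \<in> \<rat>" "x < r" "g r t < a" using F_less by blast
    then show "\<forall>\<^sub>F y in at_right x. F t y < a"
      unfolding eventually_at_right_field using F_le[OF r(1), of _ t]
      by (intro exI[of _ r]) (auto intro: le_less_trans)
  qed
  have F0: "F t x = 0" if "x < 0" for t x
  proof -
    obtain r where "r \<in> \<rat>" "x < r" "r < 0" using Rats_dense_in_real[OF \<open>x < 0\<close>] by auto
    then show ?thesis using F_le[of r x t] g0[of r t] F_nn[of t x] by simp
  qed
  have F1: "F t x = 1" if "2 \<le> x" for t x
  proof -
    have "(\<lambda>r. g r t) ` {r\<in>\<rat>. x < r} = {1}" using that ne[of x] g1 by auto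
    then show ?thesis unfolding F_def by simp
  qed
  have Fbot: "(F t \<longlongrightarrow> 0) at_bot" for t
    by (rule tendsto_eventually) (auto simp: eventually_at_bot_linorder F0 intro!: exI[of _ "-1"])
  have Ftop: "(F t \<longlongrightarrow> 1) at_top" for t
    by (rule tendsto_eventually) (auto simp: eventually_at_top_linorder F1 intro!: exI[of _ 2])
  have "\<exists>q :: nat \<Rightarrow> real. \<forall>n. q n \<in> \<rat> \<and> x < q n \<and> q n < x + 1 / real (Suc n)" for x :: real
  proof (intro choice allI)
    show "\<exists>y. y \<in> \<rat> \<and> x < y \<and> y < x + 1 / real (Suc n)" for n
      using Rats_dense_in_real[of x "x + 1 / real (Suc n)"] by auto
  qed
  \<comment> \<open>Rationals that approach x strictly from above turn the uncountable infimum into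
    a sequential limit, which preserves measurability and allows dominated convergence.\<close>
  then obtain q :: "real \<Rightarrow> nat \<Rightarrow> real" where
    q: "\<And>x n. q x n \<in> \<rat>" "\<And>x n. x < q x n" "\<And>x n. q x n < x + 1 / real (Suc n)" by metis
  have ev_q: "\<forall>\<^sub>F n in sequentially. q x n < y" if "x < y" for x y
  proof -
    have "(\<lambda>n. x + 1 / real (Suc n)) \<longlonglongrightarrow> x + 0"
      by (intro tendsto_add tendsto_const LIMSEQ_Suc lim_1_over_n)
    then have "\<forall>\<^sub>F n in sequentially. x + 1 / real (Suc n) < y"
      using that by (auto dest: order_tendstoD)
    then show ?thesis by eventually_elim (use q(3) in \<open>auto intro: less_trans\<close>)
  qed
  have g_lim: "(\<lambda>n. g (q x n) t) \<longlonglongrightarrow> F t x" for x t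
  proof (rule order_tendstoI)
    fix a assume "a < F t x"
    then have "a < g (q x n) t" for n
      by (rule less_le_trans) (rule F_le[OF q(1,2)])
    then show "\<forall>\<^sub>F n in sequentially. a < g (q x n) t" by simp
  next
    fix a assume "F t x < a"
    then obtain r where r: "r \<in> \<rat>" "x < r" "g r t < a" using F_less by blast
    show "\<forall>\<^sub>F n in sequentially. g (q x n) t < a"
      using ev_q[OF r(2)]
    proof eventually_elim
      case (elim n)
      then have "g (q x n) t \<le> g r t" by (intro g_mono q(1) r(1)) simp
      then show ?case using r(3) by simp
    qed
  qed
  have F_meas[measurable]: "(\<lambda>t. F t x) \<in> borel_measurable L" for x
    by (rule borel_measurable_LIMSEQ_real[OF g_lim]) simp
  have F_int: "(LINT t:B|L. F t x) = measure \<nu> {w \<in> space \<nu>. R w \<le> x \<and> T w \<in> B}"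
    if B[measurable]: "B \<in> sets L" for x B
  proof -
    have 1: "(\<lambda>n. LINT t:B|L. g (q x n) t) \<longlonglongrightarrow> (LINT t:B|L. F t x)"
      unfolding set_lebesgue_integral_def
    proof (rule integral_dominated_convergence[where w="\<lambda>_. 1"])
      show "AE t in L. (\<lambda>n. indicator B t *\<^sub>R g (q x n) t) \<longlonglongrightarrow> indicator B t *\<^sub>R F t x"
        by (rule AE_I2) (rule tendsto_scaleR[OF tendsto_const g_lim])
      show "AE t in L. norm (indicator B t *\<^sub>R g (q x n) t) \<le> 1" for n
      proof (rule AE_I2)
        show "norm (indicator B t *\<^sub>R g (q x n) t) \<le> 1" for t
          using g_nn[of "q x n" t] g_le1[OF q(1)[of x n], of t] by (cases "t \<in> B") auto
      qed
      show "(\<lambda>t. indicator B t *\<^sub>R F t x) \<in> borel_measurable L" by measurable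
      show "(\<lambda>t. indicator B t *\<^sub>R g (q x n) t) \<in> borel_measurable L" for n by measurable
      show "integrable L (\<lambda>_. 1 :: real)" by simp
    qed
    \<comment> \<open>The events \<open>R w \<le> q x n\<close> converge pointwise to
      \<open>R w \<le> x\<close> because the bounds stay above x while they tend to it.\<close>
    have 2: "(\<lambda>n. LINT w|\<nu>. indicator {w \<in> space \<nu>. R w \<le> q x n \<and> T w \<in> B} w :: real) \<longlonglongrightarrow>
        (LINT w|\<nu>. indicator {w \<in> space \<nu>. R w \<le> x \<and> T w \<in> B} w)"
    proof (rule integral_dominated_convergence[where w="\<lambda>_. 1"])
      show "AE w in \<nu>. (\<lambda>n. indicator {w \<in> space \<nu>. R w \<le> q x n \<and> T w \<in> B} w :: real) \<longlonglongrightarrow>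
        indicator {w \<in> space \<nu>. R w \<le> x \<and> T w \<in> B} w"
      proof (rule AE_I2)
        fix w assume "w \<in> space \<nu>"
        show "(\<lambda>n. indicator {w \<in> space \<nu>. R w \<le> q x n \<and> T w \<in> B} w :: real) \<longlonglongrightarrow>
          indicator {w \<in> space \<nu>. R w \<le> x \<and> T w \<in> B} w"
        proof (cases "R w \<le> x")
          case True
          then have "R w \<le> q x n" for n using q(2)[of x n] by simp
          then show ?thesis using True by (simp add: indicator_def)
        next
          case False
          then have "\<forall>\<^sub>F n in sequentially. q x n < R w" using ev_q by simp
          then have "\<forall>\<^sub>F n in sequentially. (indicator {w \<in> space \<nu>. R w \<le> q x n \<and> T w \<in> B} w :: real)
              = indicator {w \<in> space \<nu>. R w \<le> x \<and> T w \<in> B} w"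
            by eventually_elim (use False in \<open>auto simp: indicator_def\<close>)
          then show ?thesis by (rule tendsto_eventually)
        qed
      qed
      show "AE w in \<nu>. norm (indicator {w \<in> space \<nu>. R w \<le> q x n \<and> T w \<in> B} w :: real) \<le> 1" for n
        by (intro AE_I2) (simp add: indicator_def)
      show "integrable \<nu> (\<lambda>_. 1 :: real)" by simp
    qed measurable
    have int_ind: "(LINT w|\<nu>. indicator {w \<in> space \<nu>. R w \<le> y \<and> T w \<in> B} w :: real)
        = measure \<nu> {w \<in> space \<nu>. R w \<le> y \<and> T w \<in> B}" for y
    proof -
      have "{w \<in> space \<nu>. R w \<le> y \<and> T w \<in> B} \<inter> space \<nu> = {w \<in> space \<nu>. R w \<le> y \<and> T w \<in> B}" by auto
      then show ?thesis by simp
    qed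
    show ?thesis
      using LIMSEQ_unique[OF 1[unfolded gN[OF B q(1)]] 2[unfolded int_ind]] .
  qed
  define Q where "Q t = interval_measure (F t)" for t
  have Qrd: "real_distribution (Q t)" for t
    unfolding Q_def by (rule real_distribution_interval_measure[OF F_mono F_rc Fbot Ftop])
  have Qp: "prob_space (Q t)" "sets (Q t) = sets borel" for t
    using Qrd[of t] by (auto simp: real_distribution_def real_distribution_axioms_def)
  have QF: "emeasure (Q t) {..x} = ennreal (F t x)" for t x
    unfolding Q_def by (rule emeasure_interval_measure_Iic[OF F_mono F_rc Fbot])
  have Qm: "Q \<in> measurable L (prob_algebra borel)"
  proof (rule measurable_prob_algebra_generated[where \<Omega>=UNIV and G="range (\<lambda>x::real. {..x})"])
    show "sets borel = sigma_sets UNIV (range (\<lambda>x::real. {..x}))" by (simp add: borel_eq_atMost)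
    show "Int_stable (range (\<lambda>x::real. {..x}))" by (auto simp: Int_stable_def)
    show "(\<lambda>t. emeasure (Q t) A) \<in> borel_measurable L" if "A \<in> range (\<lambda>x::real. {..x})" for A
      using that by (auto simp: QF)
  qed (use Qp in auto)
  note Qs = measurable_prob_algebraD[OF Qm]
  have Lp: "L \<in> space (prob_algebra L)" by (simp add: space_prob_algebra L.prob_space_axioms)
  have rect: "emeasure \<nu> {w \<in> space \<nu>. T w \<in> B \<and> R w \<in> A} = (\<integral>\<^sup>+t\<in>B. emeasure (Q t) A \<partial>L)"
    if B[measurable]: "B \<in> sets L" and A: "A \<in> sets borel" for A B
  proof -
    \<comment> \<open>For a fixed set B of times both sides are finite measures in A, so they may be
      compared through their distribution functions, where \<open>F_int\<close> gives
      equality.\<close>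
    define M1 where "M1 = distr (density \<nu> (indicator {w \<in> space \<nu>. T w \<in> B})) borel R"
    define M2 where "M2 = density L (indicator B) \<bind> Q"
    have M1: "emeasure M1 A = emeasure \<nu> {w \<in> space \<nu>. T w \<in> B \<and> R w \<in> A}" if [measurable]: "A \<in> sets borel" for A
    proof -
      have "emeasure M1 A = emeasure \<nu> ({w \<in> space \<nu>. T w \<in> B} \<inter> (R -` A \<inter> space \<nu>))"
        unfolding M1_def by (simp add: emeasure_distr_density_indicator)
      also have "{w \<in> space \<nu>. T w \<in> B} \<inter> (R -` A \<inter> space \<nu>) = {w \<in> space \<nu>. T w \<in> B \<and> R w \<in> A}" by auto
      finally show ?thesis .
    qed
    have Qs': "Q \<in> measurable (density L (indicator B)) (subprob_algebra borel)" using Qs by simp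
    have M2: "emeasure M2 A = (\<integral>\<^sup>+t\<in>B. emeasure (Q t) A \<partial>L)" if A: "A \<in> sets borel" for A
    proof -
      have "(\<lambda>t. emeasure (Q t) A) \<in> borel_measurable L"
        using measurable_emeasure_kernel[OF Qs A] .
      then show ?thesis
        unfolding M2_def by (subst emeasure_bind[OF _ Qs' A])
          (auto simp: L.not_empty nn_integral_density mult.commute)
    qed
    have "M1 = M2"
    proof (rule cdf_unique')
      have s1: "sets M1 = sets borel" by (simp add: M1_def)
      have s2: "sets M2 = sets borel"
        unfolding M2_def by (rule sets_bind_measurable[OF Qs']) (simp add: L.not_empty)
      have em2: "emeasure M2 {..x} = emeasure M1 {..x}" for x
      proof -
        have "emeasure M2 {..x} = (\<integral>\<^sup>+t. ennreal (indicator B t *\<^sub>R F t x) \<partial>L)"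
          by (subst M2) (auto simp: QF indicator_def intro!: nn_integral_cong)
        also have "\<dots> = ennreal (LINT t:B|L. F t x)"
          unfolding set_lebesgue_integral_def
        proof (rule nn_integral_eq_integral)
          have "F t x \<le> 1" for t
            using F_le[OF q(1)[of x 0] q(2)[of x 0], of t] g_le1[OF q(1)[of x 0], of t] by simp
          then show "integrable L (\<lambda>t. indicator B t *\<^sub>R F t x)"
            by (intro L.integrable_const_bound[where B=1]) (auto simp: F_nn indicator_def)
        qed (auto simp: F_nn)
        also have "\<dots> = emeasure M1 {..x}"
          by (simp add: F_int[OF B] M1 nu.emeasure_eq_measure conj_commute)
        finally show ?thesis .
      qed
      have f1: "emeasure M1 UNIV \<le> 1"
        using M1[of UNIV] nu.emeasure_le_1 by simp
      have "emeasure M2 UNIV = (\<integral>\<^sup>+t\<in>B. 1 \<partial>L)"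
        using M2[of UNIV] prob_space.emeasure_space_1[OF Qp(1)] sets_eq_imp_space_eq[OF Qp(2)] by simp
      then have f2: "emeasure M2 UNIV \<le> 1" using L.emeasure_le_1[of B] by simp
      show "finite_borel_measure M1" "finite_borel_measure M2"
        using f1 f2 s1 s2 sets_eq_imp_space_eq[OF s1] sets_eq_imp_space_eq[OF s2]
        by (auto simp: finite_borel_measure_def finite_borel_measure_axioms_def top_unique intro!: finite_measureI)
      show "cdf M1 = cdf M2"
        by (simp add: cdf_def fun_eq_iff measure_def em2)
    qed
    then show ?thesis using M1[OF A] M2[OF A] by simp
  qed
  \<comment> \<open>The time is carried along as the first component, so that
    \<open>L \<bind> ?K\<close> is a candidate for the joint law and integrands may depend on both
    variables.\<close>
  let ?K = "\<lambda>t. distr (Q t) (L \<Otimes>\<^sub>M borel) (\<lambda>r. (t, r))"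
  have Km: "?K \<in> measurable L (prob_algebra (L \<Otimes>\<^sub>M borel))"
    by (rule measurable_distr_prob_space2[OF Qm]) simp
  have eq: "distr \<nu> (L \<Otimes>\<^sub>M borel) (\<lambda>w. (T w, R w)) = L \<bind> ?K"
  proof (rule measure_eqI_generator_eq[OF Int_stable_pair_measure_generator[of L "borel :: real measure"], of "space L \<times> UNIV" _ _ "\<lambda>_. space L \<times> UNIV"])
    show "{a \<times> b |a b. a \<in> sets L \<and> b \<in> sets borel} \<subseteq> Pow (space L \<times> (UNIV :: real set))"
      using sets.sets_into_space by blast
    show "emeasure (distr \<nu> (L \<Otimes>\<^sub>M borel) (\<lambda>w. (T w, R w))) X = emeasure (L \<bind> ?K) X"
      if XE: "X \<in> {a \<times> b |a b. a \<in> sets L \<and> b \<in> sets borel}" for X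
    proof -
      obtain B A where X: "X = B \<times> A" and B[measurable]: "B \<in> sets L" and A[measurable]: "A \<in> sets borel" using XE by auto
      have "emeasure (distr \<nu> (L \<Otimes>\<^sub>M borel) (\<lambda>w. (T w, R w))) X = emeasure \<nu> {w \<in> space \<nu>. T w \<in> B \<and> R w \<in> A}"
        unfolding X by (subst emeasure_distr) (auto intro!: arg_cong[where f="emeasure \<nu>"])
      also have "\<dots> = (\<integral>\<^sup>+t\<in>B. emeasure (Q t) A \<partial>L)" by (rule rect[OF B A])
      also have "\<dots> = (\<integral>\<^sup>+t. emeasure (?K t) X \<partial>L)"
      proof (rule nn_integral_cong)
        fix t assume "t \<in> space L"
        then have "(\<lambda>r. (t, r)) \<in> Q t \<rightarrow>\<^sub>M L \<Otimes>\<^sub>M borel"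
          by (simp cong: measurable_cong_sets add: Qp(2))
        then show "emeasure (Q t) A * indicator B t = emeasure (?K t) X"
          unfolding X by (subst emeasure_distr)
            (auto simp: indicator_def sets_eq_imp_space_eq[OF Qp(2)] intro!: arg_cong[where f="emeasure (Q t)"])
      qed
      also have "\<dots> = emeasure (L \<bind> ?K) X"
        unfolding X by (rule emeasure_bind_prob_algebra[OF Lp Km, symmetric]) simp
      finally show ?thesis .
    qed
    show "sets (L \<bind> ?K) = sigma_sets (space L \<times> UNIV) {a \<times> b |a b. a \<in> sets L \<and> b \<in> sets borel}"
      unfolding sets_bind'[OF Lp Km] sets_pair_measure by simp
    show "sets (distr \<nu> (L \<Otimes>\<^sub>M borel) (\<lambda>w. (T w, R w))) = sigma_sets (space L \<times> UNIV) {a \<times> b |a b. a \<in> sets L \<and> b \<in> sets borel}"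
      unfolding sets_distr sets_pair_measure by simp
    have "prob_space (distr \<nu> (L \<Otimes>\<^sub>M borel) (\<lambda>w. (T w, R w)))" by (rule nu.prob_space_distr) simp
    then show "emeasure (distr \<nu> (L \<Otimes>\<^sub>M borel) (\<lambda>w. (T w, R w))) (space L \<times> UNIV) \<noteq> \<infinity>" for i :: nat
      using prob_space.emeasure_le_1 by (metis ennreal_one_less_top infinity_ennreal_def leD)
    have "space L \<times> (UNIV :: real set) \<in> {a \<times> b |a b. a \<in> sets L \<and> b \<in> sets borel}"
      unfolding mem_Collect_eq by (rule exI[of _ "space L"], rule exI[of _ UNIV]) simp
    then show "range (\<lambda>_ :: nat. space L \<times> (UNIV :: real set)) \<subseteq> {a \<times> b |a b. a \<in> sets L \<and> b \<in> sets borel}"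
      by (rule image_subsetI)
  qed auto
  show thesis
  proof (rule that[OF Qm])
    fix \<psi> :: "'s \<times> real \<Rightarrow> real" and B
    assume \<psi>[measurable]: "\<psi> \<in> borel_measurable (L \<Otimes>\<^sub>M borel)" and bd: "\<And>z. \<bar>\<psi> z\<bar> \<le> B"
    have "(LINT w|\<nu>. \<psi> (T w, R w)) = integral\<^sup>L (L \<bind> ?K) \<psi>"
      unfolding eq[symmetric] by (subst integral_distr) auto
    also have "\<dots> = (LINT t|L. integral\<^sup>L (?K t) \<psi>)"
    proof (rule integral_bind[OF \<psi> bd measurable_prob_algebraD[OF Km]])
      show "AE t in L. emeasure (?K t) (space (?K t)) \<le> ennreal 1"
        using measurable_space[OF Km] by (auto simp: space_prob_algebra prob_space.emeasure_le_1)
    qed (rule L.finite_measure_axioms)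
    also have "\<dots> = (LINT t|L. LINT r|Q t. \<psi> (t, r))"
    proof (rule Bochner_Integration.integral_cong[OF refl])
      fix t assume "t \<in> space L"
      then have "(\<lambda>r. (t, r)) \<in> Q t \<rightarrow>\<^sub>M L \<Otimes>\<^sub>M borel"
        by (simp cong: measurable_cong_sets add: Qp(2))
      then show "integral\<^sup>L (?K t) \<psi> = (LINT r|Q t. \<psi> (t, r))"
        by (rule integral_distr) simp
    qed
    finally show "(LINT w|\<nu>. \<psi> (T w, R w)) = (LINT t|L. LINT r|Q t. \<psi> (t, r))" .
  qed
qed

section \<open>Density in \<open>L\<^sup>1([0,1], C(X))\<close>\<close>

definition L1_dist :: "(real \<Rightarrow> ('a::topological_space \<Rightarrow>\<^sub>C real)) \<Rightarrow> (real \<Rightarrow> ('a \<Rightarrow>\<^sub>C real)) \<Rightarrow> ennreal"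
  where "L1_dist F G = (\<integral>\<^sup>+t. ennreal (norm (F t - G t)) \<partial>unit_lborel)"

section \<open>Lebesgue measure on [0,1] and approximation in L^1\<close>

lemma unit_lborel_prob_space: "prob_space unit_lborel"
  by (rule prob_spaceI) (simp add: emeasure_restrict_space space_restrict_space)

interpretation unit: prob_space unit_lborel
  by (rule unit_lborel_prob_space)

lemma space_unit_lborel [simp]: "space unit_lborel = {0..1}"
  by (simp add: space_restrict_space)

lemma borel_measurable_unit_lborel:
  assumes "f \<in> borel_measurable borel"
  shows "f \<in> borel_measurable unit_lborel"
  by (rule measurable_restrict_space1) (use assms in simp)

lemma sets_unit_lborel_iff: "E \<in> sets unit_lborel \<longleftrightarrow> E \<in> sets borel \<and> E \<subseteq> {0..1}"
  by (auto simp: sets_restrict_space_iff)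

text \<open>Three replacements: the set by a closed subset (inner regularity), its indicator by a
  continuous cutoff (dominated convergence), and the cutoff by a polynomial (Weierstrass).\<close>

lemma indicator_approx_polynomial:
  assumes E: "E \<in> sets unit_lborel" and "\<epsilon> > 0"
  obtains p :: "real \<Rightarrow> real" where "real_polynomial_function p"
    "(\<integral>\<^sup>+t. ennreal \<bar>indicator E t - p t\<bar> \<partial>unit_lborel) < ennreal \<epsilon>"
proof -
  \<comment> \<open>Each of the three replacements costs at most \<delta>; the fourth share keeps
    the final inequality strict.\<close>
  define \<delta> where "\<delta> = \<epsilon> / 4"
  have \<delta>: "\<delta> > 0" using assms(2) by (simp add: \<delta>_def)
  have Eb[measurable]: "E \<in> sets borel" and E01: "E \<subseteq> {0..1}" using E by (auto simp: sets_unit_lborel_iff)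
  have "E \<in> sets lebesgue" by simp
  then obtain T where T: "closed T" "T \<subseteq> E" "E - T \<in> lmeasurable" "emeasure lebesgue (E - T) < ennreal \<delta>"
    using \<delta> by (rule sets_lebesgue_inner_closed)
  have [measurable]: "T \<in> sets borel" using T(1) by simp
  have ET: "E - T \<in> sets unit_lborel" unfolding sets_unit_lborel_iff using E01 by auto
  have "emeasure unit_lborel (E - T) = emeasure lebesgue (E - T)"
    using E01 by (subst emeasure_restrict_space) auto
  then have e1: "(\<integral>\<^sup>+t. ennreal \<bar>indicator E t - indicator T t\<bar> \<partial>unit_lborel) < ennreal \<delta>"
  proof -
    have "(\<integral>\<^sup>+t. ennreal \<bar>indicator E t - indicator T t\<bar> \<partial>unit_lborel) = (\<integral>\<^sup>+t. indicator (E - T) t \<partial>unit_lborel)"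
      by (rule nn_integral_cong) (use T(2) in \<open>auto simp: indicator_def\<close>)
    also have "\<dots> = emeasure unit_lborel (E - T)" using ET by (rule nn_integral_indicator)
    finally show ?thesis using T(4) \<open>emeasure unit_lborel (E - T) = _\<close> by simp
  qed
  obtain f :: "nat \<Rightarrow> real \<Rightarrow> real" where f: "\<And>n. continuous_on UNIV (f n)" "\<And>n x. 0 \<le> f n x"
    "\<And>n x. f n x \<le> 1" "\<And>x. (\<lambda>n. f n x) \<longlonglongrightarrow> indicator T x"
    using closed_indicator_limit[OF T(1)] by metis
  have [measurable]: "f n \<in> borel_measurable unit_lborel" for n
    by (intro borel_measurable_unit_lborel borel_measurable_continuous_onI f)
  have indT[measurable]: "(indicator T :: real \<Rightarrow> real) \<in> borel_measurable unit_lborel" 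
    "(indicator E :: real \<Rightarrow> real) \<in> borel_measurable unit_lborel"
    by (intro borel_measurable_unit_lborel, simp)+
  have bT: "\<bar>indicator T t - f n t\<bar> \<le> 1" for n t
    using f(2)[of n t] f(3)[of n t] by (auto simp: indicator_def)
  have "(\<lambda>n. LINT t|unit_lborel. \<bar>indicator T t - f n t\<bar>) \<longlonglongrightarrow> (LINT t|unit_lborel. 0 :: real)"
  proof (rule integral_dominated_convergence[where w="\<lambda>_. 1"])
    show "AE t in unit_lborel. (\<lambda>n. \<bar>indicator T t - f n t\<bar>) \<longlonglongrightarrow> 0"
    proof (rule AE_I2)
      fix t
      have "(\<lambda>n. \<bar>indicator T t - f n t\<bar>) \<longlonglongrightarrow> \<bar>indicator T t - indicator T t :: real\<bar>"
        by (intro tendsto_rabs tendsto_diff tendsto_const f)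
      then show "(\<lambda>n. \<bar>indicator T t - f n t\<bar>) \<longlonglongrightarrow> 0" by simp
    qed
    show "AE t in unit_lborel. norm \<bar>indicator T t - f n t\<bar> \<le> 1" for n
      using bT by (intro AE_I2) simp
  qed simp_all
  then have "\<forall>\<^sub>F n in sequentially. (LINT t|unit_lborel. \<bar>indicator T t - f n t\<bar>) < \<delta>"
    using \<delta> by (auto dest: order_tendstoD)
  then obtain n where n: "(LINT t|unit_lborel. \<bar>indicator T t - f n t\<bar>) < \<delta>"
    by (auto simp: eventually_sequentially)
  have "(\<integral>\<^sup>+t. ennreal \<bar>indicator T t - f n t\<bar> \<partial>unit_lborel) = ennreal (LINT t|unit_lborel. \<bar>indicator T t - f n t\<bar>)"
  proof (rule nn_integral_eq_integral)
    show "integrable unit_lborel (\<lambda>t. \<bar>indicator T t - f n t\<bar>)"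
      by (rule unit.integrable_const_bound[where B=1]) (use bT in simp_all)
  qed simp
  with n \<delta> have e2: "(\<integral>\<^sup>+t. ennreal \<bar>indicator T t - f n t\<bar> \<partial>unit_lborel) < ennreal \<delta>"
    by (simp add: ennreal_lessI)
  obtain p where p: "real_polynomial_function p" "\<And>t. t \<in> {0..1} \<Longrightarrow> \<bar>f n t - p t\<bar> < \<delta>"
    using Stone_Weierstrass_real_polynomial_function[of "{0..1}" "f n" \<delta>] \<delta> f(1)[of n]
    by (metis compact_Icc continuous_on_subset subset_UNIV)
  have "continuous_on UNIV p"
    by (intro continuous_at_imp_continuous_on ballI continuous_real_polymonial_function p(1))
  then have [measurable]: "p \<in> borel_measurable unit_lborel"
    by (intro borel_measurable_unit_lborel borel_measurable_continuous_onI)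
  have "(\<integral>\<^sup>+t. ennreal \<bar>f n t - p t\<bar> \<partial>unit_lborel) \<le> (\<integral>\<^sup>+t. ennreal \<delta> \<partial>unit_lborel)"
    by (rule nn_integral_mono) (use less_imp_le[OF p(2)] in \<open>auto intro!: ennreal_leI\<close>)
  also have "\<dots> = ennreal \<delta>" by (simp add: unit.emeasure_space_1[simplified])
  finally have e3: "(\<integral>\<^sup>+t. ennreal \<bar>f n t - p t\<bar> \<partial>unit_lborel) \<le> ennreal \<delta>" .
  have "(\<integral>\<^sup>+t. ennreal \<bar>indicator E t - p t\<bar> \<partial>unit_lborel) \<le>
     (\<integral>\<^sup>+t. ennreal \<bar>indicator E t - indicator T t\<bar> + ennreal \<bar>indicator T t - f n t\<bar> + ennreal \<bar>f n t - p t\<bar> \<partial>unit_lborel)"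
  proof (rule nn_integral_mono)
    fix t
    have "\<bar>indicator E t - p t\<bar> \<le> \<bar>indicator E t - indicator T t\<bar> + \<bar>indicator T t - f n t\<bar> + \<bar>f n t - p t\<bar>" by linarith
    then show "ennreal \<bar>indicator E t - p t\<bar> \<le> ennreal \<bar>indicator E t - indicator T t\<bar> + ennreal \<bar>indicator T t - f n t\<bar> + ennreal \<bar>f n t - p t\<bar>"
      by (simp add: ennreal_plus[symmetric] ennreal_leI del: ennreal_plus)
  qed
  also have "\<dots> = (\<integral>\<^sup>+t. ennreal \<bar>indicator E t - indicator T t\<bar> \<partial>unit_lborel) +
      (\<integral>\<^sup>+t. ennreal \<bar>indicator T t - f n t\<bar> \<partial>unit_lborel) + (\<integral>\<^sup>+t. ennreal \<bar>f n t - p t\<bar> \<partial>unit_lborel)"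
    by (simp add: nn_integral_add)
  also have "\<dots> \<le> ennreal \<delta> + ennreal \<delta> + ennreal \<delta>"
    using e1 e2 e3 by (intro add_mono) auto
  also have "\<dots> < ennreal \<epsilon>"
    using \<delta> by (simp add: ennreal_plus[symmetric] ennreal_less_iff \<delta>_def del: ennreal_plus)
  finally show thesis using that p(1) by blast
qed

lemma apply_bcontfun_measurable:
  fixes F :: "'s \<Rightarrow> ('b::topological_space \<Rightarrow>\<^sub>C real)"
  assumes "F \<in> borel_measurable M"
  shows "(\<lambda>t. apply_bcontfun (F t) x) \<in> borel_measurable M"
proof -
  have "continuous_on UNIV (\<lambda>f :: 'b \<Rightarrow>\<^sub>C real. apply_bcontfun f x)"
    unfolding continuous_on_iff
  proof (intro ballI allI impI)
    fix f :: "'b \<Rightarrow>\<^sub>C real" and e :: real assume "e > 0"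
    then show "\<exists>d>0. \<forall>g\<in>UNIV. dist g f < d \<longrightarrow> dist (apply_bcontfun g x) (apply_bcontfun f x) < e"
      by (intro exI[of _ e]) (auto intro: dist_fun_lt_imp_dist_val_lt)
  qed
  then show ?thesis using measurable_compose[OF assms borel_measurable_continuous_onI] by simp
qed

lemma sum_apply_bcontfun [simp]:
  "apply_bcontfun (\<Sum>i\<in>I. f i :: 'b::topological_space \<Rightarrow>\<^sub>C real) x = (\<Sum>i\<in>I. apply_bcontfun (f i) x)"
  by (induction I rule: infinite_finite_induct) auto

lemma step_functionsI:
  fixes f :: "'i \<Rightarrow> ('b::topological_space \<Rightarrow>\<^sub>C real)"
  assumes I: "finite I" "I \<noteq> {}" and E: "\<And>i. i \<in> I \<Longrightarrow> E i \<in> sets unit_lborel"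
  shows "(\<lambda>t. \<Sum>i\<in>I. indicator (E i) t *\<^sub>R f i) \<in> step_functions"
proof -
  obtain h where h: "bij_betw h {1..card I} I"
    using ex_bij_betw_nat_finite_1[OF I(1)] by blast
  have "(\<Sum>i\<in>I. indicator (E i) t *\<^sub>R f i) = (\<Sum>j=1..card I. indicator (E (h j)) t *\<^sub>R f (h j))" for t
    by (rule sum.reindex_bij_betw[OF h, symmetric])
  moreover have "card I \<ge> 1" using I by (simp add: Suc_le_eq card_gt_0_iff)
  moreover have "E (h j) \<in> sets unit_lborel" if "j \<in> {1..card I}" for j
    using bij_betwE[OF h] that by (intro E) blast
  ultimately show ?thesis
    unfolding step_functions_def
    by (intro CollectI exI[of _ "card I"] exI[of _ "\<lambda>j. E (h j)"] exI[of _ "\<lambda>j. f (h j)"]) auto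
qed

text \<open>Rounding the coefficients down to multiples of 1/N leaves finitely many values, because
  they are bounded, and moves the sum by at most C/N in norm.\<close>

lemma L1_contI:
  fixes g :: "nat \<Rightarrow> real \<Rightarrow> real" and f :: "nat \<Rightarrow> ('b::topological_space \<Rightarrow>\<^sub>C real)"
  assumes I: "finite I"
    and g[measurable]: "\<And>i. g i \<in> borel_measurable unit_lborel"
    and B: "\<And>i t. i \<in> I \<Longrightarrow> t \<in> {0..1} \<Longrightarrow> \<bar>g i t\<bar> \<le> B"
  shows "(\<lambda>t. \<Sum>i\<in>I. g i t *\<^sub>R f i) \<in> L1_cont"
  unfolding L1_cont_def
proof (intro CollectI conjI allI impI)
  \<comment> \<open>Measurability into the space of continuous functions is obtained by factoring
    through the coefficient vector, which is measurable into real sequences; the sum depends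
    continuously on it.\<close>
  have "continuous_on UNIV (\<lambda>v :: nat \<Rightarrow> real. \<Sum>i\<in>I. v i *\<^sub>R f i)"
    by (intro continuous_intros continuous_on_product_coordinates)
  moreover have "(\<lambda>t i. g i t) \<in> borel_measurable unit_lborel"
    by (rule measurable_coordinatewise_then_product) simp
  ultimately show "(\<lambda>t. \<Sum>i\<in>I. g i t *\<^sub>R f i) \<in> borel_measurable unit_lborel"
    by (rule measurable_compose[OF _ borel_measurable_continuous_onI, rotated])
next
  fix \<epsilon> :: real assume \<epsilon>: "\<epsilon> > 0"
  define C where "C = (\<Sum>i\<in>I. norm (f i))"
  have "C \<ge> 0" unfolding C_def by (intro sum_nonneg) auto
  obtain N :: nat where N: "N > 0" "C / real N < \<epsilon>"
  proof -
    obtain N :: nat where "real N * \<epsilon> > C" using reals_Archimedean3[OF \<epsilon>] by blast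
    moreover from this have "N > 0" using \<open>C \<ge> 0\<close> by (cases N) auto
    ultimately show thesis using that[of N] by (simp add: field_simps)
  qed
  define K where "K = \<lceil>real N * B\<rceil> + 1"
  have fl: "\<lfloor>real N * g i t\<rfloor> \<in> {-K..K}" if "i \<in> I" "t \<in> {0..1}" for i t
  proof -
    have "\<bar>real N * g i t\<bar> \<le> real N * B" using B[OF that] by (simp add: abs_mult mult_left_mono)
    then show ?thesis unfolding K_def by simp linarith
  qed
  define E where "E = (\<lambda>(i, k :: int). {t \<in> space unit_lborel. \<lfloor>real N * g i t\<rfloor> = k})"
  define h where "h = (\<lambda>(i, k :: int). (real_of_int k / real N) *\<^sub>R f i)"
  \<comment> \<open>The extra index (0, K + 1) lies outside the product and has coefficient 0. It
    keeps the index set nonempty when \<open>I\<close> is empty, as \<open>step_functionsI\<close>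
    demands.\<close>
  let ?S = "\<lambda>t. \<Sum>j\<in>insert (0, K + 1) (I \<times> {-K..K}). indicator (E j) t *\<^sub>R (if j = (0, K + 1) then 0 else h j)"
  show "\<exists>S\<in>step_functions. (\<integral>\<^sup>+t. ennreal (norm ((\<Sum>i\<in>I. g i t *\<^sub>R f i) - S t)) \<partial>unit_lborel) < ennreal \<epsilon>"
  proof
    have "E j \<in> sets unit_lborel" for j unfolding E_def floor_eq_iff by (cases j) (simp only: prod.case, measurable)
    then show "?S \<in> step_functions" using I by (intro step_functionsI) auto
    have "norm ((\<Sum>i\<in>I. g i t *\<^sub>R f i) - ?S t) \<le> C / real N" if t: "t \<in> {0..1}" for t
    proof -
      have "?S t = (\<Sum>j\<in>I \<times> {-K..K}. indicator (E j) t *\<^sub>R h j)"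
        using I by (subst sum.insert) (auto intro!: sum.cong)
      also have "\<dots> = (\<Sum>i\<in>I. \<Sum>k\<in>{-K..K}. indicator (E (i, k)) t *\<^sub>R h (i, k))"
        unfolding sum.cartesian_product by (rule sum.cong) auto
      also have "\<dots> = (\<Sum>i\<in>I. (real_of_int \<lfloor>real N * g i t\<rfloor> / real N) *\<^sub>R f i)"
      proof (rule sum.cong[OF refl])
        fix i assume i: "i \<in> I"
        have "(\<Sum>k\<in>{-K..K}. indicator (E (i, k)) t *\<^sub>R h (i, k))
          = (\<Sum>k\<in>{-K..K}. if k = \<lfloor>real N * g i t\<rfloor> then h (i, k) else 0)"
          using t by (intro sum.cong) (auto simp: E_def)
        also have "\<dots> = h (i, \<lfloor>real N * g i t\<rfloor>)"
          using fl[OF i t] by (subst sum.delta) auto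
        finally show "(\<Sum>k\<in>{-K..K}. indicator (E (i, k)) t *\<^sub>R h (i, k))
          = (real_of_int \<lfloor>real N * g i t\<rfloor> / real N) *\<^sub>R f i" by (simp add: h_def)
      qed
      finally have "(\<Sum>i\<in>I. g i t *\<^sub>R f i) - ?S t
          = (\<Sum>i\<in>I. (g i t - real_of_int \<lfloor>real N * g i t\<rfloor> / real N) *\<^sub>R f i)"
        by (simp add: sum_subtractf scaleR_left_diff_distrib)
      also have "norm \<dots> \<le> (\<Sum>i\<in>I. norm ((g i t - real_of_int \<lfloor>real N * g i t\<rfloor> / real N) *\<^sub>R f i))"
        by (rule norm_sum)
      also have "\<dots> \<le> (\<Sum>i\<in>I. 1 / real N * norm (f i))"
      proof (rule sum_mono)
        fix i
        have "g i t - real_of_int \<lfloor>real N * g i t\<rfloor> / real N = (real N * g i t - real_of_int \<lfloor>real N * g i t\<rfloor>) / real N"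
          using N(1) by (simp add: diff_divide_distrib)
        moreover have "\<bar>real N * g i t - real_of_int \<lfloor>real N * g i t\<rfloor>\<bar> \<le> 1" by linarith
        ultimately have "\<bar>g i t - real_of_int \<lfloor>real N * g i t\<rfloor> / real N\<bar> \<le> 1 / real N"
          by (simp add: divide_right_mono)
        then show "norm ((g i t - real_of_int \<lfloor>real N * g i t\<rfloor> / real N) *\<^sub>R f i) \<le> 1 / real N * norm (f i)"
          by (simp only: norm_scaleR) (rule mult_right_mono, auto)
      qed
      also have "\<dots> = C / real N" by (simp add: C_def sum_divide_distrib)
      finally show ?thesis .
    qed
    then have "(\<integral>\<^sup>+t. ennreal (norm ((\<Sum>i\<in>I. g i t *\<^sub>R f i) - ?S t)) \<partial>unit_lborel) \<le> (\<integral>\<^sup>+t. ennreal (C / real N) \<partial>unit_lborel)"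
      by (intro nn_integral_mono ennreal_leI) auto
    also have "\<dots> = ennreal (C / real N)" by (simp add: unit.emeasure_space_1[simplified])
    also have "\<dots> < ennreal \<epsilon>" using N \<epsilon> by (simp add: ennreal_lessI)
    finally show "(\<integral>\<^sup>+t. ennreal (norm ((\<Sum>i\<in>I. g i t *\<^sub>R f i) - ?S t)) \<partial>unit_lborel) < ennreal \<epsilon>" .
  qed
qed

text \<open>Polynomials in t with coefficients taken from the sequence \<open>c\<close>. Encoding
  the choice of coefficients by a list of indices makes the family countable, and a product of real
  lines indexed by \<open>nat list\<close> is metrizable.\<close>

definition poly_fun :: "(nat \<Rightarrow> ('b::topological_space \<Rightarrow>\<^sub>C real)) \<Rightarrow> nat list \<Rightarrow> real \<Rightarrow> ('b \<Rightarrow>\<^sub>C real)"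
  where "poly_fun c l t = (\<Sum>i<length l. t ^ i *\<^sub>R c (l ! i))"

lemma poly_fun_L1_cont: "poly_fun c l \<in> L1_cont"
proof -
  have "(\<lambda>t. \<Sum>i<length l. t ^ i *\<^sub>R c (l ! i)) \<in> L1_cont"
    by (rule L1_contI[where B=1])
      (auto simp: power_abs[symmetric] power_le_one intro!: borel_measurable_unit_lborel)
  then show ?thesis by (simp add: poly_fun_def[abs_def])
qed

lemma step_functions_apply_measurable:
  assumes "S \<in> step_functions"
  shows "(\<lambda>t. apply_bcontfun (S t) x) \<in> borel_measurable unit_lborel"
proof -
  obtain N :: nat and E f where S: "S = (\<lambda>t. \<Sum>j=1..N. indicator (E j) t *\<^sub>R f j)"
    and [measurable]: "\<forall>j\<in>{1..N}. E j \<in> sets unit_lborel" using assms unfolding step_functions_def by blast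
  show ?thesis
    unfolding S sum_apply_bcontfun scaleR_bcontfun.rep_eq real_scaleR_def by measurable
qed

lemma L1_cont_apply_measurable:
  assumes "F \<in> L1_cont"
  shows "(\<lambda>t. apply_bcontfun (F t) x) \<in> borel_measurable unit_lborel"
  using assms by (auto simp: L1_cont_def intro: apply_bcontfun_measurable)

section \<open>Separability of C(X) and density of the polynomial functions of time\<close>

context
  assumes compact_UNIV: "compact (UNIV :: 'a::metric_space set)"
begin

lemma finite_nets:
  obtains K :: "nat \<Rightarrow> 'a set" where "\<And>p. finite (K p)" "\<And>p x. \<exists>y\<in>K p. dist x y < 1 / real (Suc p)"
proof -
  have "\<exists>K. finite K \<and> (UNIV :: 'a set) \<subseteq> (\<Union>y\<in>K. ball y (1 / real (Suc p)))" for p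
    using compact_UNIV unfolding compact_eq_totally_bounded
    by (meson of_nat_0_less_iff zero_less_Suc zero_less_divide_1_iff)
  then obtain K where K: "\<And>p. finite (K p)" "\<And>p. (UNIV :: 'a set) \<subseteq> (\<Union>y\<in>K p. ball y (1 / real (Suc p)))" by metis
  show thesis
  proof (rule that[of K])
    show "\<exists>y\<in>K p. dist x y < 1 / real (Suc p)" for p x
    proof -
      have "x \<in> (\<Union>y\<in>K p. ball y (1 / real (Suc p)))" using K(2) by blast
      then show ?thesis by (auto simp: dist_commute)
    qed
  qed (rule K)
qed

lemma dense_sequence:
  obtains q :: "nat \<Rightarrow> 'a" where "\<And>x e. e > 0 \<Longrightarrow> \<exists>i. dist x (q i) < e"
proof -
  obtain K :: "nat \<Rightarrow> 'a set" where K: "\<And>p. finite (K p)" "\<And>p x. \<exists>y\<in>K p. dist x y < 1 / real (Suc p)"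
    using finite_nets by metis
  define D where "D = (\<Union>p. K p)"
  have "countable D" unfolding D_def using K(1) by (intro countable_UN) (auto intro: countable_finite)
  moreover have "D \<noteq> {}" using K(2)[where p=0] unfolding D_def by blast
  ultimately have r: "range (from_nat_into D) = D" by (intro range_from_nat_into)
  show thesis
  proof (rule that[of "from_nat_into D"])
    fix x :: 'a and e :: real assume "e > 0"
    then obtain p where p: "1 / real (Suc p) < e" using reals_Archimedean by (auto simp: inverse_eq_divide)
    obtain y where y: "y \<in> K p" "dist x y < 1 / real (Suc p)" using K(2) by blast
    then have "y \<in> range (from_nat_into D)" unfolding r by (auto simp: D_def)
    with y p show "\<exists>i. dist x (from_nat_into D i) < e" by (auto intro: less_trans)
  qed
qed

lemma apply_Bcontfun:
  fixes f :: "'a \<Rightarrow> real"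
  assumes "continuous_on UNIV f"
  shows "apply_bcontfun (Bcontfun f) = f"
proof -
  have "bounded (range f)" using compact_continuous_image[OF assms compact_UNIV] by (rule compact_imp_bounded)
  then have "f \<in> bcontfun" using assms by (simp add: bcontfun_def)
  then show ?thesis by (rule Bcontfun_inverse)
qed

lemma uniform_continuity:
  fixes f :: "'a \<Rightarrow> real"
  assumes "continuous_on UNIV f" "\<epsilon> > 0"
  obtains p where "\<And>x y. dist x y < 1 / real (Suc p) \<Longrightarrow> \<bar>f x - f y\<bar> < \<epsilon>"
proof -
  have "uniformly_continuous_on UNIV f" using assms(1) compact_UNIV by (rule compact_uniformly_continuous)
  then obtain d where d: "d > 0" "\<And>x y. dist x y < d \<Longrightarrow> \<bar>f x - f y\<bar> < \<epsilon>"
    using assms(2) unfolding uniformly_continuous_on_def by (metis UNIV_I dist_commute dist_real_def)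
  obtain p where "1 / real (Suc p) < d" using reals_Archimedean[OF d(1)] by (auto simp: inverse_eq_divide)
  then show thesis using d(2) by (intro that[of p]) auto
qed

text \<open>The tents around the points of a finite net, divided by their sum, form a partition of
  unity. Combining them with rational values at the net points gives countably many functions, and
  uniform continuity makes them approximate everything: at x only net points close to x
  contribute.\<close>

lemma dense_continuous_functions:
  obtains c :: "nat \<Rightarrow> ('a \<Rightarrow>\<^sub>C real)" where "\<And>f e. e > 0 \<Longrightarrow> \<exists>j. norm (f - c j) < e"
proof -
  obtain K :: "nat \<Rightarrow> 'a set" where K: "\<And>p. finite (K p)" "\<And>p x. \<exists>y\<in>K p. dist x y < 1 / real (Suc p)"
    using finite_nets by metis
  define \<phi> where "\<phi> p y x = max 0 (1 / real (Suc p) - dist x y)" for p and x y :: 'a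
  define s where "s p x = (\<Sum>y\<in>K p. \<phi> p y x)" for p x
  have \<phi>0: "0 \<le> \<phi> p y x" for p x y by (simp add: \<phi>_def)
  have s_pos: "s p x > 0" for p x
  proof -
    obtain y where "y \<in> K p" "dist x y < 1 / real (Suc p)" using K(2) by blast
    then have "0 < \<phi> p y x" by (simp add: \<phi>_def)
    moreover have "\<phi> p y x \<le> s p x"
      unfolding s_def using \<open>y \<in> K p\<close> K(1) \<phi>0 by (intro member_le_sum) auto
    ultimately show ?thesis by simp
  qed
  define h where "h p r x = (\<Sum>y\<in>K p. r y * \<phi> p y x / s p x)" for p and r :: "'a \<Rightarrow> real" and x
  have h_cont: "continuous_on UNIV (h p r)" for p r
    unfolding h_def s_def \<phi>_def
    by (intro continuous_intros) (use s_pos in \<open>auto simp: s_def \<phi>_def less_imp_neq[symmetric] dest: less_imp_neq\<close>)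
  define D where "D = (\<Union>p. (\<lambda>r. Bcontfun (h p r)) ` (K p \<rightarrow>\<^sub>E \<rat>))"
  have "countable D" unfolding D_def
    by (intro countable_UN countable_image countable_PiE K countable_rat) simp
  moreover have "D \<noteq> {}"
    unfolding D_def by (auto simp: PiE_eq_empty_iff intro: exI[of _ 0])
  ultimately have r: "range (from_nat_into D) = D" by (intro range_from_nat_into)
  show thesis
  proof (rule that[of "from_nat_into D"])
    fix f :: "'a \<Rightarrow>\<^sub>C real" and e :: real assume e: "e > 0"
    then have e4: "e / 4 > 0" by simp
    obtain p where p: "\<And>x y. dist x y < 1 / real (Suc p) \<Longrightarrow> \<bar>f x - f y\<bar> < e/4"
      using uniform_continuity[OF _ e4, of f] by auto
    have "\<exists>r\<in>\<rat>. \<bar>f y - r\<bar> < e/4" for y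
    proof -
      obtain r where "r \<in> \<rat>" "f y < r" "r < f y + e/4"
        using Rats_dense_in_real[of "f y" "f y + e/4"] e by auto
      then show ?thesis by (intro bexI[of _ r]) auto
    qed
    then obtain r0 where r0: "\<And>y. r0 y \<in> \<rat>" "\<And>y. \<bar>f y - r0 y\<bar> < e/4" by metis
    define r where "r = restrict r0 (K p)"
    have rK: "r \<in> K p \<rightarrow>\<^sub>E \<rat>" using r0 by (auto simp: r_def)
    have "norm (f - Bcontfun (h p r)) \<le> e/2"
    proof (rule norm_bound)
      fix x
      have one: "(\<Sum>y\<in>K p. \<phi> p y x / s p x) = 1"
        using s_pos[of p x] by (simp add: sum_divide_distrib[symmetric] s_def)
      have "f x - h p r x = (\<Sum>y\<in>K p. f x * (\<phi> p y x / s p x)) - h p r x"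
        by (simp only: sum_distrib_left[symmetric] one mult_1_right)
      also have "\<dots> = (\<Sum>y\<in>K p. (f x - r y) * (\<phi> p y x / s p x))"
        unfolding h_def by (simp add: sum_subtractf[symmetric] left_diff_distrib diff_divide_distrib)
      also have "\<bar>\<dots>\<bar> \<le> (\<Sum>y\<in>K p. \<bar>(f x - r y) * (\<phi> p y x / s p x)\<bar>)" by (rule sum_abs)
      also have "\<dots> \<le> (\<Sum>y\<in>K p. e/2 * (\<phi> p y x / s p x))"
      proof (rule sum_mono)
        fix y assume y: "y \<in> K p"
        show "\<bar>(f x - r y) * (\<phi> p y x / s p x)\<bar> \<le> e/2 * (\<phi> p y x / s p x)"
        proof (cases "dist x y < 1 / real (Suc p)")
          case True
          have ry: "r y = r0 y" using y by (simp add: r_def)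
          have "\<bar>f x - r y\<bar> \<le> e/2" using p[OF True] r0(2)[of y] unfolding ry by linarith
          moreover have "0 \<le> \<phi> p y x / s p x" using \<phi>0[of p y x] s_pos[of p x] by simp
          ultimately show ?thesis by (simp only: abs_mult abs_of_nonneg mult_right_mono)
        next
          case False
          then have "\<phi> p y x = 0" by (simp add: \<phi>_def)
          then show ?thesis by simp
        qed
      qed
      also have "\<dots> = e/2" by (simp only: sum_distrib_left[symmetric] one)
      finally show "norm (apply_bcontfun (f - Bcontfun (h p r)) x) \<le> e/2"
        by (simp add: apply_Bcontfun[OF h_cont])
    qed
    have "Bcontfun (h p r) \<in> range (from_nat_into D)" unfolding r using rK by (auto simp: D_def)
    then obtain j where "Bcontfun (h p r) = from_nat_into D j" by blast
    then have "norm (f - from_nat_into D j) < e"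
      using \<open>norm (f - Bcontfun (h p r)) \<le> e/2\<close> e by simp
    then show "\<exists>j. norm (f - from_nat_into D j) < e" ..
  qed
qed


text \<open>The sup norm is a supremum over a countable dense set, so measurability at each point x
  suffices. In this form the lemma covers step functions and elements of \<open>L1_cont\<close>
  alike.\<close>

lemma borel_measurable_norm_bcontfun:
  fixes F :: "'s \<Rightarrow> ('a \<Rightarrow>\<^sub>C real)"
  assumes F: "\<And>x. (\<lambda>t. apply_bcontfun (F t) x) \<in> borel_measurable M"
  shows "(\<lambda>t. norm (F t)) \<in> borel_measurable M"
proof -
  obtain q :: "nat \<Rightarrow> 'a" where q: "\<And>x e. e > 0 \<Longrightarrow> \<exists>i. dist x (q i) < e"
    using dense_sequence by metis
  have eq: "norm f \<le> a \<longleftrightarrow> (\<forall>i. \<bar>f (q i)\<bar> \<le> a)" for f :: "'a \<Rightarrow>\<^sub>C real" and a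
  proof
    assume "norm f \<le> a"
    then show "\<forall>i. \<bar>f (q i)\<bar> \<le> a" using norm_bounded[of f] order_trans by fastforce
  next
    assume a: "\<forall>i. \<bar>f (q i)\<bar> \<le> a"
    show "norm f \<le> a"
    proof (rule norm_bound, rule field_le_epsilon)
      fix x and e :: real assume e: "e > 0"
      obtain p where p: "\<And>x y. dist x y < 1 / real (Suc p) \<Longrightarrow> \<bar>f x - f y\<bar> < e"
        using uniform_continuity[OF _ e, of f] by auto
      obtain i where "dist x (q i) < 1 / real (Suc p)" using q[of "1 / real (Suc p)" x] by auto
      from p[OF this] a[rule_format, of i] show "norm (f x) \<le> a + e" by simp
    qed
  qed
  show ?thesis
    unfolding borel_measurable_iff_le eq using F by simp
qed

lemma L1_dist_triangle:
  fixes F G H :: "real \<Rightarrow> ('a \<Rightarrow>\<^sub>C real)"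
  assumes "\<And>x. (\<lambda>t. apply_bcontfun (F t) x) \<in> borel_measurable unit_lborel"
    "\<And>x. (\<lambda>t. apply_bcontfun (G t) x) \<in> borel_measurable unit_lborel"
    "\<And>x. (\<lambda>t. apply_bcontfun (H t) x) \<in> borel_measurable unit_lborel"
  shows "L1_dist F H \<le> L1_dist F G + L1_dist G H"
proof -
  have [measurable]: "(\<lambda>t. norm (F t - G t)) \<in> borel_measurable unit_lborel"
    "(\<lambda>t. norm (G t - H t)) \<in> borel_measurable unit_lborel"
    using assms by (auto intro!: borel_measurable_norm_bcontfun)
  have "L1_dist F H \<le> (\<integral>\<^sup>+t. ennreal (norm (F t - G t)) + ennreal (norm (G t - H t)) \<partial>unit_lborel)"
    unfolding L1_dist_def
  proof (rule nn_integral_mono)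
    fix t
    have "norm (F t - H t) \<le> norm (F t - G t) + norm (G t - H t)"
      using norm_triangle_ineq[of "F t - G t" "G t - H t"] by simp
    then show "ennreal (norm (F t - H t)) \<le> ennreal (norm (F t - G t)) + ennreal (norm (G t - H t))"
      by (simp add: ennreal_plus[symmetric] ennreal_leI del: ennreal_plus)
  qed
  then show ?thesis unfolding L1_dist_def by (subst (asm) nn_integral_add) auto
qed

text \<open>Approximate by a step function, replace each indicator by a polynomial, collect powers
  of t, and finally replace each of the resulting coefficient functions \<open>v i\<close> by a
  member of the sequence.\<close>

lemma poly_fun_dense:
  fixes c :: "nat \<Rightarrow> ('a \<Rightarrow>\<^sub>C real)"
  assumes c: "\<And>f e. e > 0 \<Longrightarrow> \<exists>j. norm (f - c j) < e" and F: "F \<in> L1_cont" and \<epsilon>: "\<epsilon> > 0"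
  shows "\<exists>l. L1_dist F (poly_fun c l) < ennreal \<epsilon>"
proof -
  obtain S where S: "S \<in> step_functions" "L1_dist F S < ennreal (\<epsilon> / 2)"
    using F \<epsilon> unfolding L1_cont_def L1_dist_def by (auto dest!: spec[of _ "\<epsilon> / 2"])
  then obtain N :: nat and E f where Sdef: "S = (\<lambda>t. \<Sum>j=1..N. indicator (E j) t *\<^sub>R f j)"
    and E: "\<And>j. j \<in> {1..N} \<Longrightarrow> E j \<in> sets unit_lborel" and N: "N \<ge> 1" unfolding step_functions_def by auto
  define M where "M = (\<Sum>j=1..N. norm (f j)) + 1"
  have M: "M > 0" unfolding M_def by (intro add_nonneg_pos sum_nonneg) auto
  \<comment> \<open>The summand 1 in \<open>M\<close> keeps the denominator positive. The
    polynomials then cost at most \<epsilon>/4 and the coefficients at most \<epsilon>/8, which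
    together with \<epsilon>/2 for the step function stays below \<epsilon>.\<close>
  define \<delta> where "\<delta> = \<epsilon> / (4 * M)"
  have \<delta>: "\<delta> > 0" using \<epsilon> M by (simp add: \<delta>_def)
  have "\<exists>p. real_polynomial_function p \<and> (\<integral>\<^sup>+t. ennreal \<bar>indicator (E j) t - p t\<bar> \<partial>unit_lborel) < ennreal \<delta>"
    if "j \<in> {1..N}" for j
    using indicator_approx_polynomial[OF E[OF that] \<delta>] by metis
  then obtain p where p: "\<And>j. j \<in> {1..N} \<Longrightarrow> real_polynomial_function (p j)"
    "\<And>j. j \<in> {1..N} \<Longrightarrow> (\<integral>\<^sup>+t. ennreal \<bar>indicator (E j) t - p j t\<bar> \<partial>unit_lborel) < ennreal \<delta>" by metis
  have "\<exists>a n. p j = (\<lambda>t. \<Sum>i\<le>(n :: nat). a i * t ^ i)" if "j \<in> {1..N}" for j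
    using real_polynomial_function_imp_sum[OF p(1)[OF that]] .
  then obtain a n where an: "\<And>j. j \<in> {1..N} \<Longrightarrow> p j = (\<lambda>t. \<Sum>i\<le>(n j :: nat). a j i * t ^ i)" by metis
  define D where "D = Suc (Max (n ` {1..N}))"
  have D: "n j < D" if "j \<in> {1..N}" for j unfolding D_def using that by (auto simp: less_Suc_eq_le intro!: Max_ge)
  \<comment> \<open>Padding with zeros up to the common length \<open>D\<close> allows the two sums
    to be interchanged.\<close>
  define a' where "a' j i = (if i \<le> n j then a j i else 0)" for j i
  have p_eq: "p j t = (\<Sum>i<D. a' j i * t ^ i)" if "j \<in> {1..N}" for j t
  proof -
    have "(\<Sum>i<D. a' j i * t ^ i) = (\<Sum>i\<le>n j. a' j i * t ^ i)"
      by (rule sum.mono_neutral_right) (use D[OF that] in \<open>auto simp: a'_def\<close>)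
    then show ?thesis by (simp add: an[OF that] a'_def)
  qed
  define v where "v i = (\<Sum>j=1..N. a' j i *\<^sub>R f j)" for i
  have D0: "D > 0" by (simp add: D_def)
  \<comment> \<open>There are \<open>D\<close> coefficients, each multiplied by a power of t that is
    at most 1, so their total error is \<epsilon>/8.\<close>
  then have "\<epsilon> / (8 * real D) > 0" using \<epsilon> by simp
  from c[OF this] have "\<exists>j. norm (v i - c j) < \<epsilon> / (8 * real D)" for i by blast
  then obtain J where J: "\<And>i. norm (v i - c (J i)) < \<epsilon> / (8 * real D)" by metis
  define l where "l = map J [0..<D]"
  have P: "(\<Sum>i<D. t ^ i *\<^sub>R v i) = (\<Sum>j=1..N. p j t *\<^sub>R f j)" for t
  proof -
    have "(\<Sum>i<D. t ^ i *\<^sub>R v i) = (\<Sum>i<D. \<Sum>j=1..N. (a' j i * t ^ i) *\<^sub>R f j)"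
      by (simp add: v_def scaleR_sum_right mult.commute)
    also have "\<dots> = (\<Sum>j=1..N. \<Sum>i<D. (a' j i * t ^ i) *\<^sub>R f j)" by (rule sum.swap)
    also have "\<dots> = (\<Sum>j=1..N. p j t *\<^sub>R f j)" by (simp add: p_eq scaleR_sum_left)
    finally show ?thesis .
  qed
  have bound: "norm (S t - poly_fun c l t) \<le> (\<Sum>j=1..N. norm (f j) * \<bar>indicator (E j) t - p j t\<bar>) + \<epsilon> / 8"
    if t: "t \<in> {0..1}" for t
  proof -
    have "S t - poly_fun c l t = (\<Sum>j=1..N. (indicator (E j) t - p j t) *\<^sub>R f j) + (\<Sum>i<D. t ^ i *\<^sub>R (v i - c (J i)))"
      unfolding Sdef poly_fun_def
      by (simp add: l_def scaleR_left_diff_distrib scaleR_right_diff_distrib sum_subtractf P)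
    also have "norm \<dots> \<le> (\<Sum>j=1..N. norm ((indicator (E j) t - p j t) *\<^sub>R f j)) + (\<Sum>i<D. norm (t ^ i *\<^sub>R (v i - c (J i))))"
      by (intro norm_triangle_le add_mono norm_sum)
    also have "(\<Sum>i<D. norm (t ^ i *\<^sub>R (v i - c (J i)))) \<le> (\<Sum>i<D. \<epsilon> / (8 * real D))"
    proof (rule sum_mono)
      fix i
      have "norm (t ^ i *\<^sub>R (v i - c (J i))) = t ^ i * norm (v i - c (J i))" using t by simp
      also have "\<dots> \<le> 1 * norm (v i - c (J i))" using t by (intro mult_right_mono power_le_one) auto
      finally show "norm (t ^ i *\<^sub>R (v i - c (J i))) \<le> \<epsilon> / (8 * real D)" using J[of i] by simp
    qed
    also have "(\<Sum>i<D. \<epsilon> / (8 * real D)) = \<epsilon> / 8" using D0 by simp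
    finally show ?thesis by (simp add: mult.commute)
  qed
  have pm: "p j \<in> borel_measurable unit_lborel" if "j \<in> {1..N}" for j
    unfolding an[OF that] by (intro borel_measurable_unit_lborel) simp
  have Em: "(indicator (E j) :: real \<Rightarrow> real) \<in> borel_measurable unit_lborel" if "j \<in> {1..N}" for j
    using E[OF that] by simp
  have "L1_dist S (poly_fun c l) \<le> (\<integral>\<^sup>+t. (\<Sum>j=1..N. ennreal (norm (f j)) * ennreal \<bar>indicator (E j) t - p j t\<bar>) + ennreal (\<epsilon> / 8) \<partial>unit_lborel)"
    unfolding L1_dist_def
  proof (rule nn_integral_mono)
    fix t assume "t \<in> space unit_lborel"
    then have "ennreal (norm (S t - poly_fun c l t)) \<le> ennreal ((\<Sum>j=1..N. norm (f j) * \<bar>indicator (E j) t - p j t\<bar>) + \<epsilon> / 8)"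
      using bound[of t] by (intro ennreal_leI) simp
    also have "\<dots> = (\<Sum>j=1..N. ennreal (norm (f j)) * ennreal \<bar>indicator (E j) t - p j t\<bar>) + ennreal (\<epsilon> / 8)"
      using \<epsilon> by (subst ennreal_plus) (auto simp: sum_nonneg sum_ennreal[symmetric] ennreal_mult)
    finally show "ennreal (norm (S t - poly_fun c l t)) \<le> \<dots>" .
  qed
  also have "\<dots> = (\<Sum>j=1..N. \<integral>\<^sup>+t. ennreal (norm (f j)) * ennreal \<bar>indicator (E j) t - p j t\<bar> \<partial>unit_lborel) + ennreal (\<epsilon> / 8)"
    by (subst nn_integral_add)
      (auto simp: unit.emeasure_space_1[simplified] intro!: nn_integral_sum borel_measurable_sum pm Em
        borel_measurable_times_ennreal measurable_compose[OF _ measurable_ennreal] borel_measurable_abs borel_measurable_diff)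
  also have "(\<Sum>j=1..N. \<integral>\<^sup>+t. ennreal (norm (f j)) * ennreal \<bar>indicator (E j) t - p j t\<bar> \<partial>unit_lborel)
      \<le> (\<Sum>j=1..N. ennreal (norm (f j)) * ennreal \<delta>)"
  proof (rule sum_mono)
    fix j assume j: "j \<in> {1..N}"
    note [measurable] = pm[OF j] Em[OF j]
    have "(\<integral>\<^sup>+t. ennreal (norm (f j)) * ennreal \<bar>indicator (E j) t - p j t\<bar> \<partial>unit_lborel)
        = ennreal (norm (f j)) * (\<integral>\<^sup>+t. ennreal \<bar>indicator (E j) t - p j t\<bar> \<partial>unit_lborel)"
      by (rule nn_integral_cmult) measurable
    also have "\<dots> \<le> ennreal (norm (f j)) * ennreal \<delta>"
      by (rule mult_left_mono[OF less_imp_le[OF p(2)[OF j]]]) simp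
    finally show "(\<integral>\<^sup>+t. ennreal (norm (f j)) * ennreal \<bar>indicator (E j) t - p j t\<bar> \<partial>unit_lborel)
        \<le> ennreal (norm (f j)) * ennreal \<delta>" .
  qed
  also have "(\<Sum>j=1..N. ennreal (norm (f j)) * ennreal \<delta>) = ennreal ((M - 1) * \<delta>)"
    using \<delta> by (simp add: M_def ennreal_mult[symmetric] sum_distrib_right sum_ennreal)
  also have "ennreal ((M - 1) * \<delta>) + ennreal (\<epsilon> / 8) = ennreal ((M - 1) * \<delta> + \<epsilon> / 8)"
    using \<epsilon> \<delta> by (intro ennreal_plus[symmetric]) (auto simp: M_def sum_nonneg)
  also have "\<dots> \<le> ennreal (3 * \<epsilon> / 8)"
  proof (rule ennreal_leI)
    have "M * \<delta> = \<epsilon> / 4" using M by (simp add: \<delta>_def)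
    then show "(M - 1) * \<delta> + \<epsilon> / 8 \<le> 3 * \<epsilon> / 8" using \<delta> \<epsilon> by (simp add: left_diff_distrib)
  qed
  finally have *: "L1_dist S (poly_fun c l) \<le> ennreal (3 * \<epsilon> / 8)" by (simp add: add_mono)
  have "L1_dist F (poly_fun c l) \<le> L1_dist F S + L1_dist S (poly_fun c l)"
    by (rule L1_dist_triangle)
      (auto intro: L1_cont_apply_measurable F poly_fun_L1_cont step_functions_apply_measurable S)
  also have "\<dots> \<le> ennreal (\<epsilon> / 2) + ennreal (3 * \<epsilon> / 8)"
    using S(2) * by (intro add_mono) auto
  also have "\<dots> < ennreal \<epsilon>" using \<epsilon> by (simp add: ennreal_plus[symmetric] ennreal_less_iff del: ennreal_plus)
  finally show ?thesis by blast
qed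

end

section \<open>The space of kernels\<close>

lemma prob_integral_diff_le:
  fixes f g :: "'w \<Rightarrow> real"
  assumes M: "prob_space M" and fg: "integrable M f" "integrable M g"
    and e: "\<And>x. x \<in> space M \<Longrightarrow> \<bar>f x - g x\<bar> \<le> e"
  shows "\<bar>integral\<^sup>L M f - integral\<^sup>L M g\<bar> \<le> e"
proof -
  interpret prob_space M by fact
  have "\<bar>LINT x|M. f x - g x\<bar> \<le> (LINT x|M. \<bar>f x - g x\<bar>)" by (rule integral_abs_bound)
  also have "\<dots> \<le> (LINT x|M. e)"
    by (intro integral_mono integrable_abs Bochner_Integration.integrable_diff integrable_const fg e)
  finally show ?thesis using fg by (simp add: prob_space)
qed

lemma integrable_bcontfun:
  fixes f :: "'b::topological_space \<Rightarrow>\<^sub>C real"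
  assumes "prob_space M" "sets M = sets borel"
  shows "integrable M (apply_bcontfun f)"
proof -
  interpret prob_space M by fact
  have "apply_bcontfun f \<in> borel_measurable M"
    using borel_measurable_continuous_onI[of "apply_bcontfun f"] by (simp cong: measurable_cong_sets add: assms(2))
  then show ?thesis
    by (intro integrable_const_bound[where B="norm f"]) (auto intro: norm_bounded[of f, simplified])
qed

lemma prob_integral_bcontfun_diff:
  fixes f g :: "'b::topological_space \<Rightarrow>\<^sub>C real"
  assumes "prob_space M" "sets M = sets borel"
  shows "\<bar>(LINT x|M. f x) - (LINT x|M. g x)\<bar> \<le> norm (f - g)"
  using norm_bounded[of "f - g"]
  by (intro prob_integral_diff_le assms integrable_bcontfun[OF assms]) (simp add: minus_bcontfun.rep_eq)

lemma prob_integral_bcontfun_le: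
  fixes f :: "'b::topological_space \<Rightarrow>\<^sub>C real"
  assumes "prob_space M" "sets M = sets borel"
  shows "\<bar>LINT x|M. f x\<bar> \<le> norm f"
  using prob_integral_bcontfun_diff[OF assms, of f 0] by simp

lemma kernel_prob:
  assumes "is_kernel m" "t \<in> {0..1}"
  shows "prob_space (m t)" "sets (m t) = sets borel"
  using assms by (auto simp: is_kernel_def space_prob_algebra)

lemma kernel_measurable_integral:
  fixes f :: "'b::topological_space \<Rightarrow>\<^sub>C real"
  assumes "is_kernel m"
  shows "(\<lambda>t. LINT x|m t. apply_bcontfun f x) \<in> borel_measurable unit_lborel"
  using assms by (auto simp: is_kernel_def)

lemma is_kernelI:
  assumes "m \<in> measurable unit_lborel (prob_algebra borel)"
  shows "is_kernel m"
  unfolding is_kernel_def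
proof (intro conjI ballI allI)
  show "m t \<in> space (prob_algebra borel)" if "t \<in> {0..1}" for t
    using measurable_space[OF assms, of t] that by simp
  show "(\<lambda>t. LINT x|m t. apply_bcontfun f x) \<in> borel_measurable unit_lborel" for f :: "'a \<Rightarrow>\<^sub>C real"
    by (rule measurable_compose[OF measurable_prob_algebraD[OF assms] integral_measurable_subprob_algebra])
      (simp add: borel_measurable_continuous_onI)
qed

lemma abs_rep_kernels_eqI:
  assumes "AE t in unit_lborel. rep_kernels \<kappa> t = rep_kernels \<kappa>' t"
  shows "\<kappa> = \<kappa>'"
  using Quotient3_rel_rep[OF Quotient3_kernels, of \<kappa> \<kappa>'] assms is_kernel_rep[of \<kappa>] is_kernel_rep[of \<kappa>']
  by (simp add: kernel_eq_def)

lemma continuous_pairing: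
  assumes "F \<in> L1_cont"
  shows "continuous_on UNIV (\<lambda>\<kappa>. pairing \<kappa> F)"
proof (rule continuous_on_open_vimage[THEN iffD2, rule_format])
  fix U :: "real set" assume "open U"
  then show "open ((\<lambda>\<kappa>. pairing \<kappa> F) -` U \<inter> UNIV)"
    unfolding open_kernels_def using assms by (auto intro!: generate_topology.Basis simp: vimage_def)
qed simp

text \<open>The coordinates of the kernel space. The lemmas below show that for dense
  \<open>c\<close> this map is injective and induces the topology, so it stands in for a
  metric.\<close>

definition moments :: "(nat \<Rightarrow> ('b::topological_space \<Rightarrow>\<^sub>C real)) \<Rightarrow> 'b kernels \<Rightarrow> nat list \<Rightarrow> real"
  where "moments c \<kappa> l = pairing \<kappa> (poly_fun c l)"

lemma continuous_moments: "continuous_on UNIV (moments c)"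
  unfolding moments_def
  by (intro continuous_on_coordinatewise_then_product continuous_pairing poly_fun_L1_cont)

context
  assumes compact_UNIV: "compact (UNIV :: 'a::metric_space set)"
begin

lemma L1_dist_finite:
  fixes F :: "real \<Rightarrow> ('a \<Rightarrow>\<^sub>C real)"
  assumes F: "F \<in> L1_cont"
  shows "L1_dist F (\<lambda>_. 0) < \<infinity>"
proof -
  obtain S where S: "S \<in> step_functions" "L1_dist F S < ennreal 1"
    using F unfolding L1_cont_def L1_dist_def by (auto dest!: spec[of _ 1])
  then obtain N :: nat and E f where Sdef: "S = (\<lambda>t. \<Sum>j=1..N. indicator (E j) t *\<^sub>R f j)"
    unfolding step_functions_def by auto
  have "norm (S t) \<le> (\<Sum>j=1..N. norm (f j))" for t
    unfolding Sdef by (rule order_trans[OF norm_sum], rule sum_mono) (simp add: indicator_def)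
  then have "L1_dist S (\<lambda>_. 0) \<le> (\<integral>\<^sup>+t. ennreal (\<Sum>j=1..N. norm (f j)) \<partial>unit_lborel)"
    unfolding L1_dist_def by (intro nn_integral_mono) (simp add: ennreal_leI)
  also have "\<dots> < \<infinity>" by (simp add: unit.emeasure_space_1[simplified])
  finally have "L1_dist S (\<lambda>_. 0) < \<infinity>" .
  moreover have "L1_dist F (\<lambda>_. 0) \<le> L1_dist F S + L1_dist S (\<lambda>_. 0)"
    by (rule L1_dist_triangle[OF compact_UNIV])
      (auto intro: L1_cont_apply_measurable F step_functions_apply_measurable S)
  moreover have "L1_dist F S < \<infinity>" using less_trans[OF S(2) ennreal_less_top] by simp
  ultimately show ?thesis
    by (metis ennreal_add_less_top infinity_ennreal_def le_less_trans)
qed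

text \<open>Both the measure and the integrand vary with t. Replacing \<open>F t\<close> by the
  first member of a dense sequence within 1/(n+1) leaves a measurable choice among countably many
  fixed integrands, and the error tends to 0 because each \<open>K t\<close> has mass 1.\<close>

lemma fibre_integral_measurable:
  fixes F :: "'s \<Rightarrow> ('a \<Rightarrow>\<^sub>C real)"
  assumes K: "\<And>t. t \<in> space M \<Longrightarrow> prob_space (K t)" "\<And>t. t \<in> space M \<Longrightarrow> sets (K t) = sets borel"
    and Kf: "\<And>f :: 'a \<Rightarrow>\<^sub>C real. (\<lambda>t. LINT x|K t. f x) \<in> borel_measurable M"
    and F: "\<And>x. (\<lambda>t. apply_bcontfun (F t) x) \<in> borel_measurable M"
  shows "(\<lambda>t. LINT x|K t. F t x) \<in> borel_measurable M"
proof -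
  obtain c :: "nat \<Rightarrow> ('a \<Rightarrow>\<^sub>C real)" where c: "\<And>f e. e > 0 \<Longrightarrow> \<exists>j. norm (f - c j) < e"
    using dense_continuous_functions[OF compact_UNIV] by metis
  define J where "J n t = (LEAST j. norm (F t - c j) < 1 / real (Suc n))" for n t
  have J: "norm (F t - c (J n t)) < 1 / real (Suc n)" for n t
    unfolding J_def by (rule LeastI_ex) (rule c, simp)
  have [measurable]: "(\<lambda>t. norm (F t - c j)) \<in> borel_measurable M" for j
    by (rule borel_measurable_norm_bcontfun[OF compact_UNIV]) (use F in simp)
  have [measurable]: "J n \<in> measurable M (count_space UNIV)" for n
    unfolding J_def by measurable
  show ?thesis
  proof (rule borel_measurable_LIMSEQ_real)
    show "(\<lambda>t. LINT x|K t. c (J n t) x) \<in> borel_measurable M" for n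
      by (rule measurable_compose_countable[where f="\<lambda>j t. LINT x|K t. c j x"]) (use Kf in auto)
    show "(\<lambda>n. LINT x|K t. c (J n t) x) \<longlonglongrightarrow> (LINT x|K t. F t x)" if "t \<in> space M" for t
    proof (rule LIMSEQ_I)
      fix e :: real assume "e > 0"
      then obtain N where N: "1 / real (Suc N) < e" using reals_Archimedean by (auto simp: inverse_eq_divide)
      have "norm ((LINT x|K t. c (J n t) x) - (LINT x|K t. F t x)) < e" if "n \<ge> N" for n
      proof -
        have "\<bar>(LINT x|K t. c (J n t) x) - (LINT x|K t. F t x)\<bar> \<le> norm (c (J n t) - F t)"
          using K[OF \<open>t \<in> space M\<close>] by (rule prob_integral_bcontfun_diff)
        also have "\<dots> < 1 / real (Suc n)" using J[of t n] by (simp add: norm_minus_commute)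
        also have "\<dots> \<le> 1 / real (Suc N)" using that by (intro divide_left_mono) auto
        finally show ?thesis using N by simp
      qed
      then show "\<exists>N. \<forall>n\<ge>N. norm ((LINT x|K t. c (J n t) x) - (LINT x|K t. F t x)) < e" by blast
    qed
  qed
qed

lemma kernel_fibre_integral_measurable:
  fixes F :: "real \<Rightarrow> ('a \<Rightarrow>\<^sub>C real)"
  assumes "is_kernel m" "\<And>x. (\<lambda>t. apply_bcontfun (F t) x) \<in> borel_measurable unit_lborel"
  shows "(\<lambda>t. LINT x|m t. F t x) \<in> borel_measurable unit_lborel"
  by (rule fibre_integral_measurable)
    (use assms kernel_prob[OF assms(1)] kernel_measurable_integral[OF assms(1)] in auto)

lemma pairing_abs_kernels:
  fixes F :: "real \<Rightarrow> ('a \<Rightarrow>\<^sub>C real)"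
  assumes "is_kernel m" "\<And>x. (\<lambda>t. apply_bcontfun (F t) x) \<in> borel_measurable unit_lborel"
  shows "pairing (abs_kernels m) F = (LINT t|unit_lborel. LINT x|m t. F t x)"
  unfolding pairing_def
proof (rule integral_cong_AE)
  show "AE t in unit_lborel. (LINT x|rep_kernels (abs_kernels m) t. F t x) = (LINT x|m t. F t x)"
    using rep_abs_kernels[OF assms(1)] by eventually_elim simp
qed (use assms is_kernel_rep in \<open>auto intro!: kernel_fibre_integral_measurable\<close>)

lemma integrable_fibre_integral:
  fixes F :: "real \<Rightarrow> ('a \<Rightarrow>\<^sub>C real)"
  assumes m: "is_kernel m" and F: "F \<in> L1_cont"
  shows "integrable unit_lborel (\<lambda>t. LINT x|m t. F t x)"
proof (rule integrableI_bounded)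
  show "(\<lambda>t. LINT x|m t. F t x) \<in> borel_measurable unit_lborel"
    using m F by (intro kernel_fibre_integral_measurable L1_cont_apply_measurable)
  have "(\<integral>\<^sup>+t. ennreal (norm (LINT x|m t. F t x)) \<partial>unit_lborel) \<le> L1_dist F (\<lambda>_. 0)"
    unfolding L1_dist_def
    by (intro nn_integral_mono ennreal_leI) (simp add: prob_integral_bcontfun_le kernel_prob[OF m])
  also have "\<dots> < \<infinity>" by (rule L1_dist_finite[OF F])
  finally show "(\<integral>\<^sup>+t. ennreal (norm (LINT x|m t. F t x)) \<partial>unit_lborel) < \<infinity>" .
qed

text \<open>Every fibre is a probability measure, so the bound is uniform in \<kappa>. This
  uniformity is what lets countably many test functions control the whole topology.\<close>

lemma pairing_diff_le:
  fixes F G :: "real \<Rightarrow> ('a \<Rightarrow>\<^sub>C real)"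
  assumes F: "F \<in> L1_cont" and G: "G \<in> L1_cont"
  shows "ennreal \<bar>pairing \<kappa> F - pairing \<kappa> G\<bar> \<le> L1_dist F G"
proof -
  let ?m = "rep_kernels \<kappa>"
  note m = is_kernel_rep[of \<kappa>]
  have "pairing \<kappa> F - pairing \<kappa> G = (LINT t|unit_lborel. (LINT x|?m t. F t x) - (LINT x|?m t. G t x))"
    unfolding pairing_def by (simp add: integrable_fibre_integral[OF m] F G)
  then have "ennreal \<bar>pairing \<kappa> F - pairing \<kappa> G\<bar> \<le>
      (\<integral>\<^sup>+t. ennreal (norm ((LINT x|?m t. F t x) - (LINT x|?m t. G t x))) \<partial>unit_lborel)"
    using integral_norm_bound_ennreal[of unit_lborel "\<lambda>t. (LINT x|?m t. F t x) - (LINT x|?m t. G t x)"]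
    by (simp add: integrable_fibre_integral[OF m] F G)
  also have "\<dots> \<le> L1_dist F G"
    unfolding L1_dist_def
    by (intro nn_integral_mono ennreal_leI) (simp add: prob_integral_bcontfun_diff kernel_prob[OF m])
  finally show ?thesis .
qed

section \<open>The moment map as a topological embedding\<close>

context
  fixes c :: "nat \<Rightarrow> ('a \<Rightarrow>\<^sub>C real)"
  assumes c_dense: "\<And>f e. e > 0 \<Longrightarrow> \<exists>j. norm (f - c j) < e"
begin

lemma pairing_approx:
  assumes F: "F \<in> L1_cont" and "\<epsilon> > 0"
  shows "\<exists>l. \<forall>\<kappa>. \<bar>pairing \<kappa> F - pairing \<kappa> (poly_fun c l)\<bar> < \<epsilon>"
proof -
  obtain l where l: "L1_dist F (poly_fun c l) < ennreal \<epsilon>"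
    using poly_fun_dense[OF compact_UNIV c_dense F assms(2)] by blast
  have "\<bar>pairing \<kappa> F - pairing \<kappa> (poly_fun c l)\<bar> < \<epsilon>" for \<kappa>
    using le_less_trans[OF pairing_diff_le[OF F poly_fun_L1_cont] l] assms(2)
    by (simp add: ennreal_less_iff)
  then show ?thesis by blast
qed

text \<open>Preimages commute with unions and intersections, so only subbasic sets need work; there
  a general test function is replaced, uniformly in the kernel, by one of the countably many
  coordinates.\<close>

lemma open_moments_vimage:
  assumes "open U"
  shows "\<exists>V. open V \<and> U = moments c -` V"
  using assms unfolding open_kernels_def
proof (induction rule: generate_topology.induct)
  case UNIV
  then show ?case by (intro exI[of _ UNIV]) auto
next
  case (Int A B)
  then obtain V W where "open V" "A = moments c -` V" "open W" "B = moments c -` W" by blast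
  then show ?case by (intro exI[of _ "V \<inter> W"]) auto
next
  case (UN K)
  then obtain V where "\<And>A. A \<in> K \<Longrightarrow> open (V A) \<and> A = moments c -` (V A)" by metis
  then show ?case by (intro exI[of _ "\<Union>(V ` K)"]) auto
next
  case (Basis A)
  then obtain F W where A: "A = {\<kappa>. pairing \<kappa> F \<in> W}" and F: "F \<in> L1_cont" and W: "open W" by auto
  have "\<exists>V. open V \<and> moments c \<kappa> \<in> V \<and> moments c -` V \<subseteq> A" if "\<kappa> \<in> A" for \<kappa>
  proof -
    obtain e where e: "e > 0" "ball (pairing \<kappa> F) e \<subseteq> W"
      using W \<open>\<kappa> \<in> A\<close> unfolding A open_contains_ball by blast
    \<comment> \<open>One third for each of the two replacements of \<open>F\<close> by a polynomial
      function, and one third for the distance of the coordinates.\<close>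
    have "e / 3 > 0" using e by simp
    from pairing_approx[OF F this] obtain l where
      l: "\<And>\<kappa>. \<bar>pairing \<kappa> F - moments c \<kappa> l\<bar> < e / 3" unfolding moments_def by blast
    define V where "V = {v :: nat list \<Rightarrow> real. \<bar>v l - moments c \<kappa> l\<bar> < e / 3}"
    have "continuous_on UNIV (\<lambda>v :: nat list \<Rightarrow> real. \<bar>v l - moments c \<kappa> l\<bar>)"
      by (intro continuous_intros continuous_on_product_coordinates)
    then have "open V" unfolding V_def by (intro open_Collect_less continuous_on_const)
    moreover have "moments c \<kappa> \<in> V" using e by (simp add: V_def)
    moreover have "moments c -` V \<subseteq> A"
    proof
      fix \<kappa>' assume "\<kappa>' \<in> moments c -` V"
      then have "\<bar>moments c \<kappa>' l - moments c \<kappa> l\<bar> < e / 3" by (simp add: V_def)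
      then have "dist (pairing \<kappa> F) (pairing \<kappa>' F) < e"
        using l[of \<kappa>] l[of \<kappa>'] unfolding dist_real_def by linarith
      then show "\<kappa>' \<in> A" using e(2) unfolding A by auto
    qed
    ultimately show ?thesis by blast
  qed
  then obtain V where V: "\<And>\<kappa>. \<kappa> \<in> A \<Longrightarrow> open (V \<kappa>) \<and> moments c \<kappa> \<in> V \<kappa> \<and> moments c -` (V \<kappa>) \<subseteq> A" by metis
  show ?case
  proof (intro exI conjI)
    show "open (\<Union>(V ` A))" using V by blast
    show "A = moments c -` \<Union>(V ` A)" using V by blast
  qed
qed

text \<open>By density all pairings agree. Testing with an indicator of a time set times a fixed f
  identifies the fibre integrals of f almost everywhere.\<close>

lemma moments_inject:
  assumes eq: "moments c \<kappa> = moments c \<kappa>'"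
  shows "\<kappa> = \<kappa>'"
proof (rule abs_rep_kernels_eqI)
  let ?m = "rep_kernels \<kappa>" and ?m' = "rep_kernels \<kappa>'"
  note m = is_kernel_rep[of \<kappa>] and m' = is_kernel_rep[of \<kappa>']
  have halves: False if "d \<le> a + b" "a < d / 2" "b < d / 2" for a b d :: real
    using that by linarith
  have pair_eq: "pairing \<kappa> F = pairing \<kappa>' F" if F: "F \<in> L1_cont" for F
  proof (rule ccontr)
    assume "pairing \<kappa> F \<noteq> pairing \<kappa>' F"
    then have "\<bar>pairing \<kappa> F - pairing \<kappa>' F\<bar> / 2 > 0" by simp
    from pairing_approx[OF F this] obtain l where
      l: "\<And>\<kappa>''. \<bar>pairing \<kappa>'' F - moments c \<kappa>'' l\<bar> < \<bar>pairing \<kappa> F - pairing \<kappa>' F\<bar> / 2" unfolding moments_def by blast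
    have "\<bar>pairing \<kappa> F - pairing \<kappa>' F\<bar> \<le> \<bar>pairing \<kappa> F - moments c \<kappa>' l\<bar> + \<bar>pairing \<kappa>' F - moments c \<kappa>' l\<bar>"
      by linarith
    then show False using l[of \<kappa>, unfolded eq] l[of \<kappa>'] by (rule halves)
  qed
  have single: "(\<lambda>t. g t *\<^sub>R f) \<in> L1_cont"
    if "g \<in> borel_measurable unit_lborel" "\<And>t. \<bar>g t\<bar> \<le> 1" for g and f :: "'a \<Rightarrow>\<^sub>C real"
    using L1_contI[of "{0}" "\<lambda>_. g" 1 "\<lambda>_. f"] that by simp
  have int: "integrable unit_lborel (\<lambda>t. LINT x|m t. f x)" if "is_kernel m" for m and f :: "'a \<Rightarrow>\<^sub>C real"
    using integrable_fibre_integral[OF that single[of "\<lambda>_. 1" f]] by simp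
  have "AE t in unit_lborel. (LINT x|?m t. f x) = (LINT x|?m' t. f x)" for f :: "'a \<Rightarrow>\<^sub>C real"
  proof (rule density_unique_real[OF int[OF m] int[OF m']])
    fix E assume E: "E \<in> sets unit_lborel"
    have "(LINT t:E|unit_lborel. LINT x|rep_kernels \<kappa> t. f x) = pairing \<kappa> (\<lambda>t. indicator E t *\<^sub>R f)" for \<kappa> :: "'a kernels"
      unfolding pairing_def set_lebesgue_integral_def by (simp add: scaleR_bcontfun.rep_eq)
    then show "(LINT t:E|unit_lborel. LINT x|?m t. f x) = (LINT t:E|unit_lborel. LINT x|?m' t. f x)"
      using pair_eq[OF single[of "indicator E" f]] E by (simp add: indicator_def)
  qed
  \<comment> \<open>The exceptional null set depends on f. Restricting to the countable dense family
    gives one null set for all, and density then recovers every f at each remaining t.\<close>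
  then have "AE t in unit_lborel. \<forall>j. (LINT x|?m t. c j x) = (LINT x|?m' t. c j x)"
    by (simp add: AE_all_countable)
  then show "AE t in unit_lborel. ?m t = ?m' t"
    using AE_space
  proof eventually_elim
    case (elim t)
    then have t: "t \<in> {0..1}" by simp
    note mt = kernel_prob[OF m t] and mt' = kernel_prob[OF m' t]
    show ?case
    proof (rule measure_eqI_continuous[OF mt mt'])
      fix f0 :: "'a \<Rightarrow> real" assume f0: "continuous_on UNIV f0"
      define f where "f = Bcontfun f0"
      have "(LINT x|?m t. f x) = (LINT x|?m' t. f x)"
      proof (rule ccontr)
        assume ne: "(LINT x|?m t. f x) \<noteq> (LINT x|?m' t. f x)"
        then have "\<bar>(LINT x|?m t. f x) - (LINT x|?m' t. f x)\<bar> / 2 > 0" by simp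
        from c_dense[OF this] obtain j where
          j: "norm (f - c j) < \<bar>(LINT x|?m t. f x) - (LINT x|?m' t. f x)\<bar> / 2" by blast
        have "\<bar>(LINT x|?m t. f x) - (LINT x|?m' t. f x)\<bar>
            \<le> \<bar>(LINT x|?m t. f x) - (LINT x|?m t. c j x)\<bar> + \<bar>(LINT x|?m' t. f x) - (LINT x|?m' t. c j x)\<bar>"
          unfolding spec[OF elim(1), of j] by linarith
        then show False
          using le_less_trans[OF prob_integral_bcontfun_diff[OF mt, of f "c j"] j]
            le_less_trans[OF prob_integral_bcontfun_diff[OF mt', of f "c j"] j] by (rule halves)
      qed
      then show "integral\<^sup>L (?m t) f0 = integral\<^sup>L (?m' t) f0"
        by (simp add: f_def apply_Bcontfun[OF compact_UNIV f0])
    qed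
  qed
qed

end

end

section \<open>Compactness of the space of kernels\<close>

lemma seq_compactI_metric:
  fixes S :: "'b::metric_space set"
  assumes "\<And>f :: nat \<Rightarrow> 'b. (\<And>n. f n \<in> S) \<Longrightarrow> \<exists>l\<in>S. \<exists>r. strict_mono r \<and> (f \<circ> r) \<longlonglongrightarrow> l"
  shows "compact S"
  unfolding compact_eq_seq_compact_metric seq_compact_def using assms by blast

lemma tendsto_componentwise:
  fixes l :: "'i \<Rightarrow> 'b::topological_space"
  assumes "\<And>i. ((\<lambda>n. f n i) \<longlongrightarrow> l i) F"
  shows "(f \<longlongrightarrow> l) F"
proof -
  have "limitin (product_topology (\<lambda>_. euclidean) UNIV) f l F"
    using assms by (simp add: limitin_componentwise)
  then show ?thesis by (simp add: euclidean_product_topology)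
qed

lemma continuous_apply_bcontfun_compose:
  "continuous_on A g \<Longrightarrow> continuous_on A (\<lambda>w. apply_bcontfun f (g w))"
  by (rule continuous_on_compose2[OF continuous_on_apply_bcontfun]) auto

context
  fixes c :: "nat \<Rightarrow> ('a::metric_space \<Rightarrow>\<^sub>C real)"
  assumes compact_UNIV: "compact (UNIV :: 'a set)"
begin

text \<open>A kernel together with the uniform law of t is one probability measure on X times [0,1],
  and weak limits of such measures exist. The work lies in returning from the limit to a kernel, for
  which its time marginal must be shown to be uniform.\<close>

lemma kernels_sequentially_compact:
  fixes m :: "nat \<Rightarrow> real \<Rightarrow> 'a measure"
  assumes m: "\<And>n. is_kernel (m n)"
  obtains r :: "nat \<Rightarrow> nat" and m' where "strict_mono r" "is_kernel m'"
    "\<And>l. (\<lambda>n. LINT t|unit_lborel. LINT x|m (r n) t. poly_fun c l t x)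
      \<longlonglongrightarrow> (LINT t|unit_lborel. LINT x|m' t. poly_fun c l t x)"
proof -
  obtain q :: "nat \<Rightarrow> 'a" where q: "\<And>x e. e > 0 \<Longrightarrow> \<exists>i. dist x (q i) < e"
    using dense_sequence[OF compact_UNIV] by metis
  \<comment> \<open>Coordinate 0 stores the time, the others the distances to a dense sequence,
    which determine the point. The target is a complete space, as required by
    \<open>compact_borel_code\<close> and \<open>weak_sequential_compactness\<close>.\<close>
  define emb :: "'a \<times> real \<Rightarrow> nat \<Rightarrow> real" where
    "emb = (\<lambda>(x, t). case_nat t (\<lambda>i. dist x (q i)))"
  have emb_cont: "continuous_on A emb" for A
    unfolding emb_def
  proof (rule continuous_on_coordinatewise_then_product)
    fix i show "continuous_on A (\<lambda>p. (case p of (x, t) \<Rightarrow> case_nat t (\<lambda>i. dist x (q i))) i)"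
      by (cases i) (auto simp: case_prod_beta intro!: continuous_intros)
  qed
  have emb_0 [simp]: "emb (x, t) 0 = t" and emb_Suc: "emb (x, t) (Suc i) = dist x (q i)" for x t i
    by (simp_all add: emb_def)
  have emb_inj: "p = p'" if eq: "emb p = emb p'" for p p'
  proof -
    obtain x t y s where p: "p = (x, t)" "p' = (y, s)" by (cases p, cases p')
    have ts: "t = s" using fun_cong[OF eq, of 0] by (simp add: p)
    have d: "dist x (q i) = dist y (q i)" for i
      using fun_cong[OF eq, of "Suc i"] by (simp add: p emb_Suc)
    have "x = y"
    proof (rule ccontr)
      assume "x \<noteq> y"
      then have "dist x y / 2 > 0" by simp
      from q[OF this, of x] obtain i where "dist x (q i) < dist x y / 2" by blast
      then show False using dist_triangle2[of x y "q i"] d[of i] by simp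
    qed
    with ts show ?thesis by (simp add: p)
  qed
  define Y where "Y = (UNIV :: 'a set) \<times> {0..1::real}"
  have Y: "compact Y" unfolding Y_def by (intro compact_Times compact_UNIV) simp
  define S where "S = emb ` Y"
  have S: "compact S" unfolding S_def by (intro compact_continuous_image emb_cont Y)
  have Sne: "S \<noteq> {}" by (auto simp: S_def Y_def)
  define g where "g = inv emb"
  have g: "g (emb p) = p" for p unfolding g_def by (rule inv_f_f[OF injI]) (rule emb_inj)
  have g_cont: "continuous_on S g"
    unfolding S_def by (rule continuous_on_inv[OF emb_cont Y]) (simp add: g)
  have S_g: "g w \<in> Y" "emb (g w) = w" "w 0 = snd (g w)" "w 0 \<in> {0..1}" if "w \<in> S" for w
    using that by (auto simp: S_def Y_def g)
  obtain e :: "(nat \<Rightarrow> real) \<Rightarrow> real" and C d where e[measurable]: "e \<in> borel_measurable borel"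
    and e02: "\<And>x. 0 \<le> e x" "\<And>x. e x \<le> 2"
    and C: "closed C" "C \<subseteq> {0..2}" "e ` S \<subseteq> C"
    and d: "continuous_on C d" "d ` C \<subseteq> S" "\<And>x. x \<in> S \<Longrightarrow> d (e x) = x"
    using compact_borel_code[OF S Sne] by metis

  have emb_m: "(\<lambda>x. emb (x, t)) \<in> measurable borel borel" for t
    by (intro borel_measurable_continuous_onI continuous_on_compose2[OF emb_cont] continuous_intros) auto
  define N where "N n t = distr (m n t) borel (\<lambda>x. emb (x, t))" for n t
  have emb_mm: "(\<lambda>x. emb (x, t)) \<in> measurable (m n t) borel" if "t \<in> {0..1}" for n t
    using emb_m by (simp cong: measurable_cong_sets add: kernel_prob(2)[OF m that])
  have N_int: "integral\<^sup>L (N n t) f = (LINT x|m n t. f (emb (x, t)))"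
    if "f \<in> borel_measurable borel" "t \<in> {0..1}" for f :: "(nat \<Rightarrow> real) \<Rightarrow> real" and n t
    unfolding N_def by (rule integral_distr[OF emb_mm[OF that(2)] that(1)])
  have N_meas: "N n \<in> measurable unit_lborel (prob_algebra borel)" for n
  proof (rule measurable_prob_algebra_continuous)
    fix f :: "(nat \<Rightarrow> real) \<Rightarrow> real" assume f: "continuous_on UNIV f"
    have fe: "continuous_on A (\<lambda>p. f (emb p))" for A
      by (rule continuous_on_compose2[OF f emb_cont]) auto
    have fx: "continuous_on A (\<lambda>x. f (emb (x, t)))" and ft: "continuous_on B (\<lambda>t. f (emb (x, t)))" for A B x t
      by (auto intro!: continuous_on_compose2[OF fe[of UNIV]] continuous_intros)
    have "(\<lambda>t. LINT x|m n t. Bcontfun (\<lambda>x. f (emb (x, t))) x) \<in> borel_measurable unit_lborel"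
      by (rule kernel_fibre_integral_measurable[OF compact_UNIV m])
        (simp add: apply_Bcontfun[OF compact_UNIV fx] borel_measurable_unit_lborel borel_measurable_continuous_onI ft)
    then show "(\<lambda>t. integral\<^sup>L (N n t) f) \<in> borel_measurable unit_lborel"
      by (rule measurable_cong[THEN iffD1, rotated])
        (simp add: N_int borel_measurable_continuous_onI f apply_Bcontfun[OF compact_UNIV fx])
  qed (auto simp: N_def intro!: prob_space.prob_space_distr kernel_prob[OF m] emb_mm)
  \<comment> \<open>The law of the embedded pair (point, time) when the time is uniform and the
    point is drawn from the fibre over it.\<close>
  define \<nu> where "\<nu> n = unit_lborel \<bind> N n" for n
  have unit: "unit_lborel \<in> space (prob_algebra unit_lborel)"
    by (simp add: space_prob_algebra unit_lborel_prob_space)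
  have nu: "prob_space (\<nu> n)" "sets (\<nu> n) = sets borel" for n
    unfolding \<nu>_def using prob_space_bind'[OF unit N_meas] sets_bind'[OF unit N_meas] by auto
  have N_prob: "prob_space (N n t)" if "t \<in> {0..1}" for n t
    using measurable_space[OF N_meas[of n], of t] that by (simp add: space_prob_algebra)
  have nu_int: "integral\<^sup>L (\<nu> n) f = (LINT t|unit_lborel. LINT x|m n t. f (emb (x, t)))"
    if f: "f \<in> borel_measurable borel" "\<And>w. \<bar>f w\<bar> \<le> B" for f :: "(nat \<Rightarrow> real) \<Rightarrow> real" and n B
  proof -
    have "integral\<^sup>L (\<nu> n) f = (LINT t|unit_lborel. integral\<^sup>L (N n t) f)"
      unfolding \<nu>_def
    proof (rule integral_bind[OF f measurable_prob_algebraD[OF N_meas]])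
      show "AE t in unit_lborel. emeasure (N n t) (space (N n t)) \<le> ennreal 1"
        using N_prob by (auto simp: prob_space.emeasure_le_1)
    qed (rule unit.finite_measure_axioms)
    also have "\<dots> = (LINT t|unit_lborel. LINT x|m n t. f (emb (x, t)))"
      by (rule Bochner_Integration.integral_cong) (auto simp: N_int f(1))
    finally show ?thesis .
  qed
  have S_borel[measurable]: "S \<in> sets borel" using compact_imp_closed[OF S] by simp
  have nu_AE: "AE w in \<nu> n. w \<in> S" for n
    unfolding \<nu>_def
  proof (subst AE_bind[OF measurable_prob_algebraD[OF N_meas]])
    show "AE t in unit_lborel. AE w in N n t. w \<in> S"
    proof (rule AE_I2)
      fix t assume "t \<in> space unit_lborel"
      then have t: "t \<in> {0..1}" by simp
      have "emb (x, t) \<in> S" for x using t by (simp add: S_def Y_def)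
      moreover have "{w \<in> space borel. w \<in> S} \<in> sets borel" using S_borel by simp
      ultimately show "AE w in N n t. w \<in> S"
        unfolding N_def by (subst AE_distr_iff[OF emb_mm[OF t]]) auto
    qed
  qed simp
  have nu_set_int: "(LINT w:S|\<nu> n. f w) = (LINT t|unit_lborel. LINT x|m n t. f (emb (x, t)))"
    if f: "continuous_on S f" for f :: "(nat \<Rightarrow> real) \<Rightarrow> real" and n
  proof -
    have fm: "(\<lambda>w. indicator S w *\<^sub>R f w) \<in> borel_measurable borel"
      by (rule borel_measurable_continuous_on_indicator[OF S_borel f])
    have "compact (f ` S)" using f S by (rule compact_continuous_image)
    then obtain B where B: "\<And>w. w \<in> S \<Longrightarrow> \<bar>f w\<bar> \<le> B" "B > 0"
      using compact_imp_bounded bounded_pos by (metis imageI real_norm_def)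
    have "(LINT w:S|\<nu> n. f w) = (LINT t|unit_lborel. LINT x|m n t. indicator S (emb (x, t)) *\<^sub>R f (emb (x, t)))"
      unfolding set_lebesgue_integral_def by (rule nu_int[OF fm, of B]) (use B in \<open>auto simp: indicator_def\<close>)
    also have "\<dots> = (LINT t|unit_lborel. LINT x|m n t. f (emb (x, t)))"
      by (intro Bochner_Integration.integral_cong refl) (auto simp: S_def Y_def)
    finally show ?thesis .
  qed

  obtain r :: "nat \<Rightarrow> nat" and Q where r: "strict_mono r" and Q: "prob_space Q" "sets Q = sets borel"
    and QS: "AE w in Q. w \<in> S"
    and Qlim: "\<And>f :: (nat \<Rightarrow> real) \<Rightarrow> real. continuous_on S f \<Longrightarrow>
      (\<lambda>k. LINT w:S|\<nu> (r k). f w) \<longlonglongrightarrow> (LINT w:S|Q. f w)"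
    by (rule weak_sequential_compactness[where P=\<nu>, OF S nu nu_AE]) blast
  interpret Q: prob_space Q by fact
  note [measurable_cong] = Q(2)

  \<comment> \<open>Clamping gives a map that is valued in [0,1] everywhere; on \<open>S\<close>,
    which carries \<open>Q\<close>, it is just the time coordinate.\<close>
  define T :: "(nat \<Rightarrow> real) \<Rightarrow> real" where "T w = max 0 (min 1 (w 0))" for w
  have w0[measurable]: "(\<lambda>w. w 0) \<in> borel_measurable (borel :: (nat \<Rightarrow> real) measure)"
    by (intro borel_measurable_continuous_onI continuous_on_product_coordinates)
  have T_S: "T w = w 0" if "w \<in> S" for w using S_g(4)[OF that] by (simp add: T_def)
  have Tm: "T \<in> measurable Q unit_lborel"
  proof (rule measurable_restrict_space2)
    show "T \<in> space Q \<rightarrow> {0..1}" by (auto simp: T_def)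
    show "T \<in> measurable Q lborel" unfolding T_def by measurable
  qed
  \<comment> \<open>Functions of the time alone have the same integral under every \<nu> n, because
    the fibres have mass 1; hence the limit has the same time marginal.\<close>
  have T_law: "distr Q unit_lborel T = unit_lborel"
  proof -
    have eq: "distr Q borel (\<lambda>w. w 0) = distr unit_lborel borel (\<lambda>t. t)"
    proof (rule measure_eqI_continuous)
      have [measurable]: "(\<lambda>t. t) \<in> borel_measurable unit_lborel"
        by (intro borel_measurable_unit_lborel) simp
      show "prob_space (distr Q borel (\<lambda>w. w 0))" "prob_space (distr unit_lborel borel (\<lambda>t. t))"
        by (auto intro!: Q.prob_space_distr unit.prob_space_distr)
      fix f :: "real \<Rightarrow> real" assume f: "continuous_on UNIV f"
      then have [measurable]: "f \<in> borel_measurable borel" by (rule borel_measurable_continuous_onI)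
      have fS: "continuous_on S (\<lambda>w. f (w 0))"
        by (rule continuous_on_compose2[OF f continuous_on_subset[OF continuous_on_product_coordinates]]) auto
      have "(LINT w:S|\<nu> n. f (w 0)) = (LINT t|unit_lborel. f t)" for n
        unfolding nu_set_int[OF fS]
        by (intro Bochner_Integration.integral_cong refl)
          (simp add: prob_space.prob_space[OF kernel_prob(1)[OF m]])
      then have "(LINT w:S|Q. f (w 0)) = (LINT t|unit_lborel. f t)"
        using Qlim[OF fS] by (simp add: LIMSEQ_const_iff)
      moreover have "(LINT w:S|Q. f (w 0)) = (LINT w|Q. f (w 0))"
        unfolding set_lebesgue_integral_def
        by (rule integral_cong_AE) (use QS in auto)
      ultimately show "integral\<^sup>L (distr Q borel (\<lambda>w. w 0)) f = integral\<^sup>L (distr unit_lborel borel (\<lambda>t. t)) f"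
        by (simp add: integral_distr)
    qed simp_all
    show ?thesis
    proof (rule measure_eqI)
      fix E assume "E \<in> sets (distr Q unit_lborel T)"
      then have E: "E \<in> sets unit_lborel" by simp
      then have Eb: "E \<in> sets borel" "E \<subseteq> {0..1}" by (auto simp: sets_unit_lborel_iff)
      have "emeasure (distr Q unit_lborel T) E = emeasure Q (T -` E \<inter> space Q)"
        by (rule emeasure_distr[OF Tm E])
      also have "\<dots> = emeasure Q ((\<lambda>w. w 0) -` E \<inter> space Q)"
      proof (rule emeasure_eq_AE)
        show "AE w in Q. w \<in> T -` E \<inter> space Q \<longleftrightarrow> w \<in> (\<lambda>w. w 0) -` E \<inter> space Q"
          using QS by eventually_elim (auto simp: T_S)
        show "T -` E \<inter> space Q \<in> sets Q" by (rule measurable_sets[OF Tm E])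
        show "(\<lambda>w. w 0) -` E \<inter> space Q \<in> sets Q" using Eb(1) by measurable
      qed
      also have "\<dots> = emeasure (distr Q borel (\<lambda>w. w 0)) E"
        by (rule emeasure_distr[symmetric]) (use Eb in measurable)
      also have "\<dots> = emeasure unit_lborel E"
        unfolding eq using Eb by (subst emeasure_distr) (auto intro!: borel_measurable_unit_lborel simp: Int_absorb2)
      finally show "emeasure (distr Q unit_lborel T) E = emeasure unit_lborel E" .
    qed simp
  qed
  have em: "e \<in> borel_measurable Q" by measurable
  \<comment> \<open>\<open>disintegration\<close> conditions a real variable, so the code
    \<open>e w\<close> takes the place of the point w itself.\<close>
  obtain K where K: "K \<in> measurable unit_lborel (prob_algebra borel)"
    and K_int: "\<And>\<psi> B. \<psi> \<in> borel_measurable (unit_lborel \<Otimes>\<^sub>M borel) \<Longrightarrow> (\<And>z. \<bar>\<psi> z\<bar> \<le> B) \<Longrightarrow>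
      (LINT w|Q. \<psi> (T w, e w)) = (LINT t|unit_lborel. LINT r|K t. \<psi> (t, r) :: real)"
    by (rule disintegration[OF Q(1) em _ Tm T_law]) (use e02 in auto)
  \<comment> \<open>Decodes a real number to a sequence and then to its point of X. Values off
    \<open>C\<close> are immaterial, since \<psi> is compared with \<open>f\<close> only on
    \<open>S\<close>, whose codes lie in \<open>C\<close>.\<close>
  define dec where "dec s = (if s \<in> C then fst (g (d s)) else undefined)" for s
  have dec_m[measurable]: "dec \<in> borel_measurable borel"
    unfolding dec_def
  proof (rule borel_measurable_continuous_on_if)
    show "continuous_on C (\<lambda>s. fst (g (d s)))"
      by (intro continuous_intros continuous_on_compose2[OF g_cont d(1) d(2)])
  qed (use C(1) in auto)
  have dec_e: "dec (e w) = fst (g w)" if "w \<in> S" for w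
    using that C(3) d(3) by (auto simp: dec_def)
  define m' where "m' t = distr (K t) borel dec" for t
  have m'm: "m' \<in> measurable unit_lborel (prob_algebra borel)"
    unfolding m'_def by (rule measurable_distr_prob_space2[OF K]) simp
  show thesis
  proof (rule that[OF r is_kernelI[OF m'm]])
    fix l
    define f where "f w = poly_fun c l (w 0) (fst (g w))" for w :: "nat \<Rightarrow> real"
    \<comment> \<open>\<open>f\<close> rewritten in terms of time and code; clamping t keeps it
      bounded on the whole product, not only over [0,1].\<close>
    define \<psi> where "\<psi> = (\<lambda>(t, s). \<Sum>i<length l. (max 0 (min 1 t)) ^ i * c (l ! i) (dec s))"
    have f_eq: "f w = (\<Sum>i<length l. w 0 ^ i * c (l ! i) (fst (g w)))" for w
      by (simp add: f_def poly_fun_def scaleR_bcontfun.rep_eq)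
    have f_cont: "continuous_on S f"
      unfolding f_eq[abs_def]
      by (intro continuous_intros continuous_on_subset[OF continuous_on_product_coordinates]
          continuous_apply_bcontfun_compose g_cont) auto
    have "(LINT w:S|Q. f w) = (LINT w|Q. \<psi> (T w, e w))"
      unfolding set_lebesgue_integral_def
    proof (rule integral_cong_AE)
      show "(\<lambda>w. indicator S w *\<^sub>R f w) \<in> borel_measurable Q"
        using borel_measurable_continuous_on_indicator[OF S_borel f_cont]
        by (simp cong: measurable_cong_sets add: Q(2))
      have cm[measurable]: "apply_bcontfun (c j) \<in> borel_measurable borel" for j
        by (intro borel_measurable_continuous_onI) simp
      show "(\<lambda>w. \<psi> (T w, e w)) \<in> borel_measurable Q"
        unfolding \<psi>_def T_def by measurable
      show "AE w in Q. indicator S w *\<^sub>R f w = \<psi> (T w, e w)"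
        using QS
      proof eventually_elim
        case (elim w)
        then show ?case using S_g(4)[OF elim] by (simp add: f_eq \<psi>_def T_S dec_e)
      qed
    qed
    also have "\<dots> = (LINT t|unit_lborel. LINT s|K t. \<psi> (t, s))"
    proof (rule K_int)
      have cm[measurable]: "apply_bcontfun (c j) \<in> borel_measurable borel" for j
        by (intro borel_measurable_continuous_onI) simp
      have [measurable]: "(\<lambda>t. t) \<in> borel_measurable unit_lborel"
        by (intro borel_measurable_unit_lborel) simp
      have [measurable]: "fst \<in> borel_measurable (unit_lborel \<Otimes>\<^sub>M borel)"
        using measurable_compose[OF measurable_fst[of unit_lborel borel], of "\<lambda>t. t" borel] by simp
      show "\<psi> \<in> borel_measurable (unit_lborel \<Otimes>\<^sub>M borel)"
        unfolding \<psi>_def case_prod_beta by measurable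
      show "\<bar>\<psi> z\<bar> \<le> (\<Sum>i<length l. norm (c (l ! i)))" for z
      proof -
        obtain t s where z: "z = (t, s)" by (cases z)
        have "\<bar>(max 0 (min 1 t)) ^ i * c (l ! i) (dec s)\<bar> \<le> norm (c (l ! i))" for i
        proof -
          have "\<bar>(max 0 (min 1 t)) ^ i\<bar> \<le> 1" by (simp add: power_abs[symmetric] power_le_one)
          then have "\<bar>(max 0 (min 1 t)) ^ i\<bar> * \<bar>c (l ! i) (dec s)\<bar> \<le> 1 * norm (c (l ! i))"
            using norm_bounded[of "c (l ! i)" "dec s"] by (intro mult_mono) auto
          then show ?thesis by (simp add: abs_mult)
        qed
        then show ?thesis
          unfolding \<psi>_def z prod.case by (intro order_trans[OF sum_abs] sum_mono)
      qed
    qed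
    also have "\<dots> = (LINT t|unit_lborel. LINT x|m' t. poly_fun c l t x)"
    proof (rule Bochner_Integration.integral_cong[OF refl])
      fix t assume "t \<in> space unit_lborel"
      then have t: "t \<in> {0..1}" by simp
      have sK: "sets (K t) = sets borel" using measurable_space[OF K, of t] t by (simp add: space_prob_algebra)
      have "(LINT x|m' t. poly_fun c l t x) = (LINT s|K t. poly_fun c l t (dec s))"
        unfolding m'_def
        by (rule integral_distr) (auto cong: measurable_cong_sets simp: sK intro!: borel_measurable_continuous_onI)
      also have "\<dots> = (LINT s|K t. \<psi> (t, s))"
        using t by (simp add: poly_fun_def \<psi>_def scaleR_bcontfun.rep_eq)
      finally show "(LINT s|K t. \<psi> (t, s)) = (LINT x|m' t. poly_fun c l t x)" ..
    qed
    finally have lim: "(LINT w:S|Q. f w) = (LINT t|unit_lborel. LINT x|m' t. poly_fun c l t x)" .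
    have "(LINT w:S|\<nu> n. f w) = (LINT t|unit_lborel. LINT x|m n t. poly_fun c l t x)" for n
      unfolding nu_set_int[OF f_cont] by (simp add: f_def g)
    then show "(\<lambda>n. LINT t|unit_lborel. LINT x|m (r n) t. poly_fun c l t x)
        \<longlonglongrightarrow> (LINT t|unit_lborel. LINT x|m' t. poly_fun c l t x)"
      using Qlim[OF f_cont] by (simp add: lim)
  qed
qed

text \<open>The image lies in a metrizable product, so limits of sequences suffice, and convergence
  there is convergence of each single moment.\<close>

lemma compact_range_moments: "compact (range (moments c))"
proof (rule seq_compactI_metric)
  fix f :: "nat \<Rightarrow> nat list \<Rightarrow> real" assume f: "\<And>n. f n \<in> range (moments c)"
  then have "\<exists>\<kappa>. f n = moments c \<kappa>" for n by auto
  then obtain \<kappa> where \<kappa>: "\<And>n. f n = moments c (\<kappa> n)" by metis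
  obtain r :: "nat \<Rightarrow> nat" and m' where r: "strict_mono r" and m': "is_kernel m'"
    and lim: "\<And>l. (\<lambda>n. LINT t|unit_lborel. LINT x|rep_kernels (\<kappa> (r n)) t. poly_fun c l t x)
      \<longlonglongrightarrow> (LINT t|unit_lborel. LINT x|m' t. poly_fun c l t x)"
    by (rule kernels_sequentially_compact[of "\<lambda>n. rep_kernels (\<kappa> n)"]) (auto simp: is_kernel_rep)
  have "pairing (abs_kernels m') (poly_fun c l) = (LINT t|unit_lborel. LINT x|m' t. poly_fun c l t x)" for l
    by (intro pairing_abs_kernels[OF compact_UNIV] m' L1_cont_apply_measurable poly_fun_L1_cont)
  then have "(\<lambda>n. moments c (\<kappa> (r n)) l) \<longlonglongrightarrow> moments c (abs_kernels m') l" for l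
    using lim[of l] by (simp add: moments_def pairing_def)
  then have "(f \<circ> r) \<longlonglongrightarrow> moments c (abs_kernels m')"
    unfolding o_def \<kappa> by (rule tendsto_componentwise)
  then show "\<exists>l\<in>range (moments c). \<exists>r. strict_mono r \<and> (f \<circ> r) \<longlonglongrightarrow> l"
    using r by blast
qed

end

section \<open>Iterated integrals and their shuffle algebra\<close>

abbreviation fibre_integral :: "(real \<Rightarrow> 'b measure) \<Rightarrow> ('b::topological_space \<Rightarrow>\<^sub>C real) \<Rightarrow> real \<Rightarrow> real"
  where "fibre_integral m f t \<equiv> (LINT x|m t. apply_bcontfun f x)"

definition primitive :: "(real \<Rightarrow> real) \<Rightarrow> real \<Rightarrow> real"
  where "primitive h s = (LINT t|unit_lborel. indicator {0..s} t * h t)"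

text \<open>The head of the word belongs to the largest time.\<close>

fun iterated_integral :: "(real \<Rightarrow> 'b measure) \<Rightarrow> ('b::topological_space \<Rightarrow>\<^sub>C real) list \<Rightarrow> real \<Rightarrow> real" where
  "iterated_integral m [] s = 1"
| "iterated_integral m (f # u) s = primitive (\<lambda>t. fibre_integral m f t * iterated_integral m u t) s"

lemma indicator_unit_measurable [measurable]:
  "A \<in> sets borel \<Longrightarrow> (indicator A :: real \<Rightarrow> real) \<in> borel_measurable unit_lborel"
  by (intro borel_measurable_unit_lborel) simp

lemma unit_integrable_bounded:
  fixes h :: "real \<Rightarrow> real"
  assumes "h \<in> borel_measurable unit_lborel" "\<And>t. t \<in> {0..1} \<Longrightarrow> \<bar>h t\<bar> \<le> C"
  shows "integrable unit_lborel h"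
  by (rule unit.integrable_const_bound[where B=C]) (use assms in auto)

lemma unit_integrable_indicator:
  fixes h :: "real \<Rightarrow> real"
  assumes [measurable]: "A \<in> sets borel" "h \<in> borel_measurable unit_lborel"
    and C: "\<And>t. t \<in> {0..1} \<Longrightarrow> \<bar>h t\<bar> \<le> C"
  shows "integrable unit_lborel (\<lambda>t. indicator A t * h t)"
proof (rule unit_integrable_bounded[where C=C])
  show "\<bar>indicator A t * h t\<bar> \<le> C" if "t \<in> {0..1}" for t
    using C[OF that] abs_ge_zero[of "h t"] by (cases "t \<in> A") auto
qed measurable

lemma unit_integral_indicator_le:
  assumes "a \<in> {0..1}" "b \<in> {0..1}" "a \<le> b"
  shows "(LINT t|unit_lborel. indicator {a<..b} t :: real) = b - a"
proof -
  have "{a<..b} \<in> sets unit_lborel" using assms by (auto simp: sets_unit_lborel_iff)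
  then have "(LINT t|unit_lborel. indicator {a<..b} t :: real) = measure unit_lborel ({a<..b} \<inter> space unit_lborel)"
    by simp
  also have "{a<..b} \<inter> space unit_lborel = {a<..b}" using assms by auto
  also have "measure unit_lborel {a<..b} = measure lborel {a<..b}"
    using assms by (subst measure_restrict_space) auto
  finally show ?thesis using assms by simp
qed

lemma primitive_0: "primitive h 0 = 0"
proof -
  have "AE t in lborel. t \<noteq> (0 :: real)" by (rule AE_lborel_singleton)
  then have "AE t in unit_lborel. t \<noteq> (0 :: real)" by (subst AE_restrict_space_iff) auto
  then have "AE t in unit_lborel. indicator {0..0} t * h t = 0" by eventually_elim simp
  then show ?thesis unfolding primitive_def by (rule integral_eq_zero_AE)
qed

text \<open>Serves twice: with d = 0 it gives the Lipschitz bound of a primitive, and with d the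
  discrete value on one block it gives the local error when a sum is compared with an
  integral.\<close>

lemma primitive_increment:
  assumes h[measurable]: "h \<in> borel_measurable unit_lborel" and C: "\<And>t. t \<in> {0..1} \<Longrightarrow> \<bar>h t\<bar> \<le> C"
    and s: "a \<in> {0..1}" "b \<in> {0..1}" "a \<le> b"
    and d: "\<And>t. t \<in> {a<..b} \<Longrightarrow> \<bar>d - h t\<bar> \<le> e"
  shows "\<bar>d * (b - a) - (primitive h b - primitive h a)\<bar> \<le> e * (b - a)"
proof -
  have int: "integrable unit_lborel (\<lambda>t. indicator A t * h t)" if "A \<in> sets borel" for A
    using that h C by (rule unit_integrable_indicator)
  have intc: "integrable unit_lborel (\<lambda>t. indicator {a<..b} t * c)" for c :: real
    using unit_integrable_indicator[of "{a<..b}" "\<lambda>_. c" "\<bar>c\<bar>"] by simp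
  have intb: "integrable unit_lborel (\<lambda>t. indicator {a<..b} t * h t)" by (rule int) simp
  have ic: "(LINT t|unit_lborel. indicator {a<..b} t * c) = c * (b - a)" for c
    using unit_integral_indicator_le[OF s] by simp
  have "primitive h b - primitive h a = (LINT t|unit_lborel. indicator {0..b} t * h t - indicator {0..a} t * h t)"
    unfolding primitive_def by (simp add: int)
  also have "\<dots> = (LINT t|unit_lborel. indicator {a<..b} t * h t)"
    by (rule Bochner_Integration.integral_cong) (use s in \<open>auto simp: indicator_def\<close>)
  finally have 1: "d * (b - a) - (primitive h b - primitive h a) = (LINT t|unit_lborel. indicator {a<..b} t * d - indicator {a<..b} t * h t)"
    by (simp only: Bochner_Integration.integral_diff[OF intc intb] ic)
  have "\<bar>d * (b - a) - (primitive h b - primitive h a)\<bar> \<le> (LINT t|unit_lborel. \<bar>indicator {a<..b} t * d - indicator {a<..b} t * h t\<bar>)"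
    unfolding 1 by (rule integral_abs_bound)
  also have "\<dots> \<le> (LINT t|unit_lborel. indicator {a<..b} t * e)"
  proof (rule integral_mono)
    show "integrable unit_lborel (\<lambda>t. \<bar>indicator {a<..b} t * d - indicator {a<..b} t * h t\<bar>)"
      by (intro integrable_abs Bochner_Integration.integrable_diff int intc) simp
    show "\<bar>indicator {a<..b} t * d - indicator {a<..b} t * h t\<bar> \<le> indicator {a<..b} t * e" for t
      using d[of t] by (cases "t \<in> {a<..b}") auto
  qed (rule intc)
  finally show ?thesis unfolding ic .
qed

lemma primitive_lipschitz:
  assumes h: "h \<in> borel_measurable unit_lborel" "\<And>t. t \<in> {0..1} \<Longrightarrow> \<bar>h t\<bar> \<le> C"
    and s: "s \<in> {0..1}" "s' \<in> {0..1}"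
  shows "\<bar>primitive h s - primitive h s'\<bar> \<le> C * \<bar>s - s'\<bar>"
proof -
  have "\<bar>primitive h b - primitive h a\<bar> \<le> C * (b - a)" if "a \<in> {0..1}" "b \<in> {0..1}" "a \<le> b" for a b
    using primitive_increment[OF h that, of 0 C] h(2) that by auto
  from this[of s s'] this[of s' s] s show ?thesis by (cases "s \<le> s'") (auto simp: abs_minus_commute)
qed

lemma primitive_measurable:
  assumes "h \<in> borel_measurable unit_lborel" "\<And>t. t \<in> {0..1} \<Longrightarrow> \<bar>h t\<bar> \<le> C"
  shows "primitive h \<in> borel_measurable unit_lborel"
proof -
  have "C \<ge> 0" using assms(2)[of 0] by auto
  then have "C-lipschitz_on {0..1} (primitive h)"
    using primitive_lipschitz[OF assms] by (auto simp: lipschitz_on_def dist_real_def)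
  then have "continuous_on {0..1} (primitive h)" by (rule lipschitz_on_continuous_on)
  then have "primitive h \<in> borel_measurable (restrict_space borel {0..1})"
    by (rule borel_measurable_continuous_on_restrict)
  then show ?thesis by (simp cong: measurable_cong_sets add: sets_restrict_space)
qed

lemma primitive_bound:
  assumes h: "h \<in> borel_measurable unit_lborel" "\<And>t. t \<in> {0..1} \<Longrightarrow> \<bar>h t\<bar> \<le> C" and s: "s \<in> {0..1}"
  shows "\<bar>primitive h s\<bar> \<le> C"
proof -
  have "C \<ge> 0" using h(2)[of 0] by auto
  have "\<bar>primitive h s\<bar> \<le> C * s"
    using primitive_lipschitz[OF h s, of 0] s by (simp add: primitive_0)
  also have "\<dots> \<le> C * 1" using s \<open>C \<ge> 0\<close> by (intro mult_left_mono) auto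
  finally show ?thesis by simp
qed

text \<open>Integration by parts in integrated form: the product is an integral over the square with
  side s, which is cut along the diagonal, and each triangle is integrated with its larger variable
  outermost.\<close>

lemma primitive_mult:
  assumes h[measurable]: "h \<in> borel_measurable unit_lborel" "\<And>t. t \<in> {0..1} \<Longrightarrow> \<bar>h t\<bar> \<le> C"
    and k[measurable]: "k \<in> borel_measurable unit_lborel" "\<And>t. t \<in> {0..1} \<Longrightarrow> \<bar>k t\<bar> \<le> D"
  shows "primitive h s * primitive k s = primitive (\<lambda>t. h t * primitive k t) s + primitive (\<lambda>t. k t * primitive h t) s"
proof -
  interpret P: pair_sigma_finite unit_lborel unit_lborel ..
  interpret PP: prob_space "unit_lborel \<Otimes>\<^sub>M unit_lborel"
    by (rule prob_space_pair) (rule unit_lborel_prob_space)+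
  have [measurable]: "(\<lambda>t. t) \<in> borel_measurable unit_lborel"
    by (intro borel_measurable_unit_lborel) simp
  have [measurable]: "fst \<in> borel_measurable (unit_lborel \<Otimes>\<^sub>M unit_lborel)" "snd \<in> borel_measurable (unit_lborel \<Otimes>\<^sub>M unit_lborel)"
    using measurable_compose[OF measurable_fst[of unit_lborel unit_lborel], of "\<lambda>t. t" borel]
      measurable_compose[OF measurable_snd[of unit_lborel unit_lborel], of "\<lambda>t. t" borel] by simp_all
  have CD: "C \<ge> 0" "D \<ge> 0" using h(2)[of 0] k(2)[of 0] by auto
  have hk: "\<bar>h t * k t'\<bar> \<le> C * D" if "t \<in> {0..1}" "t' \<in> {0..1}" for t t'
    using that h(2) k(2) CD by (simp add: abs_mult mult_mono)
  \<comment> \<open>\<open>A\<close> contains the diagonal and \<open>B\<close> omits it, so the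
    triangle \<open>B\<close> produces half-open sections; they differ from those in
    \<open>primitive\<close> by a single point.\<close>
  have swap_lt: "primitive h t = (LINT t'|unit_lborel. indicator {..<t} t' * h t')" if t: "t \<in> {0..1}" for t
  proof -
    have "AE t' in lborel. t' \<noteq> t" by (rule AE_lborel_singleton)
    then have "AE t' in unit_lborel. t' \<noteq> t" by (subst AE_restrict_space_iff) auto
    then have "AE t' in unit_lborel. indicator {0..t} t' * h t' = indicator {..<t} t' * h t'"
      using AE_space by eventually_elim (auto simp: indicator_def)
    then show ?thesis unfolding primitive_def by (rule integral_cong_AE[rotated 2]) measurable
  qed
  define A where "A = (\<lambda>(t, t'). if t \<le> s \<and> t' \<le> t then h t * k t' else 0)"
  define B where "B = (\<lambda>(t, t'). if t' \<le> s \<and> t < t' then h t * k t' else 0)"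
  have A_m[measurable]: "A \<in> borel_measurable (unit_lborel \<Otimes>\<^sub>M unit_lborel)"
    and B_m[measurable]: "B \<in> borel_measurable (unit_lborel \<Otimes>\<^sub>M unit_lborel)"
    unfolding A_def B_def case_prod_beta by measurable
  have iA: "integrable (unit_lborel \<Otimes>\<^sub>M unit_lborel) A" and iB: "integrable (unit_lborel \<Otimes>\<^sub>M unit_lborel) B"
    by (rule PP.integrable_const_bound[where B="C * D"];
        use hk CD in \<open>auto simp: A_def B_def space_pair_measure\<close>)+
  have int1: "integrable unit_lborel (\<lambda>t'. indicator X t' * k t')" if "X \<in> sets borel" for X
    using that k by (rule unit_integrable_indicator)
  have int2: "integrable unit_lborel (\<lambda>t'. indicator X t' * h t')" if "X \<in> sets borel" for X
    using that h by (rule unit_integrable_indicator)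
  have sec: "integrable unit_lborel (\<lambda>t'. A (t, t'))" "integrable unit_lborel (\<lambda>t'. B (t, t'))" if "t \<in> {0..1}" for t
    by (rule unit_integrable_bounded[where C="C * D"]; use that hk CD in \<open>auto simp: A_def B_def\<close>)+
  have "primitive h s * primitive k s = (LINT t|unit_lborel. indicator {0..s} t * h t * primitive k s)"
    unfolding primitive_def[of h] by simp
  also have "\<dots> = (LINT t|unit_lborel. (LINT t'|unit_lborel. A (t, t')) + (LINT t'|unit_lborel. B (t, t')))"
  proof (rule Bochner_Integration.integral_cong[OF refl])
    fix t assume "t \<in> space unit_lborel"
    then have t: "t \<in> {0..1}" by simp
    have "indicator {0..s} t * h t * primitive k s = (LINT t'|unit_lborel. indicator {0..s} t * h t * (indicator {0..s} t' * k t'))"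
      unfolding primitive_def by simp
    also have "\<dots> = (LINT t'|unit_lborel. A (t, t') + B (t, t'))"
      by (rule Bochner_Integration.integral_cong) (use t in \<open>auto simp: A_def B_def indicator_def\<close>)
    also have "\<dots> = (LINT t'|unit_lborel. A (t, t')) + (LINT t'|unit_lborel. B (t, t'))"
      by (rule Bochner_Integration.integral_add[OF sec[OF t]])
    finally show "indicator {0..s} t * h t * primitive k s = \<dots>" .
  qed
  also have "\<dots> = (LINT t|unit_lborel. LINT t'|unit_lborel. A (t, t')) + (LINT t|unit_lborel. LINT t'|unit_lborel. B (t, t'))"
    by (rule Bochner_Integration.integral_add; rule P.integrable_fst'; fact)
  also have "(LINT t|unit_lborel. LINT t'|unit_lborel. A (t, t')) = primitive (\<lambda>t. h t * primitive k t) s"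
    unfolding primitive_def[of "\<lambda>t. h t * primitive k t"]
  proof (rule Bochner_Integration.integral_cong[OF refl])
    fix t assume "t \<in> space unit_lborel"
    then have "(LINT t'|unit_lborel. A (t, t')) = (LINT t'|unit_lborel. indicator {0..s} t * h t * (indicator {0..t} t' * k t'))"
      by (intro Bochner_Integration.integral_cong) (auto simp: A_def indicator_def)
    then show "(LINT t'|unit_lborel. A (t, t')) = indicator {0..s} t * (h t * primitive k t)"
      unfolding primitive_def by simp
  qed
  also have "(LINT t|unit_lborel. LINT t'|unit_lborel. B (t, t')) = (LINT t'|unit_lborel. LINT t|unit_lborel. B (t, t'))"
    using P.Fubini_integral[of "\<lambda>t t'. B (t, t')"] iB by (simp add: case_prod_beta')
  also have "\<dots> = primitive (\<lambda>t. k t * primitive h t) s"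
    unfolding primitive_def[of "\<lambda>t. k t * primitive h t"]
  proof (rule Bochner_Integration.integral_cong[OF refl])
    fix t' assume t': "t' \<in> space unit_lborel"
    then have "(LINT t|unit_lborel. B (t, t')) = (LINT t|unit_lborel. indicator {0..s} t' * k t' * (indicator {..<t'} t * h t))"
      by (intro Bochner_Integration.integral_cong) (auto simp: B_def indicator_def)
    then show "(LINT t|unit_lborel. B (t, t')) = indicator {0..s} t' * (k t' * primitive h t')"
      using swap_lt[of t'] t' by simp
  qed
  finally show ?thesis .
qed

section \<open>Bounds for iterated integrals and the shuffle product\<close>

definition word_norm :: "('b::topological_space \<Rightarrow>\<^sub>C real) list \<Rightarrow> real"
  where "word_norm u = prod_list (map norm u)"

lemma word_norm_nonneg: "0 \<le> word_norm u"
  by (induction u) (auto simp: word_norm_def)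

lemma fibre_integral_le:
  "is_kernel m \<Longrightarrow> t \<in> {0..1} \<Longrightarrow> \<bar>fibre_integral m f t\<bar> \<le> norm f"
  by (intro prob_integral_bcontfun_le kernel_prob)

text \<open>Both claims share one induction: measurability of a primitive comes from its Lipschitz
  continuity, which in turn needs a bound on the integrand.\<close>

lemma iterated_integral_regular:
  assumes m: "is_kernel m"
  shows "iterated_integral m u \<in> borel_measurable unit_lborel \<and>
    (\<forall>t\<in>{0..1}. \<bar>iterated_integral m u t\<bar> \<le> word_norm u)"
proof (induction u)
  case Nil
  then show ?case by (simp add: word_norm_def)
next
  case (Cons f u)
  let ?h = "\<lambda>t. fibre_integral m f t * iterated_integral m u t"
  have h: "?h \<in> borel_measurable unit_lborel"
    using Cons kernel_measurable_integral[OF m, of f] by (intro borel_measurable_times) auto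
  have b: "\<bar>?h t\<bar> \<le> norm f * word_norm u" if "t \<in> {0..1}" for t
    using Cons fibre_integral_le[OF m that] that word_norm_nonneg[of u] by (auto simp: abs_mult intro!: mult_mono)
  show ?case
    using primitive_measurable[OF h b] primitive_bound[OF h b] by (simp add: word_norm_def cong: measurable_cong)
qed

lemmas iterated_integral_measurable = iterated_integral_regular[THEN conjunct1]
  and iterated_integral_le = iterated_integral_regular[THEN conjunct2, rule_format]

lemma iterated_integrand:
  assumes m: "is_kernel m"
  shows "(\<lambda>t. fibre_integral m f t * iterated_integral m u t) \<in> borel_measurable unit_lborel"
    and "t \<in> {0..1} \<Longrightarrow> \<bar>fibre_integral m f t * iterated_integral m u t\<bar> \<le> norm f * word_norm u"
proof -
  show "(\<lambda>t. fibre_integral m f t * iterated_integral m u t) \<in> borel_measurable unit_lborel"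
    using iterated_integral_measurable[OF m] kernel_measurable_integral[OF m, of f] by (intro borel_measurable_times)
  show "\<bar>fibre_integral m f t * iterated_integral m u t\<bar> \<le> norm f * word_norm u" if "t \<in> {0..1}"
    using iterated_integral_le[OF m that] fibre_integral_le[OF m that] that word_norm_nonneg[of u]
    by (auto simp: abs_mult intro!: mult_mono)
qed

lemma primitive_cong:
  assumes "\<And>t. t \<in> {0..1} \<Longrightarrow> h t = k t"
  shows "primitive h s = primitive k s"
  unfolding primitive_def by (rule Bochner_Integration.integral_cong) (use assms in auto)

lemma primitive_sum_list:
  fixes F :: "'w \<Rightarrow> real \<Rightarrow> real"
  assumes "\<And>w. w \<in> set ws \<Longrightarrow> integrable unit_lborel (F w)"
  shows "primitive (\<lambda>t. \<Sum>w\<leftarrow>ws. F w t) s = (\<Sum>w\<leftarrow>ws. primitive (F w) s)"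
  using assms
proof (induction ws)
  case Nil
  then show ?case by (simp add: primitive_def)
next
  case (Cons w ws)
  have i: "integrable unit_lborel (\<lambda>t. indicator {0..s} t * F v t)" if "v \<in> set (w # ws)" for v
  proof (rule Bochner_Integration.integrable_bound[OF Cons.prems[OF that]])
    show "(\<lambda>t. indicator {0..s} t * F v t) \<in> borel_measurable unit_lborel"
      using borel_measurable_integrable[OF Cons.prems[OF that]] by (intro borel_measurable_times) simp_all
  qed (simp add: indicator_def)
  have "integrable unit_lborel (\<lambda>t. \<Sum>v\<leftarrow>vs. indicator {0..s} t * F v t)" if "set vs \<subseteq> set (w # ws)" for vs
    using that
  proof (induction vs)
    case (Cons v vs)
    then show ?case using i[of v] by auto
  qed simp
  from this[of ws] have "integrable unit_lborel (\<lambda>t. \<Sum>v\<leftarrow>ws. indicator {0..s} t * F v t)"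
    by auto
  then have "integrable unit_lborel (\<lambda>t. indicator {0..s} t * (\<Sum>v\<leftarrow>ws. F v t))"
    by (simp add: sum_list_const_mult)
  then show ?case
    using Cons i[of w] by (simp add: primitive_def distrib_left)
qed

text \<open>\<open>ws\<close> lists the shuffles of \<open>u\<close> and \<open>v\<close>, with multiplicity.\<close>

lemma iterated_integral_mult:
  fixes u v :: "('b::topological_space \<Rightarrow>\<^sub>C real) list"
  shows "\<exists>ws. \<forall>m s. is_kernel m \<longrightarrow> s \<in> {0..1} \<longrightarrow>
    iterated_integral m u s * iterated_integral m v s = (\<Sum>w\<leftarrow>ws. iterated_integral m w s)"
proof (induction "length u + length v" arbitrary: u v rule: less_induct)
  case less
  show ?case
  proof (cases "u = [] \<or> v = []")
    case True
    then have "\<forall>m s. is_kernel m \<longrightarrow> s \<in> {0..1} \<longrightarrow>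
        iterated_integral m u s * iterated_integral m v s = (\<Sum>w\<leftarrow>[u @ v]. iterated_integral m w s)" by auto
    then show ?thesis by blast
  next
    case False
    then obtain f u' g v' where uv: "u = f # u'" "v = g # v'" by (meson neq_Nil_conv)
    obtain ws1 where ws1: "\<And>m s. is_kernel m \<Longrightarrow> s \<in> {0..1} \<Longrightarrow>
        iterated_integral m u' s * iterated_integral m v s = (\<Sum>w\<leftarrow>ws1. iterated_integral m w s)"
      using less[of u' v] uv by auto
    obtain ws2 where ws2: "\<And>m s. is_kernel m \<Longrightarrow> s \<in> {0..1} \<Longrightarrow>
        iterated_integral m v' s * iterated_integral m u s = (\<Sum>w\<leftarrow>ws2. iterated_integral m w s)"
      using less[of v' u] uv by auto
    have "iterated_integral m u s * iterated_integral m v s =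
        (\<Sum>w\<leftarrow>map ((#) f) ws1 @ map ((#) g) ws2. iterated_integral m w s)"
      if m: "is_kernel m" and s: "s \<in> {0..1}" for m s
    proof -
      have step: "primitive (\<lambda>t. fibre_integral m f t * iterated_integral m u t * iterated_integral m v t) s =
          (\<Sum>w\<leftarrow>ws. iterated_integral m (f # w) s)"
        if "\<And>t. t \<in> {0..1} \<Longrightarrow> iterated_integral m u t * iterated_integral m v t = (\<Sum>w\<leftarrow>ws. iterated_integral m w t)"
        for f u v ws
      proof -
        have "primitive (\<lambda>t. fibre_integral m f t * iterated_integral m u t * iterated_integral m v t) s
          = primitive (\<lambda>t. \<Sum>w\<leftarrow>ws. fibre_integral m f t * iterated_integral m w t) s"
          by (rule primitive_cong) (use that in \<open>auto simp: sum_list_const_mult mult.assoc\<close>)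
        also have "\<dots> = (\<Sum>w\<leftarrow>ws. primitive (\<lambda>t. fibre_integral m f t * iterated_integral m w t) s)"
          by (rule primitive_sum_list) (rule unit_integrable_bounded[OF iterated_integrand[OF m]])
        finally show ?thesis by simp
      qed
      \<comment> \<open>The product rule separates the cases according to which of the two words
        owns the largest time; this is the recursion of the shuffle product.\<close>
      have "iterated_integral m u s * iterated_integral m v s =
          primitive (\<lambda>t. fibre_integral m f t * iterated_integral m u' t * iterated_integral m v t) s +
          primitive (\<lambda>t. fibre_integral m g t * iterated_integral m v' t * iterated_integral m u t) s"
        using primitive_mult[OF iterated_integrand[OF m, where f=f and u=u'] iterated_integrand[OF m, where f=g and u=v'], of s]
        by (simp add: uv mult.assoc)
      then show ?thesis using step[OF ws1[OF m]] step[OF ws2[OF m]] by (simp add: o_def)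
    qed
    then show ?thesis by blast
  qed
qed

section \<open>Words of ones, moments and convergence\<close>

abbreviation one_bcontfun :: "'b::topological_space \<Rightarrow>\<^sub>C real"
  where "one_bcontfun \<equiv> const_bcontfun 1"

lemma fibre_integral_one [simp]: "is_kernel m \<Longrightarrow> t \<in> {0..1} \<Longrightarrow> fibre_integral m one_bcontfun t = 1"
  by (simp add: const_bcontfun.rep_eq prob_space.prob_space[OF kernel_prob(1)])

lemma primitive_power: "s \<in> {0..1} \<Longrightarrow> primitive (\<lambda>t. t ^ k) s = s ^ Suc k / real (Suc k)"
proof -
  assume s: "s \<in> {0..1}"
  have "primitive (\<lambda>t. t ^ k) s = (LINT t|lborel. indicator {0..1} t *\<^sub>R (indicator {0..s} t * t ^ k))"
    unfolding primitive_def by (rule integral_restrict_space) simp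
  also have "\<dots> = (LINT t|lborel. t ^ k * indicator {0..s} t)"
    by (rule Bochner_Integration.integral_cong) (use s in \<open>auto simp: indicator_def\<close>)
  also have "\<dots> = s ^ Suc k / real (Suc k)"
    using s by (subst integral_power) auto
  finally show ?thesis .
qed

lemma iterated_integral_ones:
  assumes m: "is_kernel m"
  shows "s \<in> {0..1} \<Longrightarrow> iterated_integral m (replicate k one_bcontfun) s = s ^ k / fact k"
proof (induction k arbitrary: s)
  case 0
  then show ?case by simp
next
  case (Suc k)
  have "iterated_integral m (replicate (Suc k) one_bcontfun) s = primitive (\<lambda>t. t ^ k / fact k) s"
    using Suc m by (auto intro!: primitive_cong simp: prob_space.prob_space[OF kernel_prob(1)[OF m]])
  also have "\<dots> = primitive (\<lambda>t. t ^ k) s / fact k"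
    unfolding primitive_def by simp
  finally show ?case using Suc.prems by (simp add: primitive_power)
qed


lemma fibre_integral_scaleR: "(LINT x|M. apply_bcontfun (a *\<^sub>R f) x) = a * (LINT x|M. apply_bcontfun f x :: real)"
  by (simp add: scaleR_bcontfun.rep_eq)

lemma scaled_L1_cont:
  fixes f :: "'b::topological_space \<Rightarrow>\<^sub>C real"
  assumes "g \<in> borel_measurable unit_lborel" "\<And>t. t \<in> {0..1} \<Longrightarrow> \<bar>g t\<bar> \<le> C"
  shows "(\<lambda>t. g t *\<^sub>R f) \<in> L1_cont"
  using L1_contI[of "{0}" "\<lambda>_. g" C "\<lambda>_. f"] assms by simp

text \<open>Only weak convergence of the fibres is given, so the two factors of the integrand cannot
  both be sent to the limit weakly. By induction the inner integral converges pointwise with a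
  uniform bound; it may be replaced by its limit at vanishing cost, and what remains is a pairing
  with a fixed test function.\<close>

lemma iterated_integral_tendsto:
  fixes \<kappa> :: "'b::topological_space kernels"
  assumes lim: "\<And>F. F \<in> L1_cont \<Longrightarrow> (\<lambda>n. pairing (\<kappa>s n) F) \<longlonglongrightarrow> pairing \<kappa> F"
  shows "s \<in> {0..1} \<Longrightarrow> (\<lambda>n. iterated_integral (rep_kernels (\<kappa>s n)) w s) \<longlonglongrightarrow> iterated_integral (rep_kernels \<kappa>) w s"
proof (induction w arbitrary: s)
  case Nil
  then show ?case by simp
next
  case (Cons f u)
  let ?I = "iterated_integral (rep_kernels \<kappa>)" and ?In = "\<lambda>n. iterated_integral (rep_kernels (\<kappa>s n))"
  let ?G = "\<lambda>n. fibre_integral (rep_kernels (\<kappa>s n)) f"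
  note k = is_kernel_rep[of \<kappa>] and kn = is_kernel_rep[of "\<kappa>s n" for n]
  note [measurable] = iterated_integral_measurable[OF k] iterated_integral_measurable[OF kn]
    kernel_measurable_integral[OF kn]
  \<comment> \<open>The fixed test function contains the inner integral of the limit kernel, not
    that of the n-th one.\<close>
  define F where "F t = (indicator {0..s} t * ?I u t) *\<^sub>R f" for t
  have F: "F \<in> L1_cont"
    unfolding F_def
  proof (rule scaled_L1_cont[where C="word_norm u"])
    show "\<bar>indicator {0..s} t * ?I u t\<bar> \<le> word_norm u" if "t \<in> {0..1}" for t
      using iterated_integral_le[OF k that, of u] word_norm_nonneg[of u] by (simp add: indicator_def)
  qed measurable
  have F_pair: "pairing \<kappa>' F = primitive (\<lambda>t. fibre_integral (rep_kernels \<kappa>') f t * ?I u t) s" for \<kappa>'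
    unfolding pairing_def primitive_def F_def fibre_integral_scaleR by (simp add: ac_simps)
  have bd: "\<bar>norm f * \<bar>?In n u t - ?I u t\<bar>\<bar> \<le> norm f * (2 * word_norm u)" if "t \<in> {0..1}" for n t
  proof -
    have "\<bar>?In n u t - ?I u t\<bar> \<le> \<bar>?In n u t\<bar> + \<bar>?I u t\<bar>" by (rule abs_triangle_ineq4)
    also have "\<dots> \<le> word_norm u + word_norm u"
      by (rule add_mono[OF iterated_integral_le[OF kn that] iterated_integral_le[OF k that]])
    finally have "\<bar>?In n u t - ?I u t\<bar> \<le> 2 * word_norm u" by simp
    from mult_left_mono[OF this norm_ge_zero, of f] show ?thesis by (simp only: abs_mult abs_norm_cancel abs_idempotent)
  qed
  \<comment> \<open>The difference involves only the change of the inner integral, because the outer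
    fibre is that of the n-th kernel in both terms.\<close>
  have diff: "\<bar>?In n (f # u) s - pairing (\<kappa>s n) F\<bar> \<le> (LINT t|unit_lborel. norm f * \<bar>?In n u t - ?I u t\<bar>)" for n
  proof -
    have b: "\<bar>?G n t * ?I u t\<bar> \<le> norm f * word_norm u" if "t \<in> {0..1}" for t
      using iterated_integral_le[OF k that, of u] fibre_integral_le[OF kn that, of n f] that word_norm_nonneg[of u]
      by (auto simp: abs_mult intro!: mult_mono)
    have i1: "integrable unit_lborel (\<lambda>t. indicator {0..s} t * (?G n t * ?In n u t))"
      by (rule unit_integrable_indicator[OF _ iterated_integrand[OF kn]]) simp
    have i2: "integrable unit_lborel (\<lambda>t. indicator {0..s} t * (?G n t * ?I u t))"
      by (rule unit_integrable_indicator[OF _ _ b]) simp_all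
    have eq: "?In n (f # u) s - pairing (\<kappa>s n) F = (LINT t|unit_lborel. indicator {0..s} t * (?G n t * ?In n u t)
        - indicator {0..s} t * (?G n t * ?I u t))"
      unfolding F_pair by (simp add: primitive_def i1 i2)
    have "\<bar>?In n (f # u) s - pairing (\<kappa>s n) F\<bar> \<le> (LINT t|unit_lborel. \<bar>indicator {0..s} t * (?G n t * ?In n u t)
        - indicator {0..s} t * (?G n t * ?I u t)\<bar>)" unfolding eq by (rule integral_abs_bound)
    also have "\<dots> \<le> (LINT t|unit_lborel. norm f * \<bar>?In n u t - ?I u t\<bar>)"
    proof (rule integral_mono)
      show "integrable unit_lborel (\<lambda>t. norm f * \<bar>?In n u t - ?I u t\<bar>)"
      proof (rule unit_integrable_bounded[where C="norm f * (2 * word_norm u)"])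
        show "\<bar>norm f * \<bar>?In n u t - ?I u t\<bar>\<bar> \<le> norm f * (2 * word_norm u)" if "t \<in> {0..1}" for t
          by (rule bd[OF that])
      qed (intro borel_measurable_times borel_measurable_abs borel_measurable_diff iterated_integral_measurable k kn borel_measurable_const)
      fix t assume "t \<in> space unit_lborel"
      then have t: "t \<in> {0..1}" by simp
      have "\<bar>indicator {0..s} t * (?G n t * ?In n u t) - indicator {0..s} t * (?G n t * ?I u t)\<bar>
          = indicator {0..s} t * \<bar>?G n t\<bar> * \<bar>?In n u t - ?I u t\<bar>"
        by (simp add: indicator_def abs_mult flip: right_diff_distrib)
      also have "\<dots> \<le> norm f * \<bar>?In n u t - ?I u t\<bar>"
        using fibre_integral_le[OF kn t, of n f] by (intro mult_right_mono) (auto simp: indicator_def)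
      finally show "\<bar>indicator {0..s} t * (?G n t * ?In n u t) - indicator {0..s} t * (?G n t * ?I u t)\<bar>
          \<le> norm f * \<bar>?In n u t - ?I u t\<bar>" .
    qed (intro integrable_abs Bochner_Integration.integrable_diff i1 i2)
    finally show ?thesis .
  qed
  have "(\<lambda>n. LINT t|unit_lborel. norm f * \<bar>?In n u t - ?I u t\<bar>) \<longlonglongrightarrow> (LINT t|unit_lborel. 0 :: real)"
  proof (rule integral_dominated_convergence[where w="\<lambda>_. norm f * (2 * word_norm u)"])
    show "AE t in unit_lborel. (\<lambda>n. norm f * \<bar>?In n u t - ?I u t\<bar>) \<longlonglongrightarrow> 0"
    proof (rule AE_I2)
      fix t assume "t \<in> space unit_lborel"
      then have "(\<lambda>n. ?In n u t - ?I u t) \<longlonglongrightarrow> ?I u t - ?I u t"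
        by (intro tendsto_diff tendsto_const Cons.IH) simp
      then show "(\<lambda>n. norm f * \<bar>?In n u t - ?I u t\<bar>) \<longlonglongrightarrow> 0"
        by (intro tendsto_mult_right_zero tendsto_rabs_zero) simp
    qed
    show "AE t in unit_lborel. norm (norm f * \<bar>?In n u t - ?I u t\<bar>) \<le> norm f * (2 * word_norm u)" for n
    proof (rule AE_I2)
      fix t assume "t \<in> space unit_lborel"
      then have t: "t \<in> {0..1}" by simp
      show "norm (norm f * \<bar>?In n u t - ?I u t\<bar>) \<le> norm f * (2 * word_norm u)"
        using bd[OF t] by (simp only: real_norm_def)
    qed
  qed simp_all
  then have "(\<lambda>n. LINT t|unit_lborel. norm f * \<bar>?In n u t - ?I u t\<bar>) \<longlonglongrightarrow> 0" by simp
  then have "(\<lambda>n. ?In n (f # u) s - pairing (\<kappa>s n) F) \<longlonglongrightarrow> 0"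
    by (rule Lim_null_comparison[rotated]) (use diff in auto)
  from tendsto_add[OF this lim[OF F]] show ?case
    by (simp add: F_pair)
qed

text \<open>A word of i ones equals t^i / i!, so putting a letter in front of it integrates that
  letter against the weight t^i.\<close>

lemma moments_eq_iterated_integrals:
  "moments c \<kappa> l = (\<Sum>i<length l. fact i * iterated_integral (rep_kernels \<kappa>) (c (l ! i) # replicate i one_bcontfun) 1)"
proof -
  let ?m = "rep_kernels \<kappa>"
  note m = is_kernel_rep[of \<kappa>]
  have b: "\<bar>t ^ i * fibre_integral ?m f t\<bar> \<le> norm f" if "t \<in> {0..1}" for i t f
  proof -
    have "\<bar>t ^ i\<bar> * \<bar>fibre_integral ?m f t\<bar> \<le> 1 * norm f"
      using that fibre_integral_le[OF m that, of f] by (intro mult_mono) (auto simp: power_le_one)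
    then show ?thesis by (simp add: abs_mult)
  qed
  have [measurable]: "(\<lambda>t. t ^ i) \<in> borel_measurable unit_lborel" for i
    by (intro borel_measurable_unit_lborel) simp
  note [measurable] = kernel_measurable_integral[OF m]
  have int: "integrable unit_lborel (\<lambda>t. t ^ i * fibre_integral ?m f t)" for i f
    by (rule unit_integrable_bounded[OF _ b]) simp
  have "moments c \<kappa> l = (LINT t|unit_lborel. (\<Sum>i<length l. t ^ i * fibre_integral ?m (c (l ! i)) t))"
    unfolding moments_def pairing_def
  proof (rule Bochner_Integration.integral_cong[OF refl])
    fix t assume "t \<in> space unit_lborel"
    then have t: "t \<in> {0..1}" by simp
    show "(LINT x|?m t. poly_fun c l t x) = (\<Sum>i<length l. t ^ i * fibre_integral ?m (c (l ! i)) t)"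
      unfolding poly_fun_def sum_apply_bcontfun
      by (subst Bochner_Integration.integral_sum) (auto simp: scaleR_bcontfun.rep_eq intro!: integrable_bcontfun kernel_prob[OF m t])
  qed
  also have "\<dots> = (\<Sum>i<length l. (LINT t|unit_lborel. t ^ i * fibre_integral ?m (c (l ! i)) t))"
    by (rule Bochner_Integration.integral_sum) (rule int)
  also have "\<dots> = (\<Sum>i<length l. fact i * iterated_integral ?m (c (l ! i) # replicate i one_bcontfun) 1)"
  proof (rule sum.cong[OF refl])
    fix i
    have "iterated_integral ?m (c (l ! i) # replicate i one_bcontfun) 1
      = (LINT t|unit_lborel. t ^ i * fibre_integral ?m (c (l ! i)) t / fact i)"
      unfolding iterated_integral.simps primitive_def
      by (rule Bochner_Integration.integral_cong) (auto simp: iterated_integral_ones[OF m])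
    then show "(LINT t|unit_lborel. t ^ i * fibre_integral ?m (c (l ! i)) t)
      = fact i * iterated_integral ?m (c (l ! i) # replicate i one_bcontfun) 1"
      by simp
  qed
  finally show ?thesis .
qed

section \<open>Continuity of iterated integrals on the space of kernels\<close>

context
  assumes compact_UNIV: "compact (UNIV :: 'a::metric_space set)"
begin

lemma continuous_on_inv_moments:
  fixes c :: "nat \<Rightarrow> ('a \<Rightarrow>\<^sub>C real)"
  assumes c: "\<And>f e. e > 0 \<Longrightarrow> \<exists>j. norm (f - c j) < e"
  shows "continuous_on (range (moments c)) (inv (moments c))"
  unfolding continuous_on_open_invariant
proof (intro allI impI)
  fix B :: "'a kernels set" assume "open B"
  then obtain V where V: "open V" "B = moments c -` V"
    using open_moments_vimage[OF compact_UNIV c] by blast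
  have "inj (moments c)" using moments_inject[OF compact_UNIV c] by (auto simp: inj_on_def)
  then have "V \<inter> range (moments c) = inv (moments c) -` B \<inter> range (moments c)"
    unfolding V(2) by auto
  then show "\<exists>A. open A \<and> A \<inter> range (moments c) = inv (moments c) -` B \<inter> range (moments c)"
    using V(1) by blast
qed

text \<open>Convergence along sequences proves continuity in a metrizable space. The function is
  therefore transported to the image of the moments, shown continuous there, and pulled
  back.\<close>

lemma continuous_iterated_integral:
  "continuous_on UNIV (\<lambda>\<kappa> :: 'a kernels. iterated_integral (rep_kernels \<kappa>) w 1)"
proof -
  obtain c :: "nat \<Rightarrow> ('a \<Rightarrow>\<^sub>C real)" where c: "\<And>f e. e > 0 \<Longrightarrow> \<exists>j. norm (f - c j) < e"
    using dense_continuous_functions[OF compact_UNIV] by metis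
  have inj: "inj (moments c)" using moments_inject[OF compact_UNIV c] by (auto simp: inj_on_def)
  let ?J = "\<lambda>v. iterated_integral (rep_kernels (inv (moments c) v)) w 1"
  have J: "continuous_on (range (moments c)) ?J"
    unfolding continuous_on_sequentially
  proof (intro allI ballI impI)
    fix x :: "nat \<Rightarrow> nat list \<Rightarrow> real" and v
    assume v: "v \<in> range (moments c)" and x: "(\<forall>n. x n \<in> range (moments c)) \<and> x \<longlonglongrightarrow> v"
    have "(\<lambda>n. pairing (inv (moments c) (x n)) F) \<longlonglongrightarrow> pairing (inv (moments c) v) F"
      if F: "F \<in> L1_cont" for F :: "real \<Rightarrow> ('a \<Rightarrow>\<^sub>C real)"
    proof -
      have "continuous_on (range (moments c)) (\<lambda>v. pairing (inv (moments c) v) F)"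
        by (rule continuous_on_compose2[OF continuous_pairing[OF F] continuous_on_inv_moments[OF c]]) auto
      then show ?thesis using v x unfolding continuous_on_sequentially by (auto simp: o_def)
    qed
    from iterated_integral_tendsto[OF this, of 1 w] show "(?J \<circ> x) \<longlonglongrightarrow> ?J v"
      by (simp add: o_def)
  qed
  have "continuous_on UNIV (\<lambda>\<kappa>. ?J (moments c \<kappa>))"
    by (rule continuous_on_compose2[OF J continuous_moments]) auto
  then show ?thesis using inj by simp
qed

end

section \<open>Mixtures over the ordered simplex\<close>

lemma space_PiM_lborel: "space (PiM I (\<lambda>_. lborel :: real measure)) = extensional I"
  by (simp add: space_PiM PiE_UNIV_domain PiE_def)

lemma ordered_simplex_eq:
  "ordered_simplex n = {t \<in> space (PiM {1..n} (\<lambda>_. lborel)). (\<forall>i\<in>{1..n}. t i \<in> {0<..<1}) \<and>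
    (\<forall>i\<in>{1..n}. \<forall>j\<in>{1..n}. i < j \<longrightarrow> t i < t j)}"
  by (auto simp: ordered_simplex_def space_PiM_lborel PiE_def strict_mono_on_def)

lemma ordered_simplex_sets [measurable]: "ordered_simplex n \<in> sets (PiM {1..n} (\<lambda>_. lborel))"
  unfolding ordered_simplex_eq by measurable

text \<open>Adding the largest time: by monotonicity only the comparison with its predecessor
  matters, and for n = 0 there is no predecessor.\<close>

lemma ordered_simplex_Suc:
  assumes y: "y \<in> extensional {1..n}"
  shows "y(Suc n := z) \<in> ordered_simplex (Suc n) \<longleftrightarrow>
    z \<in> {0<..<1} \<and> y \<in> ordered_simplex n \<and> (n = 0 \<or> y n < z)"
proof -
  have ext: "y(Suc n := z) \<in> extensional {1..Suc n}" using y by (auto simp: extensional_def)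
  have eq: "{1..Suc n} = insert (Suc n) {1..n}" by auto
  show ?thesis
  proof
    assume a: "y(Suc n := z) \<in> ordered_simplex (Suc n)"
    then have 1: "\<And>i. i \<in> {1..Suc n} \<Longrightarrow> (y(Suc n := z)) i \<in> {0<..<1}"
      and 2: "\<And>i j. i \<in> {1..Suc n} \<Longrightarrow> j \<in> {1..Suc n} \<Longrightarrow> i < j \<Longrightarrow> (y(Suc n := z)) i < (y(Suc n := z)) j"
      by (auto simp: ordered_simplex_eq)
    have "y i \<in> {0<..<1}" if "i \<in> {1..n}" for i using 1[of i] that by auto
    moreover have "y i < y j" if "i \<in> {1..n}" "j \<in> {1..n}" "i < j" for i j using 2[of i j] that by auto
    ultimately have "y \<in> ordered_simplex n" using y by (auto simp: ordered_simplex_eq space_PiM_lborel)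
    moreover have "n = 0 \<or> y n < z" using 2[of n "Suc n"] by (cases "n = 0") auto
    ultimately show "z \<in> {0<..<1} \<and> y \<in> ordered_simplex n \<and> (n = 0 \<or> y n < z)" using 1[of "Suc n"] by simp
  next
    assume a: "z \<in> {0<..<1} \<and> y \<in> ordered_simplex n \<and> (n = 0 \<or> y n < z)"
    have lt: "y i < z" if i: "i \<in> {1..n}" for i
    proof (cases "i = n")
      case False
      then have "y i < y n" using a i by (auto simp: ordered_simplex_eq)
      then show ?thesis using a i by auto
    qed (use a i in auto)
    show "y(Suc n := z) \<in> ordered_simplex (Suc n)"
      using a ext lt by (auto simp: ordered_simplex_eq space_PiM_lborel eq)
  qed
qed

lemma ordered_simplex_0: "ordered_simplex 0 = {\<lambda>_. undefined}"
  by (auto simp: ordered_simplex_def strict_mono_on_def)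

text \<open>The order is reversed so that the head carries the largest index, in agreement with the
  convention of \<open>iterated_integral\<close>.\<close>

definition word :: "(nat \<Rightarrow> 'c) \<Rightarrow> nat \<Rightarrow> 'c list"
  where "word \<phi> n = map \<phi> (rev [1..<Suc n])"

lemma word_simps [simp]: "word \<phi> 0 = []" "word \<phi> (Suc n) = \<phi> (Suc n) # word \<phi> n" "length (word \<phi> n) = n"
  by (simp_all add: word_def)

lemma lborel_measurable_unit:
  fixes h :: "real \<Rightarrow> real"
  assumes "h \<in> borel_measurable unit_lborel"
  shows "(\<lambda>t. indicator {0<..<1} t * h t) \<in> borel_measurable lborel"
proof -
  have "(\<lambda>t. indicator {0..1} t *\<^sub>R h t) \<in> borel_measurable lborel"
    using assms by (subst (asm) borel_measurable_restrict_space_iff) auto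
  then have "(\<lambda>t. indicator {0<..<1} t * (indicator {0..1} t *\<^sub>R h t)) \<in> borel_measurable lborel"
    by (intro borel_measurable_times) auto
  then show ?thesis
    by (rule measurable_cong[THEN iffD1, rotated]) (auto simp: indicator_def)
qed

lemma integrable_unit_fibre_integral:
  assumes m: "is_kernel m"
  shows "integrable lborel (\<lambda>t. indicator {0<..<1} t * fibre_integral m f t)"
proof (rule Bochner_Integration.integrable_bound)
  show "integrable lborel (\<lambda>t :: real. norm f * indicator {0..1} t :: real)"
    by (intro integrable_mult_right integrable_real_indicator) auto
  show "(\<lambda>t. indicator {0<..<1} t * fibre_integral m f t) \<in> borel_measurable lborel"
    by (rule lborel_measurable_unit[OF kernel_measurable_integral[OF m]])
  have "\<bar>indicator {0<..<1} t * fibre_integral m f t\<bar> \<le> norm f * indicator {0..1} t" for t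
    using fibre_integral_le[OF m, of t f] by (auto simp: indicator_def)
  then show "AE t in lborel. norm (indicator {0<..<1} t * fibre_integral m f t) \<le> norm (norm f * indicator {0..1} t :: real)"
    by simp
qed

text \<open>Induction on n for all s at once: the largest time is integrated last, and for fixed z
  it becomes the upper limit s of the remaining integral. The factor with \<open>t n\<close>
  expresses this limit. The functions \<open>g\<close> vanish off (0,1) because the times range over
  the whole real line.\<close>

lemma iterated_integral_simplex:
  fixes \<phi> :: "nat \<Rightarrow> ('b::topological_space \<Rightarrow>\<^sub>C real)"
  assumes m: "is_kernel m"
  defines "g \<equiv> \<lambda>i t. indicator {0<..<1} t * fibre_integral m (\<phi> i) t"
  shows "s \<in> {0..1} \<Longrightarrow> (LINT t|PiM {1..n} (\<lambda>_. lborel). indicator (ordered_simplex n) t *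
      (if n = 0 then 1 else indicator {..<s} (t n)) * (\<Prod>i\<in>{1..n}. g i (t i))) = iterated_integral m (word \<phi> n) s"
proof (induction n arbitrary: s)
  case 0
  interpret product_sigma_finite "\<lambda>_ :: nat. lborel :: real measure" ..
  interpret finite_measure "Pi\<^sub>M {} (\<lambda>_ :: nat. lborel :: real measure)"
    by rule (simp add: space_PiM)
  have "measure (Pi\<^sub>M {} (\<lambda>_ :: nat. lborel :: real measure)) {\<lambda>_. undefined} = 1"
    by (simp add: measure_def)
  then show ?case by (simp add: ordered_simplex_0 space_PiM)
next
  case (Suc n)
  interpret L: product_sigma_finite "\<lambda>_ :: nat. lborel :: real measure" ..
  let ?P = "\<lambda>I. PiM I (\<lambda>_ :: nat. lborel :: real measure)"
  have g_int: "integrable lborel (g i)" for i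
    unfolding g_def by (rule integrable_unit_fibre_integral[OF m])
  define F where "F n s t = indicator (ordered_simplex n) t *
      (if n = 0 then 1 else indicator {..<s} (t n)) * (\<Prod>i\<in>{1..n}. g i (t i))" for n and s :: real and t
  have prod_m: "(\<lambda>t. \<Prod>i\<in>{1..n}. g i (t i)) \<in> borel_measurable (?P {1..n})" for n
    by (intro borel_measurable_prod
        measurable_compose[OF measurable_component_singleton[of _ _ "\<lambda>_. lborel"] borel_measurable_integrable[OF g_int]])
  have F_m: "F n s \<in> borel_measurable (?P {1..n})" for n s
  proof -
    have "(\<lambda>t. (if n = 0 then 1 else indicator {..<s} (t n)) :: real) \<in> borel_measurable (?P {1..n})"
      by (cases n) (auto intro!: measurable_compose[OF measurable_component_singleton[of _ _ "\<lambda>_. lborel"]])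
    from borel_measurable_times[OF borel_measurable_times[OF borel_measurable_indicator[OF ordered_simplex_sets] this] prod_m]
    show ?thesis unfolding F_def .
  qed
  have F_int: "integrable (?P {1..n}) (F n s)" for n s
  proof (rule Bochner_Integration.integrable_bound)
    show "integrable (?P {1..n}) (\<lambda>t. \<Prod>i\<in>{1..n}. g i (t i))"
      by (rule L.product_integrable_prod) (auto intro: g_int)
    show "AE t in ?P {1..n}. norm (F n s t) \<le> norm (\<Prod>i\<in>{1..n}. g i (t i))"
      by (rule AE_I2) (auto simp: F_def abs_mult indicator_def)
  qed (rule F_m)
  \<comment> \<open>Listing the last coordinate first makes Fubini integrate over it
    outermost.\<close>
  have eq: "{1..Suc n} = {Suc n} \<union> {1..n}" by auto
  have F_Suc: "F (Suc n) s (y(Suc n := z)) = indicator {..<s} z * g (Suc n) z * F n z y" if "y \<in> extensional {1..n}" for y z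
  proof -
    have "(\<Prod>i\<in>{1..Suc n}. g i ((y(Suc n := z)) i)) = (\<Prod>i\<in>{1..n}. g i (y i)) * g (Suc n) z"
      by (simp add: atLeastAtMostSuc_conv cong: prod.cong_simp)
    then show ?thesis
      unfolding F_def by (auto simp: ordered_simplex_Suc[OF that] indicator_def g_def)
  qed
  have "(LINT t|?P {1..Suc n}. F (Suc n) s t) =
      (LINT x|?P {Suc n}. LINT y|?P {1..n}. F (Suc n) s (merge {Suc n} {1..n} (x, y)))"
    unfolding eq
  proof (rule L.product_integral_fold)
    show "integrable (?P ({Suc n} \<union> {1..n})) (F (Suc n) s)"
      using F_int[of "Suc n" s] unfolding eq .
  qed auto
  also have "\<dots> = (LINT x|?P {Suc n}. indicator {..<s} (x (Suc n)) * g (Suc n) (x (Suc n)) * iterated_integral m (word \<phi> n) (x (Suc n)))"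
  proof (rule Bochner_Integration.integral_cong[OF refl])
    fix x assume x: "x \<in> space (?P {Suc n})"
    define z where "z = x (Suc n)"
    have "(LINT y|?P {1..n}. F (Suc n) s (merge {Suc n} {1..n} (x, y)))
        = (LINT y|?P {1..n}. indicator {..<s} z * g (Suc n) z * F n z y)"
    proof (rule Bochner_Integration.integral_cong[OF refl])
      fix y assume "y \<in> space (?P {1..n})"
      then have y: "y \<in> extensional {1..n}" by (simp add: space_PiM_lborel)
      have "merge {Suc n} {1..n} (x, y) = y(Suc n := z)"
        using y by (auto simp: merge_def z_def extensional_def fun_eq_iff)
      then show "F (Suc n) s (merge {Suc n} {1..n} (x, y)) = indicator {..<s} z * g (Suc n) z * F n z y"
        using F_Suc[OF y] by simp
    qed
    also have "\<dots> = indicator {..<s} z * g (Suc n) z * (LINT y|?P {1..n}. F n z y)" by simp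
    also have "\<dots> = indicator {..<s} z * g (Suc n) z * iterated_integral m (word \<phi> n) z"
    \<comment> \<open>The induction hypothesis covers only upper limits in [0,1]; for z outside
      (0,1) the factor \<open>g (Suc n) z\<close> is 0.\<close>
    proof (cases "z \<in> {0<..<1}")
      case True
      then have "z \<in> {0..1}" by simp
      from Suc.IH[OF this] show ?thesis by (simp add: F_def)
    qed (simp add: g_def)
    finally show "(LINT y|?P {1..n}. F (Suc n) s (merge {Suc n} {1..n} (x, y))) =
        indicator {..<s} (x (Suc n)) * g (Suc n) (x (Suc n)) * iterated_integral m (word \<phi> n) (x (Suc n))"
      by (simp add: z_def)
  qed
  also have "\<dots> = (LINT z|lborel. indicator {..<s} z * g (Suc n) z * iterated_integral m (word \<phi> n) z)"
  proof (rule L.product_integral_singleton)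
    have "(\<lambda>z. indicator {0<..<1} z * (fibre_integral m (\<phi> (Suc n)) z * iterated_integral m (word \<phi> n) z)) \<in> borel_measurable lborel"
      by (rule lborel_measurable_unit[OF iterated_integrand(1)[OF m]])
    then have "(\<lambda>z. indicator {..<s} z * (indicator {0<..<1} z * (fibre_integral m (\<phi> (Suc n)) z * iterated_integral m (word \<phi> n) z))) \<in> borel_measurable lborel"
      by (rule borel_measurable_times[rotated]) simp
    then show "(\<lambda>z. indicator {..<s} z * g (Suc n) z * iterated_integral m (word \<phi> n) z) \<in> borel_measurable lborel"
      by (simp add: g_def mult.assoc)
  qed
  also have "\<dots> = (LINT z|lborel. indicator {0..1} z *\<^sub>R (indicator {0..s} z * (fibre_integral m (\<phi> (Suc n)) z * iterated_integral m (word \<phi> n) z)))"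
  proof (rule integral_cong_AE)
    have h: "(\<lambda>z. fibre_integral m (\<phi> (Suc n)) z * iterated_integral m (word \<phi> n) z) \<in> borel_measurable unit_lborel"
      by (rule iterated_integrand(1)[OF m])
    have "(\<lambda>z. indicator {..<s} z * (indicator {0<..<1} z * (fibre_integral m (\<phi> (Suc n)) z * iterated_integral m (word \<phi> n) z))) \<in> borel_measurable lborel"
      by (rule borel_measurable_times[OF _ lborel_measurable_unit[OF h]]) simp
    then show "(\<lambda>z. indicator {..<s} z * g (Suc n) z * iterated_integral m (word \<phi> n) z) \<in> borel_measurable lborel"
      by (simp add: g_def mult.assoc)
    have "(\<lambda>z. indicator {0..s} z * (fibre_integral m (\<phi> (Suc n)) z * iterated_integral m (word \<phi> n) z)) \<in> borel_measurable unit_lborel"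
      by (rule borel_measurable_times[OF _ h]) simp
    then show "(\<lambda>z. indicator {0..1} z *\<^sub>R (indicator {0..s} z * (fibre_integral m (\<phi> (Suc n)) z * iterated_integral m (word \<phi> n) z))) \<in> borel_measurable lborel"
      by (subst (asm) borel_measurable_restrict_space_iff) auto
    \<comment> \<open>The simplex is open and the primitive uses closed intervals; the two
      integrands differ at most at these three points.\<close>
    have "AE z in lborel. z \<noteq> (0::real)" "AE z in lborel. z \<noteq> (1::real)" "AE z in lborel. z \<noteq> s"
      by (rule AE_lborel_singleton)+
    then show "AE z in lborel. indicator {..<s} z * g (Suc n) z * iterated_integral m (word \<phi> n) z =
        indicator {0..1} z *\<^sub>R (indicator {0..s} z * (fibre_integral m (\<phi> (Suc n)) z * iterated_integral m (word \<phi> n) z))"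
      by eventually_elim (auto simp: g_def indicator_def)
  qed
  also have "\<dots> = (LINT z|unit_lborel. indicator {0..s} z * (fibre_integral m (\<phi> (Suc n)) z * iterated_integral m (word \<phi> n) z))"
    by (rule integral_restrict_space[symmetric]) simp
  also have "\<dots> = iterated_integral m (word \<phi> (Suc n)) s"
    by (simp add: primitive_def)
  finally show ?case unfolding F_def .
qed

lemma fibre_product_integral:
  fixes m :: "real \<Rightarrow> 'b::topological_space measure" and n :: nat
  assumes m: "is_kernel m" and t: "\<And>i. i \<in> {1..n} \<Longrightarrow> t i \<in> {0..1}"
  shows "(LINT x|PiM {1..n} (\<lambda>i. m (t i)). (\<Prod>i\<in>{1..n}. apply_bcontfun (\<phi> i) (x i))) = (\<Prod>i\<in>{1..n}. fibre_integral m (\<phi> i) (t i))"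
    and "integrable (PiM {1..n} (\<lambda>i. m (t i))) (\<lambda>x. \<Prod>i\<in>{1..n}. apply_bcontfun (\<phi> i) (x i))"
    and "prob_space (PiM {1..n} (\<lambda>i. m (t i)))"
proof -
  \<comment> \<open>The product construction expects a probability measure at every index;
    \<open>m 0\<close> fills the indices outside {1..n}.\<close>
  define M where "M i = (if i \<in> {1..n} then m (t i) else m 0)" for i
  have eq: "PiM {1..n} (\<lambda>i. m (t i)) = PiM {1..n} M" by (rule PiM_cong) (auto simp: M_def)
  have Mp: "prob_space (M i)" and Ms: "sets (M i) = sets borel" for i
    using kernel_prob[OF m] t by (auto simp: M_def)
  interpret product_prob_space M UNIV
    by (intro product_prob_spaceI Mp)
  show "(LINT x|PiM {1..n} (\<lambda>i. m (t i)). (\<Prod>i\<in>{1..n}. apply_bcontfun (\<phi> i) (x i))) = (\<Prod>i\<in>{1..n}. fibre_integral m (\<phi> i) (t i))"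
    unfolding eq product_integral_prod[OF finite_atLeastAtMost integrable_bcontfun[OF Mp Ms]]
    by (rule prod.cong) (auto simp: M_def)
  show "integrable (PiM {1..n} (\<lambda>i. m (t i))) (\<lambda>x. \<Prod>i\<in>{1..n}. apply_bcontfun (\<phi> i) (x i))"
    unfolding eq by (rule product_integrable_prod) (auto intro!: integrable_bcontfun Mp Ms)
  show "prob_space (PiM {1..n} (\<lambda>i. m (t i)))"
    unfolding eq by (rule prob_space_PiM) (rule Mp)
qed

lemma simplex_mixture_prod:
  fixes \<kappa> :: "'b::topological_space kernels" and \<phi> :: "nat \<Rightarrow> ('b \<Rightarrow>\<^sub>C real)"
  shows "simplex_mixture n (\<lambda>x. \<Prod>i\<in>{1..n}. apply_bcontfun (\<phi> i) (x i)) \<kappa> = fact n * iterated_integral (rep_kernels \<kappa>) (word \<phi> n) 1"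
proof -
  let ?m = "rep_kernels \<kappa>"
  note m = is_kernel_rep[of \<kappa>]
  have "simplex_mixture n (\<lambda>x. \<Prod>i\<in>{1..n}. apply_bcontfun (\<phi> i) (x i)) \<kappa> =
    (LINT t|PiM {1..n} (\<lambda>_. lborel). fact n * (indicator (ordered_simplex n) t *
      (if n = 0 then 1 else indicator {..<1} (t n)) * (\<Prod>i\<in>{1..n}. indicator {0<..<1} (t i) * fibre_integral ?m (\<phi> i) (t i))))"
    unfolding simplex_mixture_def set_lebesgue_integral_def
  proof (rule Bochner_Integration.integral_cong[OF refl])
    fix t :: "nat \<Rightarrow> real"
    show "indicator (ordered_simplex n) t *\<^sub>R ((LINT x|PiM {1..n} (\<lambda>i. ?m (t i)). (\<Prod>i\<in>{1..n}. apply_bcontfun (\<phi> i) (x i))) * fact n)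
      = fact n * (indicator (ordered_simplex n) t *
      (if n = 0 then 1 else indicator {..<1} (t n)) * (\<Prod>i\<in>{1..n}. indicator {0<..<1} (t i) * fibre_integral ?m (\<phi> i) (t i)))"
    proof (cases "t \<in> ordered_simplex n")
      case True
      then have t: "\<And>i. i \<in> {1..n} \<Longrightarrow> t i \<in> {0<..<1}" by (auto simp: ordered_simplex_eq)
      have t1: "t i < 1" "0 < t i" "t i \<in> {0..1}" if "i \<in> {1..n}" for i using t[OF that] by auto
      have "(if n = 0 then 1 else indicator {..<1} (t n) :: real) = 1"
        using t1(1)[of n] by (cases "n = 0") auto
      moreover have "(\<Prod>i\<in>{1..n}. indicator {0<..<1} (t i) * fibre_integral ?m (\<phi> i) (t i)) = (\<Prod>i\<in>{1..n}. fibre_integral ?m (\<phi> i) (t i))"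
        using t1 by (intro prod.cong) auto
      moreover have "(LINT x|PiM {1..n} (\<lambda>i. ?m (t i)). (\<Prod>i\<in>{1..n}. apply_bcontfun (\<phi> i) (x i)))
          = (\<Prod>i\<in>{1..n}. fibre_integral ?m (\<phi> i) (t i))"
        by (rule fibre_product_integral(1)[OF m t1(3)])
      ultimately show ?thesis using True by (simp only: indicator_simps(1)) simp
    qed simp
  qed
  also have "\<dots> = fact n * iterated_integral ?m (word \<phi> n) 1"
    using iterated_integral_simplex[OF m, of 1 n \<phi>] by simp
  finally show ?thesis .
qed

section \<open>Empirical kernels and thinning\<close>

lemma iterated_integral_lipschitz:
  assumes m: "is_kernel m" and s: "s \<in> {0..1}" "s' \<in> {0..1}"
  shows "\<bar>iterated_integral m u s - iterated_integral m u s'\<bar> \<le> word_norm u * \<bar>s - s'\<bar>"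
proof (cases u)
  case Nil
  then show ?thesis by (simp add: word_norm_def)
next
  case (Cons f v)
  then show ?thesis
    using primitive_lipschitz[OF iterated_integrand[OF m, where f=f and u=v] s] by (simp add: word_norm_def)
qed

text \<open>Needed because the representative of an abstracted kernel agrees with the original only
  almost everywhere.\<close>

lemma iterated_integral_cong_AE:
  assumes m: "is_kernel m" "is_kernel m'" and eq: "AE t in unit_lborel. m t = m' t"
  shows "iterated_integral m u s = iterated_integral m' u s"
proof (induction u arbitrary: s)
  case (Cons f u)
  have "(LINT t|unit_lborel. indicator {0..s} t * (fibre_integral m f t * iterated_integral m u t))
      = (LINT t|unit_lborel. indicator {0..s} t * (fibre_integral m' f t * iterated_integral m' u t))"
  proof (rule integral_cong_AE)
    show "AE t in unit_lborel. indicator {0..s} t * (fibre_integral m f t * iterated_integral m u t) =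
        indicator {0..s} t * (fibre_integral m' f t * iterated_integral m' u t)"
      using eq by eventually_elim (simp add: Cons)
  qed (rule borel_measurable_times[OF _ iterated_integrand(1)[OF m(1)]] borel_measurable_times[OF _ iterated_integrand(1)[OF m(2)]], simp)+
  then show ?case by (simp add: primitive_def)
qed simp

text \<open>The blocks are open on the left and closed on the right, so t = 0 belongs to none of
  them; the maximum assigns it to block 1.\<close>

definition block_index :: "nat \<Rightarrow> real \<Rightarrow> nat"
  where "block_index N t = max 1 (nat \<lceil>real N * t\<rceil>)"

definition empirical_kernel :: "nat \<Rightarrow> (nat \<Rightarrow> 'b::topological_space) \<Rightarrow> real \<Rightarrow> 'b measure"
  where "empirical_kernel N x t = return borel (x (block_index N t))"

lemma block_index_range: "N \<ge> 1 \<Longrightarrow> t \<in> {0..1} \<Longrightarrow> block_index N t \<in> {1..N}"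
proof -
  assume a: "N \<ge> 1" "t \<in> {0..1}"
  then have "real N * t \<le> real N" by (simp add: mult_left_le)
  then have "\<lceil>real N * t\<rceil> \<le> int N" by (simp add: ceiling_le_iff)
  then show ?thesis using a by (auto simp: block_index_def nat_le_iff)
qed

lemma block_index_eq:
  assumes "N \<ge> 1" "t \<in> {real k / real N<..real (Suc k) / real N}"
  shows "block_index N t = Suc k"
proof -
  have "real k < real N * t" "real N * t \<le> real (Suc k)"
    using assms by (auto simp: field_simps)
  then have "\<lceil>real N * t\<rceil> = int (Suc k)" by (intro ceiling_unique) auto
  then show ?thesis by (simp add: block_index_def)
qed

lemma block_index_measurable [measurable]: "block_index N \<in> measurable unit_lborel (count_space UNIV)"
proof -
  have "block_index N \<in> measurable borel (count_space UNIV)" unfolding block_index_def by measurable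
  then show ?thesis by (intro measurable_restrict_space1) (simp cong: measurable_cong_sets)
qed

lemma fibre_empirical [simp]:
  "fibre_integral (empirical_kernel N x) f t = apply_bcontfun f (x (block_index N t))"
  unfolding empirical_kernel_def by (rule integral_return) (auto intro: borel_measurable_continuous_onI)

lemma is_kernel_empirical: "is_kernel (empirical_kernel N x)"
  unfolding is_kernel_def
proof (intro conjI ballI allI)
  show "empirical_kernel N x t \<in> space (prob_algebra borel)" for t
    by (simp add: empirical_kernel_def space_prob_algebra prob_space_return)
  show "fibre_integral (empirical_kernel N x) f \<in> borel_measurable unit_lborel" for f
    unfolding fibre_empirical
    by (rule measurable_compose[OF block_index_measurable, of "\<lambda>k. apply_bcontfun f (x k)"]) simp
qed

text \<open>The discrete counterpart of \<open>iterated_integral\<close>. The inner sum stops at k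
  when the outer index is k + 1, so exactly the strictly increasing tuples of positions occur, the
  head of the word taking the largest one.\<close>

fun iterated_sum :: "(nat \<Rightarrow> 'b) \<Rightarrow> ('b::topological_space \<Rightarrow>\<^sub>C real) list \<Rightarrow> nat \<Rightarrow> real" where
  "iterated_sum x [] k = 1"
| "iterated_sum x (f # u) 0 = 0"
| "iterated_sum x (f # u) (Suc k) = iterated_sum x (f # u) k + apply_bcontfun f (x (Suc k)) * iterated_sum x u k"

text \<open>On one block the fibre integral of the head letter is constant and the inner integral
  moves by at most its Lipschitz constant over N. Each letter thus adds one unit of 1/N to the
  error, which explains the factor \<open>length u\<close>.\<close>

lemma iterated_sum_approx:
  assumes N: "N \<ge> 1"
  shows "k \<le> N \<Longrightarrow> \<bar>iterated_sum x u k / real N ^ length u - iterated_integral (empirical_kernel N x) u (real k / real N)\<bar>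
    \<le> word_norm u * real (length u) / real N"
proof (induction u arbitrary: k)
  case Nil
  then show ?case by simp
next
  case (Cons f u)
  let ?m = "empirical_kernel N x" and ?n = "length u"
  let ?h = "\<lambda>t. fibre_integral ?m f t * iterated_integral ?m u t"
  note m = is_kernel_empirical[of N x]
  \<comment> \<open>The error density of one letter: the induction hypothesis for \<open>u\<close>
    contributes \<open>length u\<close> units, the variation within a block one more.\<close>
  define E where "E = norm f * (word_norm u * real (Suc ?n) / real N)"
  have E0: "0 \<le> E" using word_norm_nonneg[of u] by (simp add: E_def)
  have "\<bar>iterated_sum x (f # u) k / real N ^ Suc ?n - primitive ?h (real k / real N)\<bar> \<le> real k / real N * E"
    if "k \<le> N" for k
    using that
  proof (induction k)
    case 0
    then show ?case by (simp add: primitive_0)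
  next
    case (Suc k)
    let ?a = "real k / real N" and ?b = "real (Suc k) / real N"
    \<comment> \<open>The discrete integrand on block k + 1; multiplied by the block length 1/N it
      is the rescaled increment of the iterated sum.\<close>
    define d where "d = apply_bcontfun f (x (Suc k)) * (iterated_sum x u k / real N ^ ?n)"
    have ab: "?a \<in> {0..1}" "?b \<in> {0..1}" "?a \<le> ?b" "?b - ?a = 1 / real N"
      using Suc.prems N by (auto simp: divide_simps)
    have "\<bar>d * (?b - ?a) - (primitive ?h ?b - primitive ?h ?a)\<bar> \<le> E * (?b - ?a)"
    proof (rule primitive_increment[OF iterated_integrand[OF m] ab(1,2,3)])
      fix t assume t: "t \<in> {?a<..?b}"
      then have t01: "t \<in> {0..1}"
        using ab(1,2) by (meson atLeastAtMost_iff greaterThanAtMost_iff less_imp_le order_trans)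
      have "\<bar>iterated_sum x u k / real N ^ ?n - iterated_integral ?m u t\<bar>
        \<le> \<bar>iterated_sum x u k / real N ^ ?n - iterated_integral ?m u ?a\<bar> + \<bar>iterated_integral ?m u ?a - iterated_integral ?m u t\<bar>"
        by linarith
      also have "\<dots> \<le> word_norm u * real ?n / real N + word_norm u * \<bar>?a - t\<bar>"
        using Suc.prems by (intro add_mono Cons.IH iterated_integral_lipschitz[OF m ab(1) t01]) simp
      also have "\<dots> \<le> word_norm u * real ?n / real N + word_norm u * (1 / real N)"
        using t ab(4) word_norm_nonneg[of u] by (intro add_mono mult_left_mono order_refl) auto
      also have "\<dots> = word_norm u * real (Suc ?n) / real N"
        by (simp add: distrib_left add_divide_distrib)
      finally have 1: "\<bar>iterated_sum x u k / real N ^ ?n - iterated_integral ?m u t\<bar> \<le> word_norm u * real (Suc ?n) / real N" .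
      have "d - ?h t = apply_bcontfun f (x (Suc k)) * (iterated_sum x u k / real N ^ ?n - iterated_integral ?m u t)"
        using block_index_eq[OF N t] by (simp add: d_def right_diff_distrib)
      also have "\<bar>\<dots>\<bar> \<le> E"
        unfolding E_def abs_mult using norm_bounded[of f "x (Suc k)"] 1 by (intro mult_mono) auto
      finally show "\<bar>d - ?h t\<bar> \<le> E" .
    qed
    moreover have "iterated_sum x (f # u) (Suc k) / real N ^ Suc ?n = iterated_sum x (f # u) k / real N ^ Suc ?n + d * (?b - ?a)"
      unfolding ab(4) d_def using N by (simp add: add_divide_distrib)
    moreover have "\<bar>iterated_sum x (f # u) k / real N ^ Suc ?n - primitive ?h ?a\<bar> \<le> ?a * E"
      using Suc by simp
    moreover have "?b * E = ?a * E + E * (?b - ?a)" by (simp add: algebra_simps)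
    ultimately show ?case by linarith
  qed
  from this[OF Cons.prems] have "\<bar>iterated_sum x (f # u) k / real N ^ Suc ?n - primitive ?h (real k / real N)\<bar> \<le> real k / real N * E" .
  also have "\<dots> \<le> 1 * E" using E0 Cons.prems N by (intro mult_right_mono) auto
  finally show ?case by (simp add: E_def word_norm_def mult.assoc)
qed

lemma iterated_sum_ones: "iterated_sum x (replicate n one_bcontfun) k = real (k choose n)"
proof (induction n arbitrary: k)
  case 0
  then show ?case by simp
next
  case (Suc n)
  show ?case by (induction k) (simp_all add: Suc const_bcontfun.rep_eq)
qed

text \<open>The words of ones make the comparison between sums and integrals explicit: the sum is a
  binomial coefficient and the integral is 1/n!.\<close>

lemma binomial_limit: "(\<lambda>N. real (N choose n) / real N ^ n) \<longlonglongrightarrow> 1 / fact n"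
proof -
  let ?w = "replicate n (one_bcontfun :: real \<Rightarrow>\<^sub>C real)"
  have w1: "word_norm ?w \<le> 1"
  proof (induction n)
    case 0
    then show ?case by (simp add: word_norm_def)
  next
    case (Suc n)
    have "norm (one_bcontfun :: real \<Rightarrow>\<^sub>C real) \<le> 1" by (rule norm_bound) (simp add: const_bcontfun.rep_eq)
    then have "norm (one_bcontfun :: real \<Rightarrow>\<^sub>C real) * word_norm (replicate n (one_bcontfun :: real \<Rightarrow>\<^sub>C real)) \<le> 1 * 1"
      using Suc word_norm_nonneg by (intro mult_mono) auto
    then show ?case by (simp add: word_norm_def)
  qed
  have est: "\<bar>real (N choose n) / real N ^ n - 1 / fact n\<bar> \<le> real n / real N" if N: "N \<ge> 1" for N
  proof -
    have "\<bar>real (N choose n) / real N ^ n - 1 / fact n\<bar> \<le> word_norm ?w * real n / real N"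
      using iterated_sum_approx[OF N order_refl, of "\<lambda>_. 0 :: real" ?w] N
      by (simp add: iterated_sum_ones iterated_integral_ones[OF is_kernel_empirical])
    also have "\<dots> \<le> 1 * real n / real N"
      using w1 by (intro divide_right_mono mult_right_mono) auto
    finally show ?thesis by simp
  qed
  have "(\<lambda>N. real (N choose n) / real N ^ n - 1 / fact n) \<longlonglongrightarrow> 0"
  proof (rule Lim_null_comparison)
    show "\<forall>\<^sub>F N in sequentially. norm (real (N choose n) / real N ^ n - 1 / fact n) \<le> real n / real N"
      unfolding eventually_sequentially using est by auto
    show "(\<lambda>N. real n / real N) \<longlonglongrightarrow> 0"
      by (rule lim_const_over_n)
  qed
  then show ?thesis by (rule LIM_zero_cancel)
qed

section \<open>Increasing index maps and integrals against thinned measures\<close>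

lemma increasing_indices_0: "increasing_indices 0 N = {\<lambda>_. undefined}"
  by (auto simp: increasing_indices_def strict_mono_on_def)

lemma increasing_indices_Suc_0: "increasing_indices (Suc n) 0 = {}"
  by (auto simp: increasing_indices_def PiE_eq_empty_iff)

text \<open>Pascal's rule at the level of index maps: the last index either stays within N or equals
  N + 1. It matches the recursion of \<open>iterated_sum\<close>.\<close>

lemma increasing_indices_Suc_Suc:
  "increasing_indices (Suc n) (Suc N) = increasing_indices (Suc n) N \<union> (\<lambda>i. i(Suc n := Suc N)) ` increasing_indices n N"
proof (intro subset_antisym subsetI)
  fix i assume i: "i \<in> increasing_indices (Suc n) (Suc N)"
  then have iE: "i \<in> extensional {1..Suc n}" and ir: "\<And>j. j \<in> {1..Suc n} \<Longrightarrow> i j \<in> {1..Suc N}"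
    and im: "\<And>j k. j \<in> {1..Suc n} \<Longrightarrow> k \<in> {1..Suc n} \<Longrightarrow> j < k \<Longrightarrow> i j < i k"
    by (auto simp: increasing_indices_def PiE_def strict_mono_on_def)
  show "i \<in> increasing_indices (Suc n) N \<union> (\<lambda>i. i(Suc n := Suc N)) ` increasing_indices n N"
  proof (cases "i (Suc n) \<le> N")
    case True
    have "i j \<in> {1..N}" if "j \<in> {1..Suc n}" for j
      using ir[OF that] im[of j "Suc n"] that True by (cases "j = Suc n") auto
    then have "i \<in> increasing_indices (Suc n) N"
      using iE im by (auto simp: increasing_indices_def PiE_def strict_mono_on_def)
    then show ?thesis by simp
  next
    case False
    then have last: "i (Suc n) = Suc N" using ir[of "Suc n"] by auto
    define i' where "i' = i(Suc n := undefined)"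
    have "i' j \<in> {1..N}" if "j \<in> {1..n}" for j
      using ir[of j] im[of j "Suc n"] that last by (auto simp: i'_def)
    then have "i' \<in> increasing_indices n N"
      using iE im by (auto simp: increasing_indices_def PiE_def strict_mono_on_def i'_def extensional_def)
    moreover have "i = i'(Suc n := Suc N)" using last by (auto simp: i'_def)
    ultimately show ?thesis by blast
  qed
next
  fix i assume "i \<in> increasing_indices (Suc n) N \<union> (\<lambda>i. i(Suc n := Suc N)) ` increasing_indices n N"
  then consider "i \<in> increasing_indices (Suc n) N" | i' where "i' \<in> increasing_indices n N" "i = i'(Suc n := Suc N)"
    by blast
  then show "i \<in> increasing_indices (Suc n) (Suc N)"
  proof cases
    case 1
    then show ?thesis by (fastforce simp: increasing_indices_def PiE_def)
  next
    case 2
    then have iE: "i' \<in> extensional {1..n}" and ir: "\<And>j. j \<in> {1..n} \<Longrightarrow> i' j \<in> {1..N}"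
      and im: "\<And>j k. j \<in> {1..n} \<Longrightarrow> k \<in> {1..n} \<Longrightarrow> j < k \<Longrightarrow> i' j < i' k"
      by (auto simp: increasing_indices_def PiE_def strict_mono_on_def)
    have "i j \<in> {1..Suc N}" if "j \<in> {1..Suc n}" for j
      using ir[of j] that by (cases "j = Suc n") (auto simp: 2(2))
    moreover have "i j < i k" if "j \<in> {1..Suc n}" "k \<in> {1..Suc n}" "j < k" for j k
      using ir[of j] im[of j k] that by (cases "k = Suc n") (auto simp: 2(2))
    moreover have "i \<in> extensional {1..Suc n}" using iE by (auto simp: 2(2) extensional_def)
    ultimately show ?thesis by (auto simp: increasing_indices_def PiE_def strict_mono_on_def)
  qed
qed

lemma sum_increasing_indices:
  fixes \<phi> :: "nat \<Rightarrow> ('b::topological_space \<Rightarrow>\<^sub>C real)"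
  shows "(\<Sum>i\<in>increasing_indices n N. \<Prod>j\<in>{1..n}. apply_bcontfun (\<phi> j) (x (i j))) = iterated_sum x (word \<phi> n) N"
proof (induction n arbitrary: N)
  case 0
  then show ?case by (simp add: increasing_indices_0)
next
  case (Suc n)
  note outer = Suc
  show ?case
  proof (induction N)
    case 0
    then show ?case by (simp add: increasing_indices_Suc_0)
  next
    case (Suc N)
    have inj: "inj_on (\<lambda>i. i(Suc n := Suc N)) (increasing_indices n N)"
    proof (rule inj_onI)
      fix i i' assume i: "i \<in> increasing_indices n N" "i' \<in> increasing_indices n N" and eq: "i(Suc n := Suc N) = i'(Suc n := Suc N)"
      show "i = i'"
      proof
        fix j show "i j = i' j"
          using fun_cong[OF eq, of j] i by (cases "j = Suc n") (auto simp: increasing_indices_def PiE_def extensional_def)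
      qed
    qed
    have disj: "increasing_indices (Suc n) N \<inter> (\<lambda>i. i(Suc n := Suc N)) ` increasing_indices n N = {}"
    proof (rule equals0I)
      fix i assume i: "i \<in> increasing_indices (Suc n) N \<inter> (\<lambda>i. i(Suc n := Suc N)) ` increasing_indices n N"
      then have "i (Suc n) = Suc N" by auto
      moreover have "i (Suc n) \<in> {1..N}"
        using i by (intro PiE_mem[of i "{1..Suc n}" "\<lambda>_. {1..N}"]) (auto simp: increasing_indices_def)
      ultimately show False by simp
    qed
    have "(\<Sum>i\<in>increasing_indices (Suc n) (Suc N). \<Prod>j\<in>{1..Suc n}. apply_bcontfun (\<phi> j) (x (i j))) =
      (\<Sum>i\<in>increasing_indices (Suc n) N. \<Prod>j\<in>{1..Suc n}. apply_bcontfun (\<phi> j) (x (i j))) +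
      (\<Sum>i\<in>increasing_indices n N. \<Prod>j\<in>{1..Suc n}. apply_bcontfun (\<phi> j) (x ((i(Suc n := Suc N)) j)))"
      unfolding increasing_indices_Suc_Suc
      by (subst sum.union_disjoint) (auto simp: finite_increasing_indices disj sum.reindex[OF inj])
    also have "(\<Sum>i\<in>increasing_indices n N. \<Prod>j\<in>{1..Suc n}. apply_bcontfun (\<phi> j) (x ((i(Suc n := Suc N)) j))) =
      (\<Sum>i\<in>increasing_indices n N. (\<Prod>j\<in>{1..n}. apply_bcontfun (\<phi> j) (x (i j))) * apply_bcontfun (\<phi> (Suc n)) (x (Suc N)))"
      by (rule sum.cong) (auto simp: atLeastAtMostSuc_conv cong: prod.cong_simp)
    also have "\<dots> = apply_bcontfun (\<phi> (Suc n)) (x (Suc N)) * iterated_sum x (word \<phi> n) N"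
      unfolding sum_distrib_right[symmetric] outer by (rule mult.commute)
    finally show ?case using Suc by simp
  qed
qed

lemma card_increasing_indices: "card (increasing_indices n N) = N choose n"
proof -
  have w: "word (\<lambda>_. one_bcontfun) n = replicate n (one_bcontfun :: real \<Rightarrow>\<^sub>C real)"
    by (induction n) auto
  have "real (card (increasing_indices n N)) = real (N choose n)"
    using sum_increasing_indices[where \<phi>="\<lambda>_. one_bcontfun :: real \<Rightarrow>\<^sub>C real" and n=n and N=N and x="\<lambda>_. 0"]
    unfolding w iterated_sum_ones by (simp add: const_bcontfun.rep_eq)
  then show ?thesis by simp
qed

lemma subsequence_measurable:
  assumes "i \<in> increasing_indices k n"
  shows "(\<lambda>x. \<lambda>j\<in>{1..k}. x (i j)) \<in> measurable (borel_pow n) (borel_pow k)"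
proof (rule measurable_restrict)
  fix j assume "j \<in> {1..k}"
  with assms have "i j \<in> {1..n}" by (auto simp: increasing_indices_def)
  then show "(\<lambda>x. x (i j)) \<in> borel_measurable (borel_pow n)" by simp
qed

text \<open>Thinning is a mixture of image measures over a uniformly chosen index map, so it can be
  written with \<open>bind\<close> over a finite uniform distribution, and the integral formula for
  \<open>bind\<close> applies.\<close>

lemma integral_thinning:
  fixes M :: "(nat \<Rightarrow> 'b::topological_space) measure"
  assumes M: "prob_space M" "sets M = sets (borel_pow n)" and kn: "k \<le> n"
    and f[measurable]: "f \<in> borel_measurable (borel_pow k)" and B: "\<And>x. x \<in> space (borel_pow k) \<Longrightarrow> \<bar>f x\<bar> \<le> (B :: real)"
  shows "integral\<^sup>L (thinning n k M) f = (\<Sum>i\<in>increasing_indices k n. LINT x|M. f (\<lambda>j\<in>{1..k}. x (i j))) / real (n choose k)"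
proof -
  interpret prob_space M by fact
  let ?I = "increasing_indices k n" and ?g = "\<lambda>i x. \<lambda>j\<in>{1..k}. x (i j)"
  have "card ?I > 0" using kn by (simp add: card_increasing_indices)
  then have ne: "?I \<noteq> {}" by auto
  then obtain i0 where i0: "i0 \<in> ?I" by auto
  \<comment> \<open>The mixing kernel has to be a probability measure for every argument; maps
    outside the finite support are sent to the arbitrary \<open>i0\<close>.\<close>
  define s where "s i = (if i \<in> ?I then i else i0)" for i
  have s: "s i \<in> ?I" for i using i0 by (simp add: s_def)
  define K where "K i = distr M (borel_pow k) (?g (s i))" for i
  have gm: "?g i \<in> measurable M (borel_pow k)" if "i \<in> ?I" for i
    using subsequence_measurable[OF that] by (simp cong: measurable_cong_sets add: M(2))
  let ?p = "measure_pmf (pmf_of_set ?I)"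
  have Kp: "prob_space (K i)" for i unfolding K_def by (rule prob_space_distr[OF gm[OF s]])
  have Km: "K \<in> measurable ?p (subprob_algebra (borel_pow k))"
    using prob_space_imp_subprob_space[OF Kp] by (auto simp: measurable_def space_subprob_algebra K_def)
  have eq: "thinning n k M = ?p \<bind> K"
  proof (rule measure_eqI)
    show "sets (thinning n k M) = sets (?p \<bind> K)"
      by (simp add: sets_bind_measurable[OF Km])
    fix A assume "A \<in> sets (thinning n k M)"
    then have A: "A \<in> sets (borel_pow k)" by simp
    have "emeasure (?p \<bind> K) A = (\<integral>\<^sup>+i. emeasure (K i) A \<partial>?p)"
      by (rule emeasure_bind[OF _ Km A]) simp
    also have "\<dots> = (\<Sum>i\<in>?I. emeasure (K i) A) / of_nat (card ?I)"
      by (subst nn_integral_pmf_of_set[OF ne finite_increasing_indices]) (simp add: ennreal_of_nat_eq_real_of_nat)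
    also have "(\<Sum>i\<in>?I. emeasure (K i) A) = (\<Sum>i\<in>?I. emeasure M {x \<in> space M. ?g i x \<in> A})"
    proof (rule sum.cong[OF refl])
      fix i assume i: "i \<in> ?I"
      show "emeasure (K i) A = emeasure M {x \<in> space M. ?g i x \<in> A}"
        unfolding K_def using i by (subst emeasure_distr[OF gm[OF s] A]) (auto simp: s_def intro!: arg_cong[where f="emeasure M"])
    qed
    finally show "emeasure (thinning n k M) A = emeasure (?p \<bind> K) A"
      by (simp add: emeasure_thinning[OF M(2) A] card_increasing_indices)
  qed
  have "integral\<^sup>L (thinning n k M) f = (LINT i|?p. integral\<^sup>L (K i) f)"
    unfolding eq
  proof (rule integral_bind[OF f B Km])
    show "AE i in ?p. emeasure (K i) (space (K i)) \<le> ennreal 1"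
      using prob_space.emeasure_le_1[OF Kp] by simp
  qed (simp_all add: measure_pmf.finite_measure_axioms)
  also have "\<dots> = (\<Sum>i\<in>?I. integral\<^sup>L (K i) f) / real (card ?I)"
    by (rule integral_pmf_of_set[OF ne finite_increasing_indices])
  also have "(\<Sum>i\<in>?I. integral\<^sup>L (K i) f) = (\<Sum>i\<in>?I. LINT x|M. f (?g i x))"
  proof (rule sum.cong[OF refl])
    fix i assume i: "i \<in> ?I"
    show "integral\<^sup>L (K i) f = (LINT x|M. f (?g i x))"
      unfolding K_def using i integral_distr[OF gm[OF s] f, of i] by (simp add: s_def)
  qed
  finally show ?thesis by (simp add: card_increasing_indices)
qed

section \<open>Continuous functions on powers\<close>

definition tensor :: "nat \<Rightarrow> (nat \<Rightarrow> ('b::topological_space \<Rightarrow>\<^sub>C real)) \<Rightarrow> (nat \<Rightarrow> 'b) \<Rightarrow> real"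
  where "tensor n \<phi> x = (\<Prod>i\<in>{1..n}. apply_bcontfun (\<phi> i) (x i))"

definition tensor_sum :: "nat \<Rightarrow> (real \<times> (nat \<Rightarrow> ('b::topological_space \<Rightarrow>\<^sub>C real))) list \<Rightarrow> (nat \<Rightarrow> 'b) \<Rightarrow> real"
  where "tensor_sum n ps x = (\<Sum>p\<leftarrow>ps. fst p * tensor n (snd p) x)"

abbreviation power_space :: "nat \<Rightarrow> (nat \<Rightarrow> 'b) set"
  where "power_space n \<equiv> PiE {1..n} (\<lambda>_. UNIV)"

lemma tensor_measurable: "tensor n \<phi> \<in> borel_measurable (borel_pow n)"
  unfolding tensor_def
  by (intro borel_measurable_prod measurable_compose[OF measurable_component_singleton[of _ _ "\<lambda>_. borel"]]
      borel_measurable_continuous_onI continuous_on_apply_bcontfun)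

lemma tensor_sum_measurable: "tensor_sum n ps \<in> borel_measurable (borel_pow n)"
proof (induction ps)
  case (Cons p ps)
  have "(\<lambda>x. fst p * tensor n (snd p) x + tensor_sum n ps x) \<in> borel_measurable (borel_pow n)"
    by (intro borel_measurable_add borel_measurable_times borel_measurable_const tensor_measurable Cons)
  then show ?case by (simp add: tensor_sum_def[abs_def])
qed (simp add: tensor_sum_def[abs_def])

lemma tensor_le: "\<bar>tensor n \<phi> x\<bar> \<le> (\<Prod>i\<in>{1..n}. norm (\<phi> i))"
  unfolding tensor_def abs_prod
  by (intro prod_mono) (use norm_bounded in \<open>auto simp flip: real_norm_def\<close>)

lemma kernel_power_measure:
  assumes m: "is_kernel m" and t: "t \<in> ordered_simplex n"
  shows "prob_space (PiM {1..n} (\<lambda>i. m (t i)))" "sets (PiM {1..n} (\<lambda>i. m (t i))) = sets (borel_pow n)"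
    "space (PiM {1..n} (\<lambda>i. m (t i))) = power_space n"
proof -
  have t01: "t i \<in> {0..1}" if "i \<in> {1..n}" for i
  proof -
    have "t i \<in> {0<..<1}" using t that by (auto simp: ordered_simplex_eq)
    then show ?thesis by simp
  qed
  show "prob_space (PiM {1..n} (\<lambda>i. m (t i)))" by (rule fibre_product_integral(3)[OF m t01])
  show s: "sets (PiM {1..n} (\<lambda>i. m (t i))) = sets (borel_pow n)"
    by (rule sets_PiM_cong[OF refl]) (rule kernel_prob(2)[OF m t01])
  show "space (PiM {1..n} (\<lambda>i. m (t i))) = power_space n"
    using sets_eq_imp_space_eq[OF s] by (simp add: space_PiM)
qed

text \<open>A Bochner integral of a non-integrable function is 0 by convention, so linearity and
  comparison of mixtures require integrability both in the fibres and over the simplex.\<close>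

definition mixture_integrable :: "nat \<Rightarrow> ((nat \<Rightarrow> 'b::topological_space) \<Rightarrow> real) \<Rightarrow> 'b kernels \<Rightarrow> bool"
  where "mixture_integrable n f \<kappa> \<longleftrightarrow>
    (\<forall>t\<in>ordered_simplex n. integrable (PiM {1..n} (\<lambda>i. rep_kernels \<kappa> (t i))) f) \<and>
    integrable (PiM {1..n} (\<lambda>_. lborel))
      (\<lambda>t. indicator (ordered_simplex n) t * (LINT x|PiM {1..n} (\<lambda>i. rep_kernels \<kappa> (t i)). f x))"

lemma simplex_mixture_eq:
  "simplex_mixture n f \<kappa> = fact n * (LINT t|PiM {1..n} (\<lambda>_. lborel).
    indicator (ordered_simplex n) t * (LINT x|PiM {1..n} (\<lambda>i. rep_kernels \<kappa> (t i)). f x))"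
  unfolding simplex_mixture_def set_lebesgue_integral_def
  by (subst Bochner_Integration.integral_mult_right_zero[symmetric]) (simp add: ac_simps)

lemma mixture_integrable_add:
  assumes f: "mixture_integrable n f \<kappa>" and g: "mixture_integrable n g \<kappa>"
  shows "mixture_integrable n (\<lambda>x. a * f x + g x) \<kappa>"
    and "simplex_mixture n (\<lambda>x. a * f x + g x) \<kappa> = a * simplex_mixture n f \<kappa> + simplex_mixture n g \<kappa>"
proof -
  let ?M = "\<lambda>t. PiM {1..n} (\<lambda>i. rep_kernels \<kappa> (t i))"
  let ?T = "\<lambda>f t. indicator (ordered_simplex n) t * (LINT x|?M t. f x)"
  have eq: "?T (\<lambda>x. a * f x + g x) t = a * ?T f t + ?T g t" for t
  proof (cases "t \<in> ordered_simplex n")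
    case True
    then have "integrable (?M t) (\<lambda>x. a * f x)" "integrable (?M t) g" using f g by (auto simp: mixture_integrable_def)
    then show ?thesis using True by simp
  qed simp
  have i: "integrable (PiM {1..n} (\<lambda>_. lborel)) (\<lambda>t. a * ?T f t)" "integrable (PiM {1..n} (\<lambda>_. lborel)) (?T g)"
    using f g by (auto simp: mixture_integrable_def)
  show "mixture_integrable n (\<lambda>x. a * f x + g x) \<kappa>"
    using f g i unfolding mixture_integrable_def eq by auto
  show "simplex_mixture n (\<lambda>x. a * f x + g x) \<kappa> = a * simplex_mixture n f \<kappa> + simplex_mixture n g \<kappa>"
    unfolding simplex_mixture_eq eq Bochner_Integration.integral_add[OF i]
    by (simp only: Bochner_Integration.integral_mult_right_zero) (simp add: algebra_simps)
qed

lemma mixture_integrable_tensor: "mixture_integrable n (tensor n \<phi>) (\<kappa> :: 'b::topological_space kernels)"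
  unfolding mixture_integrable_def
proof (intro conjI ballI)
  let ?m = "rep_kernels \<kappa>"
  note m = is_kernel_rep[of \<kappa>]
  interpret L: product_sigma_finite "\<lambda>_ :: nat. lborel :: real measure" ..
  define g where "g i t = indicator {0<..<1} t * fibre_integral ?m (\<phi> i) t" for i t
  have g_int: "integrable lborel (g i)" for i
    unfolding g_def by (rule integrable_unit_fibre_integral[OF m])
  have t01: "t i \<in> {0<..<1}" if "t \<in> ordered_simplex n" "i \<in> {1..n}" for t i
    using that by (auto simp: ordered_simplex_eq)
  have t01': "t i \<in> {0..1}" if "t \<in> ordered_simplex n" "i \<in> {1..n}" for t i
    using t01[OF that] by simp
  show "integrable (PiM {1..n} (\<lambda>i. ?m (t i))) (tensor n \<phi>)" if "t \<in> ordered_simplex n" for t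
    unfolding tensor_def[abs_def] by (rule fibre_product_integral(2)[OF m t01'[OF that]])
  have eq: "indicator (ordered_simplex n) t * (LINT x|PiM {1..n} (\<lambda>i. ?m (t i)). tensor n \<phi> x)
      = indicator (ordered_simplex n) t * (\<Prod>i\<in>{1..n}. g i (t i))" for t
  proof (cases "t \<in> ordered_simplex n")
    case True
    have "(LINT x|PiM {1..n} (\<lambda>i. ?m (t i)). tensor n \<phi> x) = (\<Prod>i\<in>{1..n}. fibre_integral ?m (\<phi> i) (t i))"
      unfolding tensor_def by (rule fibre_product_integral(1)[OF m t01'[OF True]])
    also have "\<dots> = (\<Prod>i\<in>{1..n}. g i (t i))"
      by (rule prod.cong) (use t01[OF True] in \<open>auto simp: g_def\<close>)
    finally show ?thesis by simp
  qed simp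
  have i: "integrable (PiM {1..n} (\<lambda>_. lborel)) (\<lambda>t. \<Prod>i\<in>{1..n}. g i (t i))"
    by (rule L.product_integrable_prod) (auto intro: g_int)
  show "integrable (PiM {1..n} (\<lambda>_. lborel)) (\<lambda>t. indicator (ordered_simplex n) t * (LINT x|PiM {1..n} (\<lambda>i. ?m (t i)). tensor n \<phi> x))"
    unfolding eq
  proof (rule Bochner_Integration.integrable_bound[OF i])
    show "(\<lambda>t. indicator (ordered_simplex n) t * (\<Prod>i\<in>{1..n}. g i (t i))) \<in> borel_measurable (PiM {1..n} (\<lambda>_. lborel))"
      by (rule borel_measurable_times[OF borel_measurable_indicator[OF ordered_simplex_sets] borel_measurable_integrable[OF i]])
  qed (auto simp: indicator_def)
qed

lemma mixture_integrable_tensor_sum: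
  "mixture_integrable n (tensor_sum n ps) \<kappa>"
  "simplex_mixture n (tensor_sum n ps) \<kappa> =
    (\<Sum>p\<leftarrow>ps. fst p * (fact n * iterated_integral (rep_kernels \<kappa>) (word (snd p) n) 1))"
proof (induction ps)
  case Nil
  have z: "tensor_sum n [] = (\<lambda>x. 0)" by (simp add: tensor_sum_def fun_eq_iff)
  {
    case 1
    then show ?case unfolding z by (simp add: mixture_integrable_def)
  next
    case 2
    then show ?case unfolding z by (simp add: simplex_mixture_eq)
  }
next
  case (Cons p ps)
  have eq: "tensor_sum n (p # ps) = (\<lambda>x. fst p * tensor n (snd p) x + tensor_sum n ps x)"
    by (simp add: tensor_sum_def fun_eq_iff)
  note a = mixture_integrable_add[OF mixture_integrable_tensor Cons.IH(1), of "fst p" "snd p"]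
  {
    case 1
    then show ?case unfolding eq by (rule a(1))
  next
    case 2
    have "simplex_mixture n (tensor n (snd p)) \<kappa> = fact n * iterated_integral (rep_kernels \<kappa>) (word (snd p) n) 1"
      using simplex_mixture_prod[of n "snd p" \<kappa>] by (simp add: tensor_def[abs_def])
    then show ?case unfolding eq a(2) Cons.IH(2) by simp
  }
qed

lemma word_ones: "word (\<lambda>_. one_bcontfun) n = replicate n one_bcontfun"
  by (induction n) auto

text \<open>Apply the product formula to constant functions: every fibre integral is 1, and the word
  of n ones gives 1/n!. The kernel on the reals is an arbitrary choice.\<close>

lemma simplex_volume:
  "integrable (PiM {1..n} (\<lambda>_. lborel)) (indicator (ordered_simplex n) :: _ \<Rightarrow> real)"
  "fact n * (LINT t|PiM {1..n} (\<lambda>_. lborel). indicator (ordered_simplex n) t :: real) = 1"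
proof -
  define \<kappa> where "\<kappa> = abs_kernels (\<lambda>_. return borel (0 :: real))"
  let ?o = "\<lambda>_ :: nat. one_bcontfun :: real \<Rightarrow>\<^sub>C real"
  have one: "tensor n ?o = (\<lambda>_. 1)" by (simp add: tensor_def fun_eq_iff const_bcontfun.rep_eq)
  have eq: "indicator (ordered_simplex n) t * (LINT x|PiM {1..n} (\<lambda>i. rep_kernels \<kappa> (t i)). 1) = (indicator (ordered_simplex n) t :: real)" for t
  proof (cases "t \<in> ordered_simplex n")
    case True
    then show ?thesis using prob_space.prob_space[OF kernel_power_measure(1)[OF is_kernel_rep True, of \<kappa>]] by simp
  qed simp
  show "integrable (PiM {1..n} (\<lambda>_. lborel)) (indicator (ordered_simplex n) :: _ \<Rightarrow> real)"
    using mixture_integrable_tensor[of n ?o \<kappa>] unfolding mixture_integrable_def one eq by simp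
  have "simplex_mixture n (tensor n ?o) \<kappa> = fact n * iterated_integral (rep_kernels \<kappa>) (word ?o n) 1"
    using simplex_mixture_prod[of n ?o \<kappa>] by (simp add: tensor_def[abs_def])
  also have "\<dots> = 1" unfolding word_ones by (simp add: iterated_integral_ones[OF is_kernel_rep])
  finally show "fact n * (LINT t|PiM {1..n} (\<lambda>_. lborel). indicator (ordered_simplex n) t :: real) = 1"
    unfolding simplex_mixture_eq one eq .
qed

text \<open>The factor n! normalizes the simplex to mass 1, so the mixture is a contraction in the
  sup norm. This carries statements from tensor sums to all continuous functions.\<close>

lemma simplex_mixture_diff_le:
  assumes f: "mixture_integrable n f \<kappa>" and g: "mixture_integrable n g \<kappa>"
    and e: "\<And>x. x \<in> power_space n \<Longrightarrow> \<bar>f x - g x\<bar> \<le> e"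
  shows "\<bar>simplex_mixture n f \<kappa> - simplex_mixture n g \<kappa>\<bar> \<le> e"
proof -
  let ?M = "\<lambda>t. PiM {1..n} (\<lambda>i. rep_kernels \<kappa> (t i))" and ?L = "PiM {1..n} (\<lambda>_. lborel :: real measure)"
  let ?T = "\<lambda>f t. indicator (ordered_simplex n) t * (LINT x|?M t. f x)"
  have i: "integrable ?L (?T f)" "integrable ?L (?T g)"
    using f g by (auto simp: mixture_integrable_def)
  have eq: "simplex_mixture n f \<kappa> - simplex_mixture n g \<kappa> = fact n * (LINT t|?L. ?T f t - ?T g t)"
    unfolding simplex_mixture_eq Bochner_Integration.integral_diff[OF i] by (simp add: algebra_simps)
  have "\<bar>LINT t|?L. ?T f t - ?T g t\<bar> \<le> (LINT t|?L. \<bar>?T f t - ?T g t\<bar>)" by (rule integral_abs_bound)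
  also have "\<dots> \<le> (LINT t|?L. e * indicator (ordered_simplex n) t)"
  proof (rule integral_mono)
    show "integrable ?L (\<lambda>t. \<bar>?T f t - ?T g t\<bar>)" by (intro integrable_abs Bochner_Integration.integrable_diff i)
    show "integrable ?L (\<lambda>t. e * indicator (ordered_simplex n) t)" by (intro integrable_mult_right simplex_volume(1))
    fix t
    show "\<bar>?T f t - ?T g t\<bar> \<le> e * indicator (ordered_simplex n) t"
    proof (cases "t \<in> ordered_simplex n")
      case True
      note M = kernel_power_measure[OF is_kernel_rep True, of \<kappa>]
      have fi: "integrable (?M t) f" "integrable (?M t) g" using f g True by (auto simp: mixture_integrable_def)
      have "\<bar>(LINT x|?M t. f x) - (LINT x|?M t. g x)\<bar> \<le> e"
        by (rule prob_integral_diff_le[OF M(1) fi]) (use e in \<open>simp only: M(3)\<close>)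
      then show ?thesis using True by simp
    qed simp
  qed
  also have "\<dots> = e * (LINT t|?L. indicator (ordered_simplex n) t)" by simp
  finally have "fact n * \<bar>LINT t|?L. ?T f t - ?T g t\<bar> \<le> fact n * (e * (LINT t|?L. indicator (ordered_simplex n) t))"
    by (intro mult_left_mono) auto
  also have "\<dots> = e * (fact n * (LINT t|?L. indicator (ordered_simplex n) t))" by (simp only: ac_simps)
  also have "\<dots> = e" unfolding simplex_volume(2) by simp
  finally show ?thesis unfolding eq by (simp add: abs_mult)
qed

section \<open>Density of tensor sums and general continuous integrands\<close>

context
  assumes compact_UNIV: "compact (UNIV :: 'a::metric_space set)"
begin

lemma tensor_sum_mult:
  "\<exists>rs. \<forall>x :: nat \<Rightarrow> 'a. tensor_sum n ps x * tensor_sum n qs x = tensor_sum n rs x"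
proof (induction ps)
  case Nil
  then show ?case by (intro exI[of _ "[]"]) (simp add: tensor_sum_def)
next
  case (Cons p ps)
  then obtain rs where rs: "\<And>x :: nat \<Rightarrow> 'a. tensor_sum n ps x * tensor_sum n qs x = tensor_sum n rs x" by blast
  define mul where "mul f g = Bcontfun (\<lambda>x. apply_bcontfun f x * apply_bcontfun g x)" for f g :: "'a \<Rightarrow>\<^sub>C real"
  have mul: "apply_bcontfun (mul f g) x = apply_bcontfun f x * apply_bcontfun g x" for f g x
  proof -
    have "continuous_on UNIV (\<lambda>x. apply_bcontfun f x * apply_bcontfun g x)" by (intro continuous_intros) auto
    then show ?thesis unfolding mul_def by (simp add: apply_Bcontfun[OF compact_UNIV])
  qed
  have t: "tensor n (\<lambda>i. mul (\<phi> i) (\<psi> i)) x = tensor n \<phi> x * tensor n \<psi> x" for \<phi> \<psi> x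
    by (simp add: tensor_def mul prod.distrib)
  have "tensor_sum n (p # ps) x * tensor_sum n qs x =
      tensor_sum n (map (\<lambda>q. (fst p * fst q, \<lambda>i. mul (snd p i) (snd q i))) qs @ rs) x" for x
  proof -
    have "fst p * tensor n (snd p) x * tensor_sum n qs x
        = tensor_sum n (map (\<lambda>q. (fst p * fst q, \<lambda>i. mul (snd p i) (snd q i))) qs) x"
      unfolding tensor_sum_def by (induction qs) (simp_all add: t algebra_simps)
    then show ?thesis using rs[of x] by (simp add: tensor_sum_def distrib_right)
  qed
  then show ?case by blast
qed

lemma compact_power_space: "compact (power_space n :: (nat \<Rightarrow> 'a) set)"
proof -
  \<comment> \<open>Extensional functions form a full product in which the surplus coordinates range
    over one point, so Tychonoff's theorem applies.\<close>
  have eq: "(power_space n :: (nat \<Rightarrow> 'a) set) = PiE UNIV (\<lambda>i. if i \<in> {1..n} then UNIV else {undefined})"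
    by (auto simp: PiE_def extensional_def Pi_def)
  have "compactin (product_topology (\<lambda>_. euclidean) UNIV) (PiE UNIV (\<lambda>i. if i \<in> {1..n} then (UNIV :: 'a set) else {undefined}))"
    unfolding compactin_PiE by (auto simp: compact_UNIV)
  then show ?thesis unfolding eq euclidean_product_topology by simp
qed

lemma continuous_on_power_space:
  fixes f :: "(nat \<Rightarrow> 'a) \<Rightarrow> real"
  assumes "continuous_map (pow_topology n) euclideanreal f"
  shows "continuous_on (power_space n) f"
proof -
  have "continuous_map (top_of_set (power_space n)) (pow_topology n) (\<lambda>x :: nat \<Rightarrow> 'a. x)"
    unfolding continuous_map_componentwise
    by (auto simp: PiE_def intro: continuous_on_subset[OF continuous_on_product_coordinates])
  then have "continuous_map (top_of_set (power_space n)) euclideanreal (f \<circ> (\<lambda>x. x))"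
    using assms by (rule continuous_map_compose)
  then show ?thesis by (simp add: o_def)
qed

lemma tensor_sum_dense:
  fixes f :: "(nat \<Rightarrow> 'a) \<Rightarrow> real"
  assumes f: "continuous_map (pow_topology n) euclideanreal f" and e: "e > 0"
  shows "\<exists>ps. \<forall>x\<in>power_space n. \<bar>f x - tensor_sum n ps x\<bar> < e"
proof -
  define R where "R h \<longleftrightarrow> (\<exists>ps. h = tensor_sum n ps)" for h :: "(nat \<Rightarrow> 'a) \<Rightarrow> real"
  have "\<exists>g. R g \<and> (\<forall>x\<in>power_space n. \<bar>f x - g x\<bar> < e)"
  proof (rule Stone_Weierstrass_HOL[OF compact_power_space _ _ _ _ _ continuous_on_power_space[OF f] e])
    show "R (\<lambda>x. c)" for c
      unfolding R_def by (rule exI[of _ "[(c, \<lambda>_. one_bcontfun)]"])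
        (simp add: tensor_sum_def tensor_def fun_eq_iff const_bcontfun.rep_eq)
    show "continuous_on (power_space n) h" if Rh: "R h" for h
    proof -
      obtain ps where h: "h = tensor_sum n ps" using Rh unfolding R_def by blast
      show ?thesis unfolding h
      proof (induction ps)
        case (Cons p ps)
        have "continuous_on (power_space n) (\<lambda>x :: nat \<Rightarrow> 'a. fst p * tensor n (snd p) x + tensor_sum n ps x)"
          unfolding tensor_def
          by (intro continuous_intros Cons continuous_apply_bcontfun_compose
              continuous_on_subset[OF continuous_on_product_coordinates]) auto
        then show ?case by (simp add: tensor_sum_def[abs_def])
      qed (simp add: tensor_sum_def[abs_def])
    qed
    show "R (\<lambda>x. h x + g x)" if Rhg: "R h \<and> R g" for h g
    proof -
      obtain ps qs where "h = tensor_sum n ps" "g = tensor_sum n qs" using Rhg unfolding R_def by blast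
      then show ?thesis unfolding R_def by (intro exI[of _ "ps @ qs"]) (simp add: tensor_sum_def fun_eq_iff)
    qed
    show "R (\<lambda>x. h x * g x)" if Rhg: "R h \<and> R g" for h g
    proof -
      obtain ps qs where hg: "h = tensor_sum n ps" "g = tensor_sum n qs" using Rhg unfolding R_def by blast
      obtain rs where "\<And>x :: nat \<Rightarrow> 'a. tensor_sum n ps x * tensor_sum n qs x = tensor_sum n rs x"
        using tensor_sum_mult by blast
      then show ?thesis unfolding R_def hg by (intro exI[of _ rs]) (simp add: fun_eq_iff)
    qed
    show "\<exists>h. R h \<and> h x \<noteq> h y" if xy: "x \<in> power_space n \<and> y \<in> power_space n \<and> x \<noteq> y" for x y :: "nat \<Rightarrow> 'a"
    proof -
      obtain j where j: "j \<in> {1..n}" "x j \<noteq> y j"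
        using xy PiE_ext[of x "{1..n}" "\<lambda>_. UNIV" y] by blast
      \<comment> \<open>The distance to \<open>x j\<close> vanishes at x and not at y, hence
        separates the two tuples through coordinate j alone.\<close>
      define d where "d = Bcontfun (\<lambda>z. dist (x j) z)"
      have d: "apply_bcontfun d z = dist (x j) z" for z
      proof -
        have "continuous_on UNIV (\<lambda>z. dist (x j) z)" by (intro continuous_intros)
        then show ?thesis unfolding d_def by (simp add: apply_Bcontfun[OF compact_UNIV])
      qed
      define \<phi> where "\<phi> i = (if i = j then d else one_bcontfun)" for i
      have "tensor n \<phi> z = dist (x j) (z j)" for z
      proof -
        have "tensor n \<phi> z = (\<Prod>i\<in>{1..n}. if i = j then dist (x j) (z i) else 1)"
          unfolding tensor_def by (rule prod.cong) (auto simp: \<phi>_def d const_bcontfun.rep_eq)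
        also have "\<dots> = dist (x j) (z j)" using j(1) by (subst prod.delta) auto
        finally show ?thesis .
      qed
      then have "tensor_sum n [(1, \<phi>)] x \<noteq> tensor_sum n [(1, \<phi>)] y"
        using j(2) by (simp add: tensor_sum_def)
      then show ?thesis unfolding R_def by blast
    qed
  qed
  then show ?thesis unfolding R_def by blast
qed

lemma tensor_sum_sequence:
  fixes f :: "(nat \<Rightarrow> 'a) \<Rightarrow> real"
  assumes "continuous_map (pow_topology n) euclideanreal f"
  obtains ps where "\<And>k x. x \<in> power_space n \<Longrightarrow> \<bar>f x - tensor_sum n (ps k) x\<bar> \<le> 1 / real (Suc k)"
proof -
  have "\<exists>ps. \<forall>x\<in>power_space n. \<bar>f x - tensor_sum n ps x\<bar> < 1 / real (Suc k)" for k
    by (rule tensor_sum_dense[OF assms]) simp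
  then obtain ps where "\<And>k x. x \<in> power_space n \<Longrightarrow> \<bar>f x - tensor_sum n (ps k) x\<bar> < 1 / real (Suc k)" by metis
  then show thesis by (intro that[of ps] less_imp_le)
qed

text \<open>A uniform limit of tensor sums, each of which is measurable for the product
  sigma-algebra by construction.\<close>

lemma continuous_pow_measurable:
  fixes f :: "(nat \<Rightarrow> 'a) \<Rightarrow> real"
  assumes f: "continuous_map (pow_topology n) euclideanreal f"
  shows "f \<in> borel_measurable (borel_pow n)"
proof -
  obtain ps where ps: "\<And>k x. x \<in> power_space n \<Longrightarrow> \<bar>f x - tensor_sum n (ps k) x\<bar> \<le> 1 / real (Suc k)"
    using tensor_sum_sequence[OF f] by blast
  show ?thesis
  proof (rule borel_measurable_LIMSEQ_real[OF _ tensor_sum_measurable])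
    fix x assume "x \<in> space (borel_pow n :: (nat \<Rightarrow> 'a) measure)"
    then have x: "x \<in> power_space n" by (simp add: space_PiM)
    have "(\<lambda>k. tensor_sum n (ps k) x - f x) \<longlonglongrightarrow> 0"
    proof (rule Lim_null_comparison)
      show "\<forall>\<^sub>F k in sequentially. norm (tensor_sum n (ps k) x - f x) \<le> 1 / real (Suc k)"
        using ps[OF x] by (auto simp: abs_minus_commute intro!: always_eventually less_imp_le)
      show "(\<lambda>k. 1 / real (Suc k)) \<longlonglongrightarrow> 0" by (intro LIMSEQ_Suc lim_1_over_n)
    qed
    then show "(\<lambda>k. tensor_sum n (ps k) x) \<longlonglongrightarrow> f x" by (rule LIM_zero_cancel)
  qed
qed

lemma continuous_pow_bounded:
  fixes f :: "(nat \<Rightarrow> 'a) \<Rightarrow> real"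
  assumes f: "continuous_map (pow_topology n) euclideanreal f"
  shows "\<exists>B. \<forall>x\<in>power_space n. \<bar>f x\<bar> \<le> B"
proof -
  have "compact (f ` power_space n)"
    by (rule compact_continuous_image[OF continuous_on_power_space[OF f] compact_power_space])
  then have "bounded (f ` power_space n)" by (rule compact_imp_bounded)
  then obtain B where "\<forall>y\<in>f ` power_space n. norm y \<le> B"
    unfolding bounded_iff by (rule exE)
  then have "\<forall>x\<in>power_space n. \<bar>f x\<bar> \<le> B" by simp
  then show ?thesis by (rule exI)
qed

lemma mixture_integrable_continuous:
  fixes f :: "(nat \<Rightarrow> 'a) \<Rightarrow> real"
  assumes f: "continuous_map (pow_topology n) euclideanreal f"
  shows "mixture_integrable n f \<kappa>"
proof -
  let ?M = "\<lambda>t. PiM {1..n} (\<lambda>i. rep_kernels \<kappa> (t i))" and ?L = "PiM {1..n} (\<lambda>_. lborel :: real measure)"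
  let ?T = "\<lambda>f t. indicator (ordered_simplex n) t * (LINT x|?M t. f x)"
  obtain B where B: "\<And>x. x \<in> power_space n \<Longrightarrow> \<bar>f x\<bar> \<le> B" using continuous_pow_bounded[OF f] by blast
  have fi: "integrable (?M t) f" if t: "t \<in> ordered_simplex n" for t
  proof -
    note M = kernel_power_measure[OF is_kernel_rep t, of \<kappa>]
    interpret prob_space "?M t" by (rule M(1))
    have "f \<in> borel_measurable (?M t)"
      unfolding measurable_cong_sets[OF M(2) refl] by (rule continuous_pow_measurable[OF f])
    then show ?thesis
    proof (rule integrable_const_bound[where B=B, rotated])
      show "AE x in ?M t. norm (f x) \<le> B" by (rule AE_I2) (use B in \<open>simp only: M(3) real_norm_def\<close>)
    qed
  qed
  obtain ps where ps: "\<And>k x. x \<in> power_space n \<Longrightarrow> \<bar>f x - tensor_sum n (ps k) x\<bar> \<le> 1 / real (Suc k)"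
    using tensor_sum_sequence[OF f] by blast
  note mi = mixture_integrable_tensor_sum(1)[of n "ps k" \<kappa> for k]
  \<comment> \<open>The measure of the inner integral varies with t. Measurability is known for
    tensor sums, where that integral factorizes, and passes to the uniform limit.\<close>
  have Tm: "?T f \<in> borel_measurable ?L"
  proof (rule borel_measurable_LIMSEQ_real)
    show "?T (tensor_sum n (ps k)) \<in> borel_measurable ?L" for k
      using mi[of k] unfolding mixture_integrable_def by (intro borel_measurable_integrable) blast
    show "(\<lambda>k. ?T (tensor_sum n (ps k)) t) \<longlonglongrightarrow> ?T f t" for t
    proof (cases "t \<in> ordered_simplex n")
      case True
      note M = kernel_power_measure[OF is_kernel_rep True, of \<kappa>]
      have gi: "integrable (?M t) (tensor_sum n (ps k))" for k
        using mi[of k] True by (auto simp: mixture_integrable_def)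
      have "\<bar>(LINT x|?M t. tensor_sum n (ps k) x) - (LINT x|?M t. f x)\<bar> \<le> 1 / real (Suc k)" for k
      proof (rule prob_integral_diff_le[OF M(1) gi fi[OF True]])
        fix x assume "x \<in> space (?M t)"
        then have "x \<in> power_space n" by (simp only: M(3))
        from ps[OF this, of k] show "\<bar>tensor_sum n (ps k) x - f x\<bar> \<le> 1 / real (Suc k)"
          by (simp add: abs_minus_commute)
      qed
      then have "(\<lambda>k. (LINT x|?M t. tensor_sum n (ps k) x) - (LINT x|?M t. f x)) \<longlonglongrightarrow> 0"
        by (intro Lim_null_comparison[OF _ LIMSEQ_Suc[OF lim_1_over_n]]) auto
      then show ?thesis using True by (simp add: LIM_zero_cancel)
    qed simp
  qed
  have "integrable ?L (?T f)"
  proof (rule Bochner_Integration.integrable_bound[OF integrable_mult_right[OF simplex_volume(1)] Tm])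
    show "AE t in ?L. norm (?T f t) \<le> norm (B * indicator (ordered_simplex n) t)"
    proof (rule AE_I2)
      fix t
      show "norm (?T f t) \<le> norm (B * indicator (ordered_simplex n) t)"
      proof (cases "t \<in> ordered_simplex n")
        case True
        note M = kernel_power_measure[OF is_kernel_rep True, of \<kappa>]
        have "\<bar>(LINT x|?M t. f x) - (LINT x|?M t. 0)\<bar> \<le> B"
          by (rule prob_integral_diff_le[OF M(1) fi[OF True]]) (use B in \<open>simp_all only: M(3) diff_zero integrable_zero\<close>)
        then show ?thesis using True by simp
      qed simp
    qed
  qed
  then show ?thesis using fi unfolding mixture_integrable_def by blast
qed

end

section \<open>Determination of the mixing measure\<close>

lemma word_of_list: "w = word (\<lambda>i. w ! (length w - i)) (length w)"
  by (rule nth_equalityI) (auto simp: word_def rev_nth simp del: upt_Suc)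

lemma continuous_map_tensor: "continuous_map (pow_topology n) euclideanreal (tensor n \<phi>)"
proof -
  have "continuous_map (pow_topology n) euclideanreal (\<lambda>x. \<Prod>i\<in>I. apply_bcontfun (\<phi> i) (x i))"
    if "finite I" "I \<subseteq> {1..n}" for I
    using that
  proof (induction I rule: finite_induct)
    case (insert i I)
    have "continuous_map (pow_topology n) euclidean (\<lambda>x. x i)"
      using insert.prems by (intro continuous_map_product_projection) auto
    then have "continuous_map (pow_topology n) euclideanreal (apply_bcontfun (\<phi> i) \<circ> (\<lambda>x. x i))"
      by (rule continuous_map_compose) simp
    then show ?case using insert by (simp add: o_def continuous_map_real_mult)
  qed simp
  from this[of "{1..n}"] show ?thesis by (simp add: tensor_def[abs_def])
qed

context
  assumes compact_UNIV: "compact (UNIV :: 'a::metric_space set)"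
begin

lemma iterated_integral_borel:
  "(\<lambda>\<kappa> :: 'a kernels. iterated_integral (rep_kernels \<kappa>) w 1) \<in> borel_measurable borel"
  by (rule borel_measurable_continuous_onI[OF continuous_iterated_integral[OF compact_UNIV]])

lemma iterated_integral_integrable:
  fixes P :: "'a kernels measure"
  assumes P: "prob_space P" "sets P = sets borel"
  shows "integrable P (\<lambda>\<kappa>. iterated_integral (rep_kernels \<kappa>) w 1)"
proof -
  interpret prob_space P by fact
  show ?thesis
  proof (rule integrable_const_bound[where B="word_norm w"])
    show "AE \<kappa> in P. norm (iterated_integral (rep_kernels \<kappa>) w 1) \<le> word_norm w"
    proof (rule AE_I2)
      show "norm (iterated_integral (rep_kernels \<kappa>) w 1) \<le> word_norm w" for \<kappa> :: "'a kernels"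
        using iterated_integral_le[OF is_kernel_rep[of \<kappa>], of 1 w] by simp
    qed
    show "(\<lambda>\<kappa>. iterated_integral (rep_kernels \<kappa>) w 1) \<in> borel_measurable P"
      unfolding measurable_cong_sets[OF P(2) refl] by (rule iterated_integral_borel)
  qed
qed

lemma simplex_mixture_borel:
  assumes f: "continuous_map (pow_topology n) euclideanreal f"
  shows "(\<lambda>\<kappa> :: 'a kernels. simplex_mixture n f \<kappa>) \<in> borel_measurable borel"
proof -
  obtain ps where ps: "\<And>k x. x \<in> power_space n \<Longrightarrow> \<bar>f x - tensor_sum n (ps k) x\<bar> \<le> 1 / real (Suc k)"
    using tensor_sum_sequence[OF compact_UNIV f] by blast
  show ?thesis
  proof (rule borel_measurable_LIMSEQ_real)
    show "simplex_mixture n (tensor_sum n ps) \<in> borel_measurable borel" for ps :: "(real \<times> (nat \<Rightarrow> ('a \<Rightarrow>\<^sub>C real))) list"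
      unfolding mixture_integrable_tensor_sum(2)[abs_def]
    proof (induction ps)
      case (Cons p ps)
      have "(\<lambda>\<kappa> :: 'a kernels. fst p * (fact n * iterated_integral (rep_kernels \<kappa>) (word (snd p) n) 1) +
          (\<Sum>p\<leftarrow>ps. fst p * (fact n * iterated_integral (rep_kernels \<kappa>) (word (snd p) n) 1))) \<in> borel_measurable borel"
        by (intro borel_measurable_add borel_measurable_times borel_measurable_const iterated_integral_borel Cons)
      then show ?case by simp
    qed simp
    fix \<kappa> :: "'a kernels"
    have "(\<lambda>k. simplex_mixture n (tensor_sum n (ps k)) \<kappa> - simplex_mixture n f \<kappa>) \<longlonglongrightarrow> 0"
    proof (rule Lim_null_comparison[OF _ LIMSEQ_Suc[OF lim_1_over_n]])
      have "\<bar>simplex_mixture n (tensor_sum n (ps k)) \<kappa> - simplex_mixture n f \<kappa>\<bar> \<le> 1 / real (Suc k)" for k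
        by (rule simplex_mixture_diff_le[OF mixture_integrable_tensor_sum(1) mixture_integrable_continuous[OF compact_UNIV f]])
          (use ps[of _ k] in \<open>simp add: abs_minus_commute\<close>)
      then show "\<forall>\<^sub>F k in sequentially. norm (simplex_mixture n (tensor_sum n (ps k)) \<kappa> - simplex_mixture n f \<kappa>) \<le> 1 / real (Suc k)"
        by simp
    qed
    then show "(\<lambda>k. simplex_mixture n (tensor_sum n (ps k)) \<kappa>) \<longlonglongrightarrow> simplex_mixture n f \<kappa>" by (rule LIM_zero_cancel)
  qed
qed

text \<open>Both sides are linear on tensor sums and change by at most e under a uniform
  perturbation of size e, so density extends the identity to every continuous f.\<close>

lemma mixture_identity_extend:
  fixes P :: "'a kernels measure"
  assumes P: "prob_space P" "sets P = sets borel" and M: "prob_space M" "sets M = sets (borel_pow n)"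
    and eq: "\<And>\<phi>. (LINT \<kappa>|P. fact n * iterated_integral (rep_kernels \<kappa>) (word \<phi> n) 1) = (LINT x|M. tensor n \<phi> x)"
    and f: "continuous_map (pow_topology n) euclideanreal f"
  shows "(LINT x|M. f x) = (LINT \<kappa>|P. simplex_mixture n f \<kappa>)"
proof -
  interpret P: prob_space P by fact
  interpret M: prob_space M by fact
  have spM: "space M = power_space n" using sets_eq_imp_space_eq[OF M(2)] by (simp add: space_PiM)
  have tm: "integrable M (tensor n \<phi>)" for \<phi> :: "nat \<Rightarrow> ('a \<Rightarrow>\<^sub>C real)"
  proof (rule M.integrable_const_bound)
    show "AE x in M. norm (tensor n \<phi> x) \<le> (\<Prod>i\<in>{1..n}. norm (\<phi> i))"
      by (rule AE_I2) (simp only: real_norm_def tensor_le)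
    show "tensor n \<phi> \<in> borel_measurable M"
      unfolding measurable_cong_sets[OF M(2) refl] by (rule tensor_measurable)
  qed
  have fmM: "f \<in> borel_measurable M"
    unfolding measurable_cong_sets[OF M(2) refl] by (rule continuous_pow_measurable[OF compact_UNIV f])
  obtain B where B: "\<forall>x\<in>power_space n. \<bar>f x\<bar> \<le> B" using continuous_pow_bounded[OF compact_UNIV f] by blast
  have fM: "integrable M f"
  proof (rule M.integrable_const_bound[OF _ fmM])
    show "AE x in M. norm (f x) \<le> B" by (rule AE_I2) (use B in \<open>simp only: spM real_norm_def\<close>)
  qed
  have ts: "integrable M (tensor_sum n ps) \<and> integrable P (simplex_mixture n (tensor_sum n ps)) \<and>
      (LINT x|M. tensor_sum n ps x) = (LINT \<kappa>|P. simplex_mixture n (tensor_sum n ps) \<kappa>)" for ps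
    unfolding mixture_integrable_tensor_sum(2)[abs_def] unfolding tensor_sum_def[abs_def]
  proof (induction ps)
    case (Cons p ps)
    have i: "integrable M (\<lambda>x. fst p * tensor n (snd p) x)"
      "integrable P (\<lambda>\<kappa>. fst p * (fact n * iterated_integral (rep_kernels \<kappa>) (word (snd p) n) 1))"
      by (intro integrable_mult_right tm iterated_integral_integrable P)+
    have e: "(LINT x|M. fst p * tensor n (snd p) x) = (LINT \<kappa>|P. fst p * (fact n * iterated_integral (rep_kernels \<kappa>) (word (snd p) n) 1))"
      unfolding Bochner_Integration.integral_mult_right_zero[of _ "fst p"] eq ..
    show ?case
      using Cons i e by (simp only: list.map sum_list.Cons) (simp add: Bochner_Integration.integral_add)
  qed simp
  have "\<bar>(LINT x|M. f x) - (LINT \<kappa>|P. simplex_mixture n f \<kappa>)\<bar> \<le> 2 * e" if e: "e > 0" for e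
  proof -
    obtain ps where ps: "\<And>x. x \<in> power_space n \<Longrightarrow> \<bar>f x - tensor_sum n ps x\<bar> < e"
      using tensor_sum_dense[OF compact_UNIV f e] by blast
    have d: "\<bar>simplex_mixture n f \<kappa> - simplex_mixture n (tensor_sum n ps) \<kappa>\<bar> \<le> e" for \<kappa>
      by (rule simplex_mixture_diff_le[OF mixture_integrable_continuous[OF compact_UNIV f] mixture_integrable_tensor_sum(1)])
        (use ps in \<open>simp add: less_imp_le\<close>)
    have mP: "simplex_mixture n f \<in> borel_measurable P"
      unfolding measurable_cong_sets[OF P(2) refl] by (rule simplex_mixture_borel[OF f])
    have iP: "integrable P (\<lambda>\<kappa>. simplex_mixture n f \<kappa> - simplex_mixture n (tensor_sum n ps) \<kappa>)"
    proof (rule P.integrable_const_bound[where B=e])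
      show "(\<lambda>\<kappa>. simplex_mixture n f \<kappa> - simplex_mixture n (tensor_sum n ps) \<kappa>) \<in> borel_measurable P"
        using mP ts[of ps] by (intro borel_measurable_diff) auto
    qed (use d in simp)
    have iPf: "integrable P (simplex_mixture n f)"
      using Bochner_Integration.integrable_add[OF iP, of "simplex_mixture n (tensor_sum n ps)"] ts[of ps] by simp
    have 1: "\<bar>(LINT \<kappa>|P. simplex_mixture n f \<kappa>) - (LINT \<kappa>|P. simplex_mixture n (tensor_sum n ps) \<kappa>)\<bar> \<le> e"
      by (rule prob_integral_diff_le[OF P(1) iPf]) (use ts[of ps] d in auto)
    have 2: "\<bar>(LINT x|M. f x) - (LINT x|M. tensor_sum n ps x)\<bar> \<le> e"
      by (rule prob_integral_diff_le[OF M(1) fM]) (use ts[of ps] ps in \<open>auto simp: spM less_imp_le\<close>)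
    show ?thesis using 1 2 conjunct2[OF conjunct2[OF ts[of ps]]] by linarith
  qed
  \<comment> \<open>With e a quarter of the difference, the estimate bounds the difference by half
    of itself.\<close>
  from this[of "\<bar>(LINT x|M. f x) - (LINT \<kappa>|P. simplex_mixture n f \<kappa>)\<bar> / 4"] show ?thesis
    by (cases "(LINT x|M. f x) = (LINT \<kappa>|P. simplex_mixture n f \<kappa>)") auto
qed

text \<open>The comparison takes place on the image of the moments, a compact metrizable set.
  Equality of the image measures suffices, since every open set of kernels is a preimage under the
  moments.\<close>

lemma iterated_integrals_determine_measure:
  fixes P P' :: "'a kernels measure"
  assumes P: "prob_space P" "sets P = sets borel" and P': "prob_space P'" "sets P' = sets borel"
    and eq: "\<And>w. (LINT \<kappa>|P. iterated_integral (rep_kernels \<kappa>) w 1) = (LINT \<kappa>|P'. iterated_integral (rep_kernels \<kappa>) w 1)"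
  shows "P = P'"
proof -
  obtain c :: "nat \<Rightarrow> ('a \<Rightarrow>\<^sub>C real)" where c: "\<And>f e. e > 0 \<Longrightarrow> \<exists>j. norm (f - c j) < e"
    using dense_continuous_functions[OF compact_UNIV] by metis
  interpret P: prob_space P by fact
  interpret P': prob_space P' by fact
  define S where "S = range (moments c)"
  have S: "compact S" unfolding S_def by (rule compact_range_moments[OF compact_UNIV])
  have inj: "inj (moments c)" using moments_inject[OF compact_UNIV c] by (auto simp: inj_on_def)
  have mom: "moments c \<in> borel_measurable borel"
    by (rule borel_measurable_continuous_onI[OF continuous_moments])
  have momP: "moments c \<in> borel_measurable P" "moments c \<in> borel_measurable P'"
    unfolding measurable_cong_sets[OF P(2) refl] measurable_cong_sets[OF P'(2) refl] by (rule mom)+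
  define I where "I w \<kappa> = iterated_integral (rep_kernels \<kappa>) w 1" for w and \<kappa> :: "'a kernels"
  \<comment> \<open>Linear combinations of iterated integrals; the shuffle product makes them an
    algebra (\<open>ev_mult\<close>), and every moment is one of them
    (\<open>moments_ev\<close>).\<close>
  define ev where "ev ps \<kappa> = (\<Sum>p\<leftarrow>ps. fst p * I (snd p) \<kappa>)" for ps and \<kappa> :: "'a kernels"
  have I_int: "integrable P (I w)" "integrable P' (I w)" for w
    unfolding I_def[abs_def] by (rule iterated_integral_integrable P P')+
  have ev_int: "integrable P (ev ps) \<and> integrable P' (ev ps) \<and> integral\<^sup>L P (ev ps) = integral\<^sup>L P' (ev ps)" for ps
    unfolding ev_def[abs_def]
  proof (induction ps)
    case (Cons p ps)
    have "integral\<^sup>L P (I (snd p)) = integral\<^sup>L P' (I (snd p))" unfolding I_def[abs_def] by (rule eq)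
    then show ?case using Cons I_int[of "snd p"] by simp
  qed simp
  have ev_mult: "\<exists>rs. \<forall>\<kappa>. ev ps \<kappa> * ev qs \<kappa> = ev rs \<kappa>" for ps qs
  proof (induction ps)
    case Nil
    then show ?case by (intro exI[of _ "[]"]) (simp add: ev_def)
  next
    case (Cons p ps)
    then obtain rs where rs: "\<And>\<kappa>. ev ps \<kappa> * ev qs \<kappa> = ev rs \<kappa>" by blast
    have "\<exists>ss. \<forall>\<kappa>. fst p * I (snd p) \<kappa> * ev qs \<kappa> = ev ss \<kappa>"
    proof (induction qs)
      case Nil
      then show ?case by (intro exI[of _ "[]"]) (simp add: ev_def)
    next
      case (Cons q qs)
      then obtain ss where ss: "\<And>\<kappa>. fst p * I (snd p) \<kappa> * ev qs \<kappa> = ev ss \<kappa>" by blast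
      obtain ws where "\<forall>m s. is_kernel m \<longrightarrow> s \<in> {0..1} \<longrightarrow> iterated_integral m (snd p) s * iterated_integral m (snd q) s
          = (\<Sum>w\<leftarrow>ws. iterated_integral m w s)"
        using iterated_integral_mult[of "snd p" "snd q"] by blast
      then have ws: "I (snd p) \<kappa> * I (snd q) \<kappa> = (\<Sum>w\<leftarrow>ws. I w \<kappa>)" for \<kappa>
        unfolding I_def using is_kernel_rep[of \<kappa>] by simp
      have "fst p * I (snd p) \<kappa> * ev (q # qs) \<kappa> = ev (map (\<lambda>w. (fst p * fst q, w)) ws @ ss) \<kappa>" for \<kappa>
      proof -
        have "fst p * I (snd p) \<kappa> * ev (q # qs) \<kappa> = fst p * fst q * (I (snd p) \<kappa> * I (snd q) \<kappa>) + ev ss \<kappa>"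
        proof -
          have "ev (q # qs) \<kappa> = fst q * I (snd q) \<kappa> + ev qs \<kappa>" by (simp add: ev_def)
          then show ?thesis using ss[of \<kappa>] by (simp add: algebra_simps)
        qed
        also have "\<dots> = ev (map (\<lambda>w. (fst p * fst q, w)) ws @ ss) \<kappa>"
          unfolding ws by (simp add: ev_def o_def sum_list_const_mult)
        finally show ?thesis .
      qed
      then show ?case by blast
    qed
    then obtain ss where "\<And>\<kappa>. fst p * I (snd p) \<kappa> * ev qs \<kappa> = ev ss \<kappa>" by blast
    then have "ev (p # ps) \<kappa> * ev qs \<kappa> = ev (ss @ rs) \<kappa>" for \<kappa>
      using rs[of \<kappa>] by (simp add: ev_def distrib_right)
    then show ?case by blast
  qed
  have ev_cont: "continuous_on UNIV (ev ps)" for ps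
    unfolding ev_def[abs_def]
  proof (induction ps)
    case (Cons p ps)
    have "continuous_on UNIV (\<lambda>\<kappa>. fst p * I (snd p) \<kappa> + (\<Sum>p\<leftarrow>ps. fst p * I (snd p) \<kappa>))"
      by (intro continuous_on_add continuous_on_mult_left Cons continuous_iterated_integral[OF compact_UNIV, folded I_def])
    then show ?case by simp
  qed simp
  have moments_ev: "\<exists>ps. \<forall>\<kappa>. moments c \<kappa> l = ev ps \<kappa>" for l
  proof (intro exI allI)
    show "moments c \<kappa> l = ev (map (\<lambda>i. (fact i, c (l ! i) # replicate i one_bcontfun)) [0..<length l]) \<kappa>" for \<kappa>
      unfolding moments_eq_iterated_integrals ev_def I_def
      by (simp add: o_def sum_list_sum_nth atLeast0LessThan)
  qed
  have distr_eq: "distr P borel (moments c) = distr P' borel (moments c)"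
  proof (rule measure_eqI_continuous)
    show "prob_space (distr P borel (moments c))" "prob_space (distr P' borel (moments c))"
      by (rule P.prob_space_distr P'.prob_space_distr, rule momP)+
    fix f :: "(nat list \<Rightarrow> real) \<Rightarrow> real"
    assume f: "continuous_on UNIV f" "\<And>x. 0 \<le> f x" "\<And>x. f x \<le> 1"
    have fm: "f \<in> borel_measurable borel" using f(1) by (rule borel_measurable_continuous_onI)
    let ?J = "\<lambda>\<kappa>. f (moments c \<kappa>)"
    have Jm: "?J \<in> borel_measurable P" "?J \<in> borel_measurable P'"
      by (rule measurable_compose[OF _ fm], rule momP)+
    have Ji: "integrable P ?J" "integrable P' ?J"
      by (rule P.integrable_const_bound[where B=1] P'.integrable_const_bound[where B=1]; use Jm f in simp)+
    have "\<bar>integral\<^sup>L P ?J - integral\<^sup>L P' ?J\<bar> \<le> 2 * e" if e: "e > 0" for e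
    proof -
      \<comment> \<open>Equality is required on \<open>S\<close> only: off the image of the moments,
        \<open>inv\<close> has no meaning.\<close>
      define R where "R h \<longleftrightarrow> (\<exists>ps. \<forall>v\<in>S. h v = ev ps (inv (moments c) v))" for h :: "(nat list \<Rightarrow> real) \<Rightarrow> real"
      have "\<exists>g. R g \<and> (\<forall>v\<in>S. \<bar>f v - g v\<bar> < e)"
      proof (rule Stone_Weierstrass_HOL[OF S _ _ _ _ _ continuous_on_subset[OF f(1) subset_UNIV] e])
        \<comment> \<open>The empty word is the constant 1.\<close>
        show "R (\<lambda>v. a)" for a unfolding R_def by (rule exI[of _ "[(a, [])]"]) (simp add: ev_def I_def)
        show "continuous_on S h" if Rh: "R h" for h
        proof -
          obtain ps where h: "\<forall>v\<in>S. h v = ev ps (inv (moments c) v)" using Rh unfolding R_def by blast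
          have "continuous_on S (\<lambda>v. ev ps (inv (moments c) v))"
            unfolding S_def by (rule continuous_on_compose2[OF ev_cont continuous_on_inv_moments[OF compact_UNIV c]]) auto
          then show ?thesis using h by (simp cong: continuous_on_cong)
        qed
        show "R (\<lambda>v. h v + g v)" if Rhg: "R h \<and> R g" for h g
        proof -
          obtain ps qs where "\<forall>v\<in>S. h v = ev ps (inv (moments c) v)" "\<forall>v\<in>S. g v = ev qs (inv (moments c) v)"
            using Rhg unfolding R_def by blast
          then show ?thesis unfolding R_def by (intro exI[of _ "ps @ qs"]) (simp add: ev_def)
        qed
        show "R (\<lambda>v. h v * g v)" if Rhg: "R h \<and> R g" for h g
        proof -
          obtain ps qs where "\<forall>v\<in>S. h v = ev ps (inv (moments c) v)" "\<forall>v\<in>S. g v = ev qs (inv (moments c) v)"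
            using Rhg unfolding R_def by blast
          moreover obtain rs where "\<forall>\<kappa>. ev ps \<kappa> * ev qs \<kappa> = ev rs \<kappa>" using ev_mult by blast
          ultimately show ?thesis unfolding R_def by (intro exI[of _ rs]) simp
        qed
        show "\<exists>h. R h \<and> h v \<noteq> h v'" if vv: "v \<in> S \<and> v' \<in> S \<and> v \<noteq> v'" for v v'
        proof -
          obtain l where l: "v l \<noteq> v' l" using vv by (auto simp: fun_eq_iff)
          obtain ps where ps: "\<forall>\<kappa>. moments c \<kappa> l = ev ps \<kappa>" using moments_ev by blast
          have "R (\<lambda>v. v l)"
            unfolding R_def using ps inj by (intro exI[of _ ps]) (auto simp: S_def)
          with l show ?thesis by blast
        qed
      qed
      then obtain g ps where ps: "\<And>v. v \<in> S \<Longrightarrow> g v = ev ps (inv (moments c) v)" and g: "\<And>v. v \<in> S \<Longrightarrow> \<bar>f v - g v\<bar> < e"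
        unfolding R_def by blast
      have d: "\<bar>?J \<kappa> - ev ps \<kappa>\<bar> \<le> e" for \<kappa>
      proof -
        have "moments c \<kappa> \<in> S" by (simp add: S_def)
        from g[OF this] ps[OF this] inj show ?thesis by simp
      qed
      have "\<bar>integral\<^sup>L P ?J - integral\<^sup>L P (ev ps)\<bar> \<le> e"
        by (rule prob_integral_diff_le[OF P(1) Ji(1) _ d]) (use ev_int[of ps] in blast)
      moreover have "\<bar>integral\<^sup>L P' ?J - integral\<^sup>L P' (ev ps)\<bar> \<le> e"
        by (rule prob_integral_diff_le[OF P'(1) Ji(2) _ d]) (use ev_int[of ps] in blast)
      ultimately show ?thesis
        using ev_int[of ps] by linarith
    qed
    from this[of "\<bar>integral\<^sup>L P ?J - integral\<^sup>L P' ?J\<bar> / 4"] have "integral\<^sup>L P ?J = integral\<^sup>L P' ?J"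
      by (cases "integral\<^sup>L P ?J = integral\<^sup>L P' ?J") auto
    then show "integral\<^sup>L (distr P borel (moments c)) f = integral\<^sup>L (distr P' borel (moments c)) f"
      by (simp add: integral_distr[OF momP(1) fm] integral_distr[OF momP(2) fm])
  qed simp_all
  show ?thesis
  proof (rule measure_eqI_generator_eq[where E="{U. open U}" and \<Omega>=UNIV and A="\<lambda>_. UNIV"])
    show "emeasure P U = emeasure P' U" if U: "U \<in> {U. open U}" for U
    proof -
      obtain V where V: "open V" "U = moments c -` V" using open_moments_vimage[OF compact_UNIV c] U by blast
      have "emeasure P U = emeasure (distr P borel (moments c)) V"
        using V sets_eq_imp_space_eq[OF P(2)] by (subst emeasure_distr[OF momP(1)]) auto
      also have "\<dots> = emeasure P' U"
        unfolding distr_eq using V sets_eq_imp_space_eq[OF P'(2)] by (subst emeasure_distr[OF momP(2)]) auto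
      finally show ?thesis .
    qed
    show "sets P = sigma_sets UNIV {U. open U}" "sets P' = sigma_sets UNIV {U. open U}"
      unfolding P P' borel_def by simp_all
    show "Int_stable {U :: 'a kernels set. open U}" by (auto simp: Int_stable_def)
    show "emeasure P UNIV \<noteq> \<infinity>" by (simp add: P.emeasure_eq_measure)
  qed auto
qed

end

section \<open>Existence and uniqueness\<close>

text \<open>Joint measurability in the tuple and the time suffices. The coordinate that is read
  depends on t through \<open>block_index\<close>, which takes finitely many values on
  [0,1].\<close>

lemma moments_empirical:
  assumes compact_UNIV: "compact (UNIV :: 'a::metric_space set)" and N: "N \<ge> 1"
  shows "(\<lambda>x. moments c (abs_kernels (empirical_kernel N x :: real \<Rightarrow> 'a measure))) \<in> borel_measurable (borel_pow N)"
proof (rule measurable_coordinatewise_then_product)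
  fix l
  have eq: "moments c (abs_kernels (empirical_kernel N x)) l
      = (LINT t|unit_lborel. (\<Sum>i<length l. t ^ i * apply_bcontfun (c (l ! i)) (x (block_index N t))))" for x :: "nat \<Rightarrow> 'a"
    unfolding moments_def
    unfolding pairing_abs_kernels[OF compact_UNIV is_kernel_empirical L1_cont_apply_measurable[OF poly_fun_L1_cont]]
    by (simp add: poly_fun_def scaleR_bcontfun.rep_eq)
  have b: "block_index N \<in> measurable unit_lborel (count_space {1..N})"
    using block_index_measurable[of N] block_index_range[OF N]
    by (auto simp: measurable_def)
  have tm: "(\<lambda>t. t) \<in> borel_measurable unit_lborel" by (intro borel_measurable_unit_lborel) simp
  have "(\<lambda>p. (snd p) ^ i * apply_bcontfun (c j) (fst p (block_index N (snd p)))) \<in> borel_measurable (borel_pow N \<Otimes>\<^sub>M unit_lborel)" for i j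
  proof (intro borel_measurable_times borel_measurable_power)
    show "snd \<in> borel_measurable (borel_pow N \<Otimes>\<^sub>M unit_lborel)"
      using measurable_compose[OF measurable_snd[of "borel_pow N" unit_lborel] tm] by simp
    show "(\<lambda>p. apply_bcontfun (c j) (fst p (block_index N (snd p)))) \<in> borel_measurable (borel_pow N \<Otimes>\<^sub>M unit_lborel)"
    proof (rule measurable_compose_countable'[where I="{1..N}" and f="\<lambda>k p. apply_bcontfun (c j) (fst p k)" and g="\<lambda>p. block_index N (snd p)"])
      show "(\<lambda>p. apply_bcontfun (c j) (fst p k)) \<in> borel_measurable (borel_pow N \<Otimes>\<^sub>M unit_lborel)" if "k \<in> {1..N}" for k
      proof -
        have "(\<lambda>x. apply_bcontfun (c j) (x k)) \<in> borel_measurable (borel_pow N)"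
          by (rule measurable_compose[OF measurable_component_singleton[of _ _ "\<lambda>_. borel", OF that]])
            (intro borel_measurable_continuous_onI continuous_on_apply_bcontfun)
        from measurable_compose[OF measurable_fst this] show ?thesis .
      qed
      show "(\<lambda>p. block_index N (snd p)) \<in> measurable (borel_pow N \<Otimes>\<^sub>M unit_lborel) (count_space {1..N})"
        by (rule measurable_compose[OF measurable_snd b])
    qed simp
  qed
  then have "(\<lambda>p. \<Sum>i<length l. (snd p) ^ i * apply_bcontfun (c (l ! i)) (fst p (block_index N (snd p)))) \<in> borel_measurable (borel_pow N \<Otimes>\<^sub>M unit_lborel)"
    by (intro borel_measurable_sum)
  then show "(\<lambda>x. moments c (abs_kernels (empirical_kernel N x)) l) \<in> borel_measurable (borel_pow N)"
    unfolding eq by (intro unit.borel_measurable_lebesgue_integral) (simp add: case_prod_beta')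
qed

text \<open>The expected iterated sum under \<mu> N is exactly the integral of the tensor under
  \<mu> n times a binomial coefficient. Errors arise only in passing from sums to integrals and in
  replacing the normalized binomial coefficient by 1/n!.\<close>

lemma thinning_limit:
  fixes \<mu> :: "nat \<Rightarrow> (nat \<Rightarrow> 'b::topological_space) measure"
  assumes \<mu>: "\<And>n. n \<ge> 1 \<Longrightarrow> prob_space (\<mu> n)" "\<And>n. n \<ge> 1 \<Longrightarrow> sets (\<mu> n) = sets (borel_pow n)"
    and thin: "\<And>k n. 1 \<le> k \<Longrightarrow> k \<le> n \<Longrightarrow> thinning n k (\<mu> n) = \<mu> k"
    and n: "n \<ge> 1"
    and meas: "\<And>N. N \<ge> 1 \<Longrightarrow> (\<lambda>x. iterated_integral (empirical_kernel N x) (word \<phi> n) 1) \<in> borel_measurable (\<mu> N)"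
  shows "(\<lambda>N. LINT x|\<mu> N. iterated_integral (empirical_kernel N x) (word \<phi> n) 1) \<longlonglongrightarrow> (LINT x|\<mu> n. tensor n \<phi> x) / fact n"
proof -
  let ?w = "word \<phi> n" and ?L = "LINT x|\<mu> n. tensor n \<phi> x"
  have est: "\<bar>(LINT x|\<mu> N. iterated_integral (empirical_kernel N x) ?w 1) - real (N choose n) / real N ^ n * ?L\<bar>
      \<le> word_norm ?w * real n / real N" if N: "N \<ge> n" for N
  proof -
    have N1: "N \<ge> 1" using N n by simp
    interpret prob_space "\<mu> N" by (rule \<mu>(1)[OF N1])
    have i: "integrable (\<mu> N) (\<lambda>x. iterated_integral (empirical_kernel N x) ?w 1)"
    proof (rule integrable_const_bound[OF _ meas[OF N1]])
      show "AE x in \<mu> N. norm (iterated_integral (empirical_kernel N x) ?w 1) \<le> word_norm ?w"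
      proof (rule AE_I2)
        show "norm (iterated_integral (empirical_kernel N x) ?w 1) \<le> word_norm ?w" for x
          using iterated_integral_le[OF is_kernel_empirical[of N x], of 1 ?w] by simp
      qed
    qed
    have ti: "integrable (\<mu> N) (\<lambda>x. tensor n \<phi> (\<lambda>j\<in>{1..n}. x (i j)))" if "i \<in> increasing_indices n N" for i
    proof (rule integrable_const_bound)
      show "AE x in \<mu> N. norm (tensor n \<phi> (\<lambda>j\<in>{1..n}. x (i j))) \<le> (\<Prod>i\<in>{1..n}. norm (\<phi> i))"
        by (rule AE_I2) (simp only: real_norm_def tensor_le)
      show "(\<lambda>x. tensor n \<phi> (\<lambda>j\<in>{1..n}. x (i j))) \<in> borel_measurable (\<mu> N)"
        unfolding measurable_cong_sets[OF \<mu>(2)[OF N1] refl]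
        by (rule measurable_compose[OF subsequence_measurable[OF that] tensor_measurable])
    qed
    have sum_eq: "iterated_sum x ?w N = (\<Sum>i\<in>increasing_indices n N. tensor n \<phi> (\<lambda>j\<in>{1..n}. x (i j)))" for x
      unfolding sum_increasing_indices[symmetric] tensor_def by simp
    have si: "integrable (\<mu> N) (\<lambda>x. iterated_sum x ?w N)"
      unfolding sum_eq by (rule Bochner_Integration.integrable_sum) (rule ti)
    have "?L = integral\<^sup>L (thinning N n (\<mu> N)) (tensor n \<phi>)" using thin[OF n N] by simp
    also have "\<dots> = (\<Sum>i\<in>increasing_indices n N. LINT x|\<mu> N. tensor n \<phi> (\<lambda>j\<in>{1..n}. x (i j))) / real (N choose n)"
      by (rule integral_thinning[OF \<mu>(1)[OF N1] \<mu>(2)[OF N1] N tensor_measurable tensor_le])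
    also have "(\<Sum>i\<in>increasing_indices n N. LINT x|\<mu> N. tensor n \<phi> (\<lambda>j\<in>{1..n}. x (i j))) = (LINT x|\<mu> N. iterated_sum x ?w N)"
      unfolding sum_eq by (rule Bochner_Integration.integral_sum[symmetric]) (rule ti)
    \<comment> \<open>The only use of thinning invariance, and an identity without error
      term.\<close>
    finally have L: "real (N choose n) * ?L = (LINT x|\<mu> N. iterated_sum x ?w N)"
      using N by simp
    have "real (N choose n) / real N ^ n * ?L = (LINT x|\<mu> N. iterated_sum x ?w N / real N ^ n)"
      by (simp flip: L)
    moreover have "\<bar>(LINT x|\<mu> N. iterated_integral (empirical_kernel N x) ?w 1) - (LINT x|\<mu> N. iterated_sum x ?w N / real N ^ n)\<bar>
        \<le> word_norm ?w * real n / real N"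
    proof (rule prob_integral_diff_le[OF \<mu>(1)[OF N1] i])
      show "integrable (\<mu> N) (\<lambda>x. iterated_sum x ?w N / real N ^ n)" using si by simp
      show "\<bar>iterated_integral (empirical_kernel N x) ?w 1 - iterated_sum x ?w N / real N ^ n\<bar> \<le> word_norm ?w * real n / real N" for x
        using iterated_sum_approx[OF N1 order_refl, of x ?w] N1 by (simp add: abs_minus_commute)
    qed
    ultimately show ?thesis by (simp only:)
  qed
  have "(\<lambda>N. (LINT x|\<mu> N. iterated_integral (empirical_kernel N x) ?w 1) - real (N choose n) / real N ^ n * ?L) \<longlonglongrightarrow> 0"
  proof (rule Lim_null_comparison)
    show "\<forall>\<^sub>F N in sequentially. norm ((LINT x|\<mu> N. iterated_integral (empirical_kernel N x) ?w 1) - real (N choose n) / real N ^ n * ?L)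
        \<le> word_norm ?w * real n / real N"
      unfolding eventually_sequentially using est by auto
    show "(\<lambda>N. word_norm ?w * real n / real N) \<longlonglongrightarrow> 0" by (rule lim_const_over_n)
  qed
  moreover have "(\<lambda>N. real (N choose n) / real N ^ n * ?L) \<longlonglongrightarrow> 1 / fact n * ?L"
    by (intro tendsto_mult binomial_limit tendsto_const)
  ultimately have "(\<lambda>N. ((LINT x|\<mu> N. iterated_integral (empirical_kernel N x) ?w 1) - real (N choose n) / real N ^ n * ?L)
      + real (N choose n) / real N ^ n * ?L) \<longlonglongrightarrow> 0 + 1 / fact n * ?L"
    by (rule tendsto_add)
  then show ?thesis by simp
qed

lemma mixing_measure_exists:
  fixes \<mu> :: "nat \<Rightarrow> (nat \<Rightarrow> 'a::metric_space) measure"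
  assumes compact_UNIV: "compact (UNIV :: 'a set)"
    and \<mu>: "\<And>n. n \<ge> 1 \<Longrightarrow> prob_space (\<mu> n)" "\<And>n. n \<ge> 1 \<Longrightarrow> sets (\<mu> n) = sets (borel_pow n)"
    and thin: "\<And>k n. 1 \<le> k \<Longrightarrow> k \<le> n \<Longrightarrow> thinning n k (\<mu> n) = \<mu> k"
  shows "\<exists>P :: 'a kernels measure. prob_space P \<and> sets P = sets borel \<and>
    (\<forall>n \<phi>. n \<ge> 1 \<longrightarrow> (LINT \<kappa>|P. fact n * iterated_integral (rep_kernels \<kappa>) (word \<phi> n) 1) = (LINT x|\<mu> n. tensor n \<phi> x))"
proof -
  obtain c :: "nat \<Rightarrow> ('a \<Rightarrow>\<^sub>C real)" where c: "\<And>f e. e > 0 \<Longrightarrow> \<exists>j. norm (f - c j) < e"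
    using dense_continuous_functions[OF compact_UNIV] by metis
  define S where "S = range (moments c)"
  have S: "compact S" unfolding S_def by (rule compact_range_moments[OF compact_UNIV])
  then have Sb: "S \<in> sets borel" by (intro borel_closed compact_imp_closed)
  have inj: "inj (moments c)" using moments_inject[OF compact_UNIV c] by (auto simp: inj_on_def)
  \<comment> \<open>Iterated integrals as functions of the moments, so that weak convergence on the
    image can be tested with them.\<close>
  define J where "J w v = iterated_integral (rep_kernels (inv (moments c) v)) w 1" for w v
  have J_cont: "continuous_on S (J w)" for w
    unfolding J_def S_def
    by (rule continuous_on_compose2[OF continuous_iterated_integral[OF compact_UNIV] continuous_on_inv_moments[OF compact_UNIV c]]) auto
  have J_m: "(\<lambda>v. indicator S v *\<^sub>R J w v) \<in> borel_measurable borel" for w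
    by (rule borel_measurable_continuous_on_indicator[OF Sb J_cont])
  define h where "h N x = moments c (abs_kernels (empirical_kernel N x))" for N and x :: "nat \<Rightarrow> 'a"
  have h_m: "h N \<in> borel_measurable (\<mu> N)" if "N \<ge> 1" for N
    unfolding h_def measurable_cong_sets[OF \<mu>(2)[OF that] refl] by (rule moments_empirical[OF compact_UNIV that])
  have J_h: "indicator S (h N x) *\<^sub>R J w (h N x) = iterated_integral (empirical_kernel N x) w 1" for N x w
  proof -
    have "J w (h N x) = iterated_integral (rep_kernels (abs_kernels (empirical_kernel N x))) w 1"
      using inj by (simp add: J_def h_def)
    also have "\<dots> = iterated_integral (empirical_kernel N x) w 1"
      by (rule iterated_integral_cong_AE[OF is_kernel_rep is_kernel_empirical rep_abs_kernels[OF is_kernel_empirical]])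
    finally show ?thesis by (simp add: S_def h_def)
  qed
  have meas: "(\<lambda>x. iterated_integral (empirical_kernel N x) w 1) \<in> borel_measurable (\<mu> N)" if "N \<ge> 1" for N w
    using measurable_compose[OF h_m[OF that] J_m[of w]] unfolding J_h .
  \<comment> \<open>The shift by one starts the sequence at N = 1, where the hypotheses on \<mu>
    begin.\<close>
  define R where "R N = distr (\<mu> (Suc N)) borel (h (Suc N))" for N
  have R: "prob_space (R N)" "sets (R N) = sets borel" for N
    unfolding R_def by (auto intro!: prob_space.prob_space_distr \<mu> h_m)
  have RS: "AE v in R N. v \<in> S" for N
  proof -
    have "{v \<in> space borel. v \<in> S} \<in> sets borel" using Sb by simp
    then show ?thesis unfolding R_def by (subst AE_distr_iff[OF h_m]) (auto simp: S_def h_def)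
  qed
  obtain r :: "nat \<Rightarrow> nat" and Q where r: "strict_mono r" and Q: "prob_space Q" "sets Q = sets borel"
    and QS: "AE v in Q. v \<in> S"
    and Qlim: "\<And>f :: (nat list \<Rightarrow> real) \<Rightarrow> real. continuous_on S f \<Longrightarrow> (\<lambda>k. LINT v:S|R (r k). f v) \<longlonglongrightarrow> (LINT v:S|Q. f v)"
    by (rule weak_sequential_compactness[where P=R, OF S R RS]) blast
  \<comment> \<open>The inverse of the moments is continuous on the compact set \<open>S\<close>
    only; a constant value elsewhere makes it Borel, and \<open>Q\<close> does not charge the
    complement of \<open>S\<close>.\<close>
  define g where "g v = (if v \<in> S then inv (moments c) v else undefined)" for v
  have g_b: "g \<in> borel_measurable borel"
    unfolding g_def
    by (rule borel_measurable_continuous_on_if[OF Sb])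
      (auto simp: S_def intro: continuous_on_inv_moments[OF compact_UNIV c])
  then have g_m: "g \<in> borel_measurable Q" unfolding measurable_cong_sets[OF Q(2) refl] .
  define P where "P = distr Q borel g"
  show ?thesis
  proof (intro exI[of _ P] conjI allI impI)
    show "prob_space P" unfolding P_def by (rule prob_space.prob_space_distr[OF Q(1) g_m])
    show "sets P = sets borel" by (simp add: P_def)
    fix n :: nat and \<phi> :: "nat \<Rightarrow> ('a \<Rightarrow>\<^sub>C real)" assume n: "n \<ge> 1"
    let ?w = "word \<phi> n"
    have "(LINT \<kappa>|P. iterated_integral (rep_kernels \<kappa>) ?w 1) = (LINT v|Q. iterated_integral (rep_kernels (g v)) ?w 1)"
      unfolding P_def by (rule integral_distr[OF g_m iterated_integral_borel[OF compact_UNIV]])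
    also have "\<dots> = (LINT v:S|Q. J ?w v)"
      unfolding set_lebesgue_integral_def
    proof (rule integral_cong_AE)
      show "(\<lambda>v. iterated_integral (rep_kernels (g v)) ?w 1) \<in> borel_measurable Q"
        by (rule measurable_compose[OF g_m iterated_integral_borel[OF compact_UNIV]])
      show "(\<lambda>v. indicator S v *\<^sub>R J ?w v) \<in> borel_measurable Q"
        unfolding measurable_cong_sets[OF Q(2) refl] by (rule J_m)
      show "AE v in Q. iterated_integral (rep_kernels (g v)) ?w 1 = indicator S v *\<^sub>R J ?w v"
        using QS by eventually_elim (simp add: g_def J_def)
    qed
    finally have P_eq: "(LINT \<kappa>|P. iterated_integral (rep_kernels \<kappa>) ?w 1) = (LINT v:S|Q. J ?w v)" .
    have "(LINT v:S|R N. J ?w v) = (LINT x|\<mu> (Suc N). iterated_integral (empirical_kernel (Suc N) x) ?w 1)" for N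
      unfolding set_lebesgue_integral_def R_def by (subst integral_distr[OF h_m J_m]) (simp_all only: J_h le_add1 Suc_eq_plus1 le_add2)
    moreover have "(\<lambda>k. LINT x|\<mu> (Suc (r k)). iterated_integral (empirical_kernel (Suc (r k)) x) ?w 1) \<longlonglongrightarrow> (LINT x|\<mu> n. tensor n \<phi> x) / fact n"
    proof -
      have "filterlim (\<lambda>k. Suc (r k)) sequentially sequentially"
        by (intro filterlim_compose[OF filterlim_Suc] filterlim_subseq r)
      from filterlim_compose[OF thinning_limit[OF \<mu> thin n meas] this] show ?thesis .
    qed
    ultimately have "(LINT v:S|Q. J ?w v) = (LINT x|\<mu> n. tensor n \<phi> x) / fact n"
      using Qlim[OF J_cont[of ?w]] LIMSEQ_unique by simp
    then show "(LINT \<kappa>|P. fact n * iterated_integral (rep_kernels \<kappa>) ?w 1) = (LINT x|\<mu> n. tensor n \<phi> x)"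
      using P_eq by simp
  qed
qed

theorem theorem1:
  fixes \<mu> :: "nat \<Rightarrow> (nat \<Rightarrow> 'a::metric_space) measure"
  assumes "compact (UNIV :: 'a set)"
    and "\<And>n. n \<ge> 1 \<Longrightarrow> \<mu> n \<in> space (prob_algebra (borel_pow n))"
    and "\<And>k n. 1 \<le> k \<Longrightarrow> k \<le> n \<Longrightarrow> thinning n k (\<mu> n) = \<mu> k"
  shows "\<exists>!P :: 'a kernels measure. P \<in> space (prob_algebra borel) \<and>
    (\<forall>n\<ge>1. \<forall>f. continuous_map (pow_topology n) euclideanreal f \<longrightarrow>
       (LINT x|\<mu> n. f x) = (LINT \<kappa>|P. simplex_mixture n f \<kappa>))"
proof -
  have \<mu>: "prob_space (\<mu> n)" "sets (\<mu> n) = sets (borel_pow n)" if "n \<ge> 1" for n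
    using assms(2)[OF that] by (auto simp: space_prob_algebra)
  obtain P :: "'a kernels measure" where P: "prob_space P" "sets P = sets borel"
    and P_eq: "\<And>n \<phi>. n \<ge> 1 \<Longrightarrow> (LINT \<kappa>|P. fact n * iterated_integral (rep_kernels \<kappa>) (word \<phi> n) 1) = (LINT x|\<mu> n. tensor n \<phi> x)"
    using mixing_measure_exists[of \<mu>, OF assms(1) \<mu> assms(3)] by blast
  have tensor_mixture: "(LINT \<kappa>|P'. simplex_mixture n (tensor n \<phi>) \<kappa>) = fact n * (LINT \<kappa>|P'. iterated_integral (rep_kernels \<kappa>) (word \<phi> n) 1)"
    for P' :: "'a kernels measure" and n \<phi>
    using simplex_mixture_prod[of n \<phi>] by (simp add: tensor_def[abs_def])
  show ?thesis
  proof (rule ex1I[of _ P])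
    show "P \<in> space (prob_algebra borel) \<and> (\<forall>n\<ge>1. \<forall>f. continuous_map (pow_topology n) euclideanreal f \<longrightarrow>
        (LINT x|\<mu> n. f x) = (LINT \<kappa>|P. simplex_mixture n f \<kappa>))"
      using P mixture_identity_extend[OF assms(1) P \<mu> P_eq] by (simp add: space_prob_algebra)
    fix P' :: "'a kernels measure"
    assume P': "P' \<in> space (prob_algebra borel) \<and> (\<forall>n\<ge>1. \<forall>f. continuous_map (pow_topology n) euclideanreal f \<longrightarrow>
        (LINT x|\<mu> n. f x) = (LINT \<kappa>|P'. simplex_mixture n f \<kappa>))"
    then have P'p: "prob_space P'" "sets P' = sets borel" by (auto simp: space_prob_algebra)
    show "P' = P"
    proof (rule iterated_integrals_determine_measure[OF assms(1) P'p P])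
      fix w :: "('a \<Rightarrow>\<^sub>C real) list"
      show "(LINT \<kappa>|P'. iterated_integral (rep_kernels \<kappa>) w 1) = (LINT \<kappa>|P. iterated_integral (rep_kernels \<kappa>) w 1)"
      \<comment> \<open>The mixture identity is assumed for n \<ge> 1 only. The empty word has
        integral 1 under any probability measure.\<close>
      proof (cases "w = []")
        case True
        then show ?thesis using prob_space.prob_space[OF P(1)] prob_space.prob_space[OF P'p(1)] by simp
      next
        case False
        define n where "n = length w"
        have n: "n \<ge> 1" using False by (cases w) (auto simp: n_def)
        obtain \<phi> where w: "w = word \<phi> n" unfolding n_def using word_of_list by blast
        have "fact n * (LINT \<kappa>|P'. iterated_integral (rep_kernels \<kappa>) w 1) = (LINT x|\<mu> n. tensor n \<phi> x)"
          using P' n continuous_map_tensor[of n \<phi>] tensor_mixture[of P' n \<phi>] by (simp add: w)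
        moreover have "fact n * (LINT \<kappa>|P. iterated_integral (rep_kernels \<kappa>) w 1) = (LINT x|\<mu> n. tensor n \<phi> x)"
          using P_eq[OF n, of \<phi>] by (simp add: w)
        ultimately show ?thesis by (metis fact_nonzero mult_left_cancel)
      qed
    qed
  qed
qed

end
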